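(* The equation for flat Lagrangian immersions in $\mathbb{C}^n$ with non-degenerate normal bundle is the $\frac{U(n)\ltimes\mathbb{C}^n}{O(n)\ltimes\mathbb{R}^n}$-system, with Lax pair $\theta_\lambda$. Precisely: let $\beta=(\beta_{ij})$ be a smooth real symmetric $n\times n$ matrix function with zero diagonal and $h=(h_1,\dots,h_n)^t$ a smooth $\mathbb{R}^n$-valued function with nowhere-vanishing entries, both on $\Omega$. The following are equivalent: (a) $(\beta,h)$ is the data of a flat Lagrangian immersion $f:\Omega\to\mathbb{C}^n$ with non-degenerate normal bundle, i.e. there is such an $f$ with fundamental forms $\mathrm{I}=\sum_i h_i^2\,du_i^2$, $\mathrm{II}=\sum_i du_i^2\otimes J(\partial f/\partial u_i)$, and $(h_i)_{u_j}=\beta_{ij}h_j$ for $i\neq j$; (b) $q=\begin{pmatrix}0&\beta&0\\-\beta&0&-h\\0&0&0\end{pmatrix}$ solves the $\frac{U(n)\ltimes\mathbb{C}^n}{O(n)\ltimes\mathbb{R}^n}$-system $$-[a_i,q_{u_j}]+[a_j,q_{u_i}]+[[a_i,q],[a_j,q]]=0,\qquad i\neq j;$$ (c) the 1-form $$\theta_\lambda=\begin{pmatrix}\mathrm{i}\lambda\delta+[\delta,\beta]&\delta h\\0&0\end{pmatrix}$$ is flat for all $\lambda\in\mathbb{C}$.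
   Context: $\Omega\subset\mathbb{R}^n$ is a connected, simply connected open neighbourhood of $0$ with coordinates $u=(u_1,\dots,u_n)$. $\delta=\mathrm{diag}(du_1,\dots,du_n)$, $[\delta,\beta]=\delta\beta-\beta\delta$. A matrix-valued 1-form $\theta$ is flat if $d\theta+\theta\wedge\theta=0$. $\mathbb{C}^n=\mathbb{R}^{2n}$ carries $\langle Z_1,Z_2\rangle=\mathrm{Re}(\bar Z_1^tZ_2)$, $\omega(Z_1,Z_2)=\mathrm{Im}(\bar Z_1^tZ_2)$, and $J$ is multiplication by $\mathrm{i}$. An immersion of an $n$-manifold is Lagrangian if $\omega$ pulls back to $0$, flat if the induced metric is flat. Its normal bundle is non-degenerate if at each point $p$ the space of shape operators at $p$ has dimension equal to the codimension $n$. It is a known fact that every flat Lagrangian immersion in $\mathbb{C}^n$ with non-degenerate normal bundle admits, locally, line of curvature coordinates $u$ in which $\mathrm{I}=\sum h_i^2du_i^2$, $\mathrm{II}=\sum du_i^2\otimes J(\partial f/\partial u_i)$, with $\beta_{ij}=(h_i)_{u_j}/h_j$ ($i\ne j$) symmetric, and these forms determine $f$ up to unitary rigid motion; "the equation for flat Lagrangian immersions" is the resulting system for $(\beta,h)$. The $\frac{U(n)\ltimes\mathbb{C}^n}{O(n)\ltimes\mathbb{R}^n}$-system: the Lie algebra $\mathrm{u}(n)\ltimes\mathbb{R}^{2n}$ is realized as the real $(2n+1)\times(2n+1)$ matrices $\begin{pmatrix}b&-c&x\\c&b&y\\0&0&0\end{pmatrix}$, $b=-b^t$, $c=c^t$,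 with $\mathcal{P}=\{b=0,\ x=0\}$ and $\mathcal{K}=\{c=0,\ y=0\}$ the Cartan decomposition; $a_j=e_{n+j,j}-e_{j,n+j}\in\mathcal{P}$ ($1\le j\le n$), where $e_{k,l}$ are elementary matrices, span a maximal abelian subalgebra in $\mathcal P$, and $q\in\mathcal{P}$ has the form displayed. In this realization the complex form $\theta_\lambda$ in (c) corresponds to $\sum_j(a_j\lambda+[a_j,q])\,du_j$. *)

theory Defs
  imports "HOL-Analysis.Analysis"
begin

section \<open>Calculus on open subsets of Euclidean space\<close>

abbreviation Dif :: "('a::real_normed_vector \<Rightarrow> 'b::real_normed_vector) \<Rightarrow> 'a \<Rightarrow> 'a \<Rightarrow> 'b" where
  "Dif F x \<equiv> frechet_derivative F (at x)"

definition pd :: "'n::finite \<Rightarrow> (real^'n \<Rightarrow> 'b::real_normed_vector) \<Rightarrow> real^'n \<Rightarrow> 'b" where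
  "pd i F x = Dif F x (axis i 1)"

text \<open>The predicates below are only meant for open sets.\<close>

primrec Ck_on :: "nat \<Rightarrow> ('a::real_normed_vector \<Rightarrow> 'b::real_normed_vector) \<Rightarrow> 'a set \<Rightarrow> bool" where
  "Ck_on 0 F S \<longleftrightarrow> continuous_on S F"
| "Ck_on (Suc k) F S \<longleftrightarrow>
     (\<forall>x\<in>S. F differentiable (at x)) \<and> (\<forall>v. Ck_on k (\<lambda>x. Dif F x v) S)"

definition smooth_on :: "('a::real_normed_vector \<Rightarrow> 'b::real_normed_vector) \<Rightarrow> 'a set \<Rightarrow> bool" where
  "smooth_on F S \<longleftrightarrow> (\<forall>k. Ck_on k F S)"

section \<open>Matrix-valued 1-forms\<close>

text \<open>A matrix-valued 1-form on an open subset of \<open>real^'n\<close> is represented by the function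
  sending a point and a tangent vector to a matrix (linearly in the tangent vector), and a 2-form by
  a function of a point and two tangent vectors. The exterior derivative is evaluated on constant
  vector fields, whose Lie bracket is zero.\<close>

type_synonym ('n, 'a, 'm) mform1 = "real^'n \<Rightarrow> real^'n \<Rightarrow> 'a^'m^'m"
type_synonym ('n, 'a, 'm) mform2 = "real^'n \<Rightarrow> real^'n \<Rightarrow> real^'n \<Rightarrow> 'a^'m^'m"

definition ext_d :: "('n::finite, 'a::real_normed_field, 'm::finite) mform1 \<Rightarrow> ('n, 'a, 'm) mform2"
  where "ext_d \<theta> x v w = Dif (\<lambda>y. \<theta> y w) x v - Dif (\<lambda>y. \<theta> y v) x w"

definition wedge :: "('n::finite, 'a::real_normed_field, 'm::finite) mform1 \<Rightarrow> ('n, 'a, 'm) mform1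
    \<Rightarrow> ('n, 'a, 'm) mform2"
  where "wedge \<theta> \<eta> x v w = \<theta> x v ** \<eta> x w - \<theta> x w ** \<eta> x v"

definition flat_form_on :: "(real^'n) set \<Rightarrow> ('n::finite, 'a::real_normed_field, 'm::finite) mform1 \<Rightarrow> bool"
  where "flat_form_on S \<theta> \<longleftrightarrow> (\<forall>x\<in>S. \<forall>v w. ext_d \<theta> x v w + wedge \<theta> \<theta> x v w = 0)"

definition comm :: "'a::ring_1^'m::finite^'m \<Rightarrow> 'a^'m^'m \<Rightarrow> 'a^'m^'m" where
  "comm A B = A ** B - B ** A"

section \<open>Riemannian curvature in coordinates\<close>

text \<open>A metric is given by its coefficient matrix: \<open>G x $ i $ j\<close> is the coefficient of
  $du_i\,du_j$.\<close>

text \<open>\<open>christoffel G k i j\<close> is $\Gamma^k_{ij}$.\<close>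

definition christoffel :: "(real^'n \<Rightarrow> real^'n^'n) \<Rightarrow> 'n::finite \<Rightarrow> 'n \<Rightarrow> 'n \<Rightarrow> real^'n \<Rightarrow> real" where
  "christoffel G k i j x = (1/2) * (\<Sum>l\<in>UNIV. matrix_inv (G x) $ k $ l *
     (pd i (\<lambda>y. G y $ j $ l) x + pd j (\<lambda>y. G y $ i $ l) x - pd l (\<lambda>y. G y $ i $ j) x))"

text \<open>\<open>riemann G l k i j\<close> is the coefficient of $\partial_l$ in
  $R(\partial_i,\partial_j)\partial_k$.\<close>

definition riemann :: "(real^'n \<Rightarrow> real^'n^'n) \<Rightarrow> 'n::finite \<Rightarrow> 'n \<Rightarrow> 'n \<Rightarrow> 'n \<Rightarrow> real^'n \<Rightarrow> real" where
  "riemann G l k i j x =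
     pd i (christoffel G l j k) x - pd j (christoffel G l i k) x
     + (\<Sum>m\<in>UNIV. christoffel G l i m x * christoffel G m j k x
               - christoffel G l j m x * christoffel G m i k x)"

definition flat_metric_on :: "(real^'n::finite) set \<Rightarrow> (real^'n \<Rightarrow> real^'n^'n) \<Rightarrow> bool" where
  "flat_metric_on S G \<longleftrightarrow> (\<forall>x\<in>S. \<forall>l k i j. riemann G l k i j x = 0)"

section \<open>Complex Euclidean space\<close>

definition herm :: "complex^'n::finite \<Rightarrow> complex^'n \<Rightarrow> complex" where
  "herm Z W = (\<Sum>i\<in>UNIV. cnj (Z $ i) * W $ i)"

text \<open>The real part of \<open>herm\<close> is the library's inner product.\<close>

lemma inner_eq_Re_herm: "Z \<bullet> W = Re (herm Z W)"
  by (simp add: herm_def inner_vec_def inner_complex_def)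

definition symp :: "complex^'n::finite \<Rightarrow> complex^'n \<Rightarrow> real" where
  "symp Z W = Im (herm Z W)"

definition Jmul :: "complex^'n::finite \<Rightarrow> complex^'n" where
  "Jmul Z = \<i> *s Z"

section \<open>Lagrangian immersions\<close>

definition immersion_on :: "(real^'n::finite) set \<Rightarrow> (real^'n \<Rightarrow> complex^'n) \<Rightarrow> bool" where
  "immersion_on S f \<longleftrightarrow> smooth_on f S \<and> (\<forall>x\<in>S. inj (Dif f x))"

definition first_form :: "(real^'n::finite \<Rightarrow> complex^'n) \<Rightarrow> real^'n \<Rightarrow> real^'n \<Rightarrow> real^'n \<Rightarrow> real" where
  "first_form f x v w = Dif f x v \<bullet> Dif f x w"

definition metric_matrix :: "(real^'n::finite \<Rightarrow> complex^'n) \<Rightarrow> real^'n \<Rightarrow> real^'n^'n" where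
  "metric_matrix f x = (\<chi> i j. first_form f x (axis i 1) (axis j 1))"

definition lagrangian_on :: "(real^'n::finite) set \<Rightarrow> (real^'n \<Rightarrow> complex^'n) \<Rightarrow> bool" where
  "lagrangian_on S f \<longleftrightarrow> (\<forall>x\<in>S. \<forall>v w. symp (Dif f x v) (Dif f x w) = 0)"

definition flat_immersion_on :: "(real^'n::finite) set \<Rightarrow> (real^'n \<Rightarrow> complex^'n) \<Rightarrow> bool" where
  "flat_immersion_on S f \<longleftrightarrow> flat_metric_on S (metric_matrix f)"

definition normal_space_at :: "(real^'n::finite \<Rightarrow> complex^'n) \<Rightarrow> real^'n \<Rightarrow> (complex^'n) set" where
  "normal_space_at f x = {\<xi>. \<forall>v. \<xi> \<bullet> Dif f x v = 0}"

text \<open>The orthogonal projection of \<open>Z\<close> to the normal space at \<open>x\<close>.\<close>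

definition normal_part :: "(real^'n::finite \<Rightarrow> complex^'n) \<Rightarrow> real^'n \<Rightarrow> complex^'n \<Rightarrow> complex^'n" where
  "normal_part f x Z = (THE \<xi>. \<xi> \<in> normal_space_at f x \<and> Z - \<xi> \<in> range (Dif f x))"

text \<open>The second fundamental form is the normal component of the ambient derivative of a tangent
  field; here the tangent field is the image of the constant coordinate field \<open>w\<close>.\<close>

definition second_form ::
  "(real^'n::finite \<Rightarrow> complex^'n) \<Rightarrow> real^'n \<Rightarrow> real^'n \<Rightarrow> real^'n \<Rightarrow> complex^'n" where
  "second_form f x v w = normal_part f x (Dif (\<lambda>y. Dif f y w) x v)"

text \<open>\<open>A\<close> is the matrix, in the coordinate frame, of the shape operator of the normal
  vector \<open>\<xi>\<close>; for an immersion it is uniquely determined by \<open>\<xi>\<close>.\<close>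

definition is_shape_operator ::
  "(real^'n::finite \<Rightarrow> complex^'n) \<Rightarrow> real^'n \<Rightarrow> complex^'n \<Rightarrow> real^'n^'n \<Rightarrow> bool" where
  "is_shape_operator f x \<xi> A \<longleftrightarrow>
     (\<forall>v w. first_form f x (A *v v) w = second_form f x v w \<bullet> \<xi>)"

definition shape_operators :: "(real^'n::finite \<Rightarrow> complex^'n) \<Rightarrow> real^'n \<Rightarrow> (real^'n^'n) set" where
  "shape_operators f x = {A. \<exists>\<xi>\<in>normal_space_at f x. is_shape_operator f x \<xi> A}"

text \<open>The real codimension of the immersion is \<open>2 * CARD('n) - CARD('n) = CARD('n)\<close>.\<close>

definition nondegenerate_normal_bundle_on ::
  "(real^'n::finite) set \<Rightarrow> (real^'n \<Rightarrow> complex^'n) \<Rightarrow> bool" where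
  "nondegenerate_normal_bundle_on S f \<longleftrightarrow> (\<forall>x\<in>S. dim (shape_operators f x) = CARD('n))"

definition flat_lagrangian_data ::
  "(real^'n::finite) set \<Rightarrow> (real^'n \<Rightarrow> real^'n^'n) \<Rightarrow> (real^'n \<Rightarrow> real^'n) \<Rightarrow> bool" where
  "flat_lagrangian_data S \<beta> h \<longleftrightarrow>
     (\<exists>f. immersion_on S f \<and> lagrangian_on S f \<and> flat_immersion_on S f
        \<and> nondegenerate_normal_bundle_on S f
        \<and> (\<forall>x\<in>S. \<forall>v w. first_form f x v w = (\<Sum>i\<in>UNIV. (h x $ i)\<^sup>2 * (v $ i) * (w $ i)))
        \<and> (\<forall>x\<in>S. \<forall>v w. second_form f x v w = (\<Sum>i\<in>UNIV. (v $ i * w $ i) *\<^sub>R Jmul (pd i f x))))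
     \<and> (\<forall>x\<in>S. \<forall>i j. i \<noteq> j \<longrightarrow> pd j (\<lambda>y. h y $ i) x = \<beta> x $ i $ j * h x $ j)"

section \<open>The system for the symmetric pair\<close>

text \<open>The indices $1,\dots,n$, $n+1,\dots,2n$ and $2n+1$ are \<open>Inl i\<close>, \<open>Inr (Inl i)\<close>
  and \<open>Inr (Inr ())\<close>.\<close>

type_synonym 'n idx = "'n + 'n + unit"

text \<open>The block matrix with rows \<open>(b, -c, x)\<close>, \<open>(c, b, y)\<close>, \<open>(0, 0, 0)\<close>.\<close>

definition blk :: "real^'n::finite^'n \<Rightarrow> real^'n^'n \<Rightarrow> real^'n \<Rightarrow> real^'n \<Rightarrow> real^'n idx^'n idx" where
  "blk b c x y = (\<chi> r s. case r of
      Inl i \<Rightarrow> (case s of Inl j \<Rightarrow> b $ i $ j | Inr (Inl j) \<Rightarrow> - (c $ i $ j) | Inr (Inr _) \<Rightarrow> x $ i)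
    | Inr (Inl i) \<Rightarrow> (case s of Inl j \<Rightarrow> c $ i $ j | Inr (Inl j) \<Rightarrow> b $ i $ j | Inr (Inr _) \<Rightarrow> y $ i)
    | Inr (Inr _) \<Rightarrow> 0)"

definition lie_alg :: "(real^'n::finite idx^'n idx) set" where
  "lie_alg = {blk b c x y | b c x y. b = - transpose b \<and> c = transpose c}"

definition cartan_P :: "(real^'n::finite idx^'n idx) set" where
  "cartan_P = {M \<in> lie_alg. \<exists>c y. M = blk 0 c 0 y}"

definition elem_mat :: "'m::finite \<Rightarrow> 'm \<Rightarrow> real^'m^'m" where
  "elem_mat k l = (\<chi> r s. if r = k \<and> s = l then 1 else 0)"

definition a_gen :: "'n::finite \<Rightarrow> real^'n idx^'n idx" where
  "a_gen j = elem_mat (Inr (Inl j)) (Inl j) - elem_mat (Inl j) (Inr (Inl j))"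

definition solves_system :: "(real^'n::finite) set \<Rightarrow> (real^'n \<Rightarrow> real^'n idx^'n idx) \<Rightarrow> bool" where
  "solves_system S q \<longleftrightarrow> (\<forall>x\<in>S. q x \<in> cartan_P) \<and>
     (\<forall>x\<in>S. \<forall>i j. i \<noteq> j \<longrightarrow>
        - comm (a_gen i) (pd j q x) + comm (a_gen j) (pd i q x)
        + comm (comm (a_gen i) (q x)) (comm (a_gen j) (q x)) = 0)"

text \<open>With \<open>c = -\<beta>\<close> and \<open>y = -h\<close> the rows are \<open>(0, \<beta>, 0)\<close>, \<open>(-\<beta>, 0, -h)\<close>, \<open>(0, 0, 0)\<close>.\<close>

definition q_mat :: "(real^'n \<Rightarrow> real^'n^'n) \<Rightarrow> (real^'n \<Rightarrow> real^'n) \<Rightarrow> real^'n::finite \<Rightarrow> real^'n idx^'n idx" where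
  "q_mat \<beta> h x = blk 0 (- \<beta> x) 0 (- h x)"

section \<open>The Lax pair\<close>

text \<open>The 1-form \<open>diag(du_1, ..., du_n)\<close>.\<close>

definition delta :: "('n::finite, real, 'n) mform1" where
  "delta x v = (\<chi> i j. if i = j then v $ i else 0)"

definition lax_form :: "(real^'n \<Rightarrow> real^'n^'n) \<Rightarrow> (real^'n \<Rightarrow> real^'n) \<Rightarrow> complex
    \<Rightarrow> ('n::finite, complex, 'n + unit) mform1" where
  "lax_form \<beta> h lam x v = (\<chi> r s. case r of
      Inl i \<Rightarrow> (case s of
          Inl j \<Rightarrow> \<i> * lam * of_real (delta x v $ i $ j) + of_real (comm (delta x v) (\<beta> x) $ i $ j)
        | Inr _ \<Rightarrow> of_real ((delta x v *v h x) $ i))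
    | Inr _ \<Rightarrow> 0)"

end

theory Submission
  imports Defs
begin

text \<open>All three conditions are forms of one statement about the real skew-symmetric 1-form
\<omega> = [\<delta>, \<beta>] (\<open>rot_form \<beta>\<close>): its curvature d\<omega> + \<omega> \<and> \<omega> and its torsion
d(\<delta>h) + \<omega> \<and> \<delta>h both vanish. The torsion vanishes exactly when (h_i)_{u_j} = \<beta>_ij h_j for all
i \<noteq> j (\<open>torsion_eq_0_iff\<close>).

For the Lax pair, curvature and torsion are the two non-zero blocks of d\<theta> + \<theta> \<and> \<theta>: the terms
containing \<lambda> cancel because \<delta> is diagonal, so the curvature of \<theta> does not depend on \<lambda>
(\<open>curvature_lax_form\<close>). For the system, the realization by real matrices turns a_j into i times the
elementary matrix e_jj and [a_j, q] into the du_j-coefficient of \<theta> at \<lambda> = 0; the left-hand side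
of the (i, j) equation is therefore the value of the same two blocks on the coordinate vectors
i and j (\<open>system_expression\<close>).

The link to geometry is the structure equation of a moving frame. Given an immersion f with the
prescribed fundamental forms, Koszul's formula determines the tangential part and II the normal part
of its second derivatives. They say that the matrix G which has the normalized coordinate vectors and
f as its columns satisfies dG = G\<theta> with \<lambda> = 1 (\<open>has_derivative_unit_frame\<close>). Since second
derivatives commute, G annihilates the curvature of \<theta>, and since the normalized coordinate vectors
are linearly independent, d\<omega> + \<omega> \<and> \<omega> = 0 (\<open>rotation_coefficients_flat\<close>).

Conversely, if \<theta> is flat then dG = G\<theta> has a solution on the simply connected domain that is the
identity at a given point (\<open>flat_form_parallel_frame\<close>). Its upper left block U stays unitary because
i\<delta> + \<omega> is skew-Hermitian, and the upper part f of its last column satisfies df = U\<delta>h; this is the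
immersion (\<open>immersion_from_flat_lax_form\<close>). Its metric is flat by the Gauss equation
(\<open>flat_induced_metric\<close>), and its shape operators are all the diagonal matrices
(\<open>nondegenerate_normal_bundle\<close>).

The analytic core is the integrability theorem for linear total differential equations
dw = \<Theta>(w) (\<open>integrable_system_global\<close>). On small convex sets Picard iteration along segments
converges, and by the Poincare homotopy formula the defect dw - \<Theta>(w) of the iterates contracts as
well, so that the limit solves the equation in all directions. Local solutions then transport values
between nearby points; \<open>global_section\<close> shows that on a simply connected set such a transport comes
from a globally defined section.\<close>

section \<open>Monodromy\<close>

text \<open>A transport rule with values in the maps of \<open>'v\<close> to itself that composes correctly, but only for
triples of points at mutual distance less than \<delta>.\<close>

definition cocycle_on :: "'k::metric_space set \<Rightarrow> real \<Rightarrow> ('k \<Rightarrow> 'k \<Rightarrow> 'v \<Rightarrow> 'v) \<Rightarrow> bool" where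
  "cocycle_on K \<delta> c \<longleftrightarrow> (\<forall>s\<in>K. \<forall>t\<in>K. \<forall>r\<in>K. \<forall>v.
     dist s t < \<delta> \<longrightarrow> dist t r < \<delta> \<longrightarrow> dist s r < \<delta> \<longrightarrow> c t r (c s t v) = c s r v)"

lemma cocycle_onD:
  "cocycle_on K \<delta> c \<Longrightarrow> s \<in> K \<Longrightarrow> t \<in> K \<Longrightarrow> r \<in> K \<Longrightarrow> dist s t < \<delta> \<Longrightarrow> dist t r < \<delta> \<Longrightarrow> dist s r < \<delta>
    \<Longrightarrow> c t r (c s t v) = c s r v"
  unfolding cocycle_on_def by blast

lemma dist_midpoint_midpoint:
  fixes s t r :: "'k::real_normed_vector"
  shows "dist (midpoint s t) (midpoint s r) = dist t r / 2"
    and "dist (midpoint t s) (midpoint r s) = dist t r / 2"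
    and "dist (midpoint t s) (midpoint s r) = dist t r / 2"
proof -
  have *: "midpoint s t - midpoint s r = (1/2) *\<^sub>R (t - r)" for s t r :: 'k
    by (simp add: midpoint_def algebra_simps)
  show A: "dist (midpoint s t) (midpoint s r) = dist t r / 2" for s t r :: 'k
    unfolding dist_norm * by simp
  show "dist (midpoint t s) (midpoint r s) = dist t r / 2"
    using A[of s t r] by (metis midpoint_sym)
  show "dist (midpoint t s) (midpoint s r) = dist t r / 2"
    using A[of s t r] by (metis midpoint_sym)
qed

text \<open>Going through the midpoint doubles the scale on which a cocycle is defined: the three midpoints of
the sides of a triangle have half of its side lengths as mutual distances, so the four small triangles
that they cut out are within the original scale.\<close>

lemma cocycle_double:
  fixes K :: "'k::real_normed_vector set"
  assumes K: "convex K" and "0 < \<delta>" and c: "cocycle_on K \<delta> c"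
  defines "c' \<equiv> \<lambda>s t v. c (midpoint s t) t (c s (midpoint s t) v)"
  shows "cocycle_on K (2 * \<delta>) c'" and "\<And>s t. s \<in> K \<Longrightarrow> t \<in> K \<Longrightarrow> dist s t < \<delta> \<Longrightarrow> c' s t = c s t"
proof -
  have mid: "midpoint s t \<in> K" if "s \<in> K" "t \<in> K" for s t
    using convexD_alt[OF K that, of "1/2"] by (simp add: midpoint_def scaleR_add_right)
  note dm = dist_midpoint dist_midpoint_midpoint
  show "cocycle_on K (2 * \<delta>) c'"
    unfolding cocycle_on_def
  proof (intro ballI allI impI)
    fix s t r v
    assume K3: "s \<in> K" "t \<in> K" "r \<in> K"
      and d: "dist s t < 2 * \<delta>" "dist t r < 2 * \<delta>" "dist s r < 2 * \<delta>"
    define m1 where "m1 = midpoint s t"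
    define m2 where "m2 = midpoint t r"
    define m3 where "m3 = midpoint s r"
    have mK: "m1 \<in> K" "m2 \<in> K" "m3 \<in> K" using mid K3 by (auto simp: m1_def m2_def m3_def)
    have d1: "dist s m1 < \<delta>" "dist m1 t < \<delta>" "dist t m2 < \<delta>" "dist m2 r < \<delta>" "dist s m3 < \<delta>" "dist m3 r < \<delta>"
      "dist m1 m2 < \<delta>" "dist m1 m3 < \<delta>" "dist m3 m2 < \<delta>"
      "dist m3 m1 < \<delta>" "dist m2 m3 < \<delta>"
      using d by (simp_all add: m1_def m2_def m3_def dm dist_commute[of r s] dist_commute[of t s] dist_commute[of r t])
    note C = cocycle_onD[OF c]
    \<comment> \<open>The path s, m1, t, m2, r is pushed across the four small triangles until it is s, m3, r.\<close>
    have "c' t r (c' s t v) = c m2 r (c t m2 (c m1 t (c s m1 v)))"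
      by (simp add: c'_def m1_def m2_def)
    also have "c t m2 (c m1 t (c s m1 v)) = c m1 m2 (c s m1 v)"
      using K3 mK d1 by (intro C)
    also have "c s m1 v = c m3 m1 (c s m3 v)"
      using K3 mK d1 by (intro C[symmetric])
    also have "c m1 m2 (c m3 m1 (c s m3 v)) = c m3 m2 (c s m3 v)"
      using K3 mK d1 by (intro C)
    also have "c m2 r (c m3 m2 (c s m3 v)) = c m3 r (c s m3 v)"
      using K3 mK d1 by (intro C)
    also have "\<dots> = c' s r v" by (simp add: c'_def m3_def)
    finally show "c' t r (c' s t v) = c' s r v" .
  qed
  show "c' s t = c s t" if "s \<in> K" "t \<in> K" "dist s t < \<delta>" for s t
  proof
    fix v
    have "dist s (midpoint s t) < \<delta>" "dist (midpoint s t) t < \<delta>"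
      using that(3) \<open>0 < \<delta>\<close> by (simp_all add: dist_midpoint)
    then show "c' s t v = c s t v"
      unfolding c'_def using that mid by (intro cocycle_onD[OF c]) auto
  qed
qed

text \<open>Repeated doubling exceeds the diameter of \<open>K\<close> after finitely many steps.\<close>

lemma cocycle_extend:
  fixes K :: "'k::real_normed_vector set"
  assumes K: "convex K" "bounded K" and "0 < \<delta>" and c: "cocycle_on K \<delta> c"
  obtains C where "\<And>s t r v. s \<in> K \<Longrightarrow> t \<in> K \<Longrightarrow> r \<in> K \<Longrightarrow> C t r (C s t v) = C s r v"
    and "\<And>s t. s \<in> K \<Longrightarrow> t \<in> K \<Longrightarrow> dist s t < \<delta> \<Longrightarrow> C s t = c s t"
proof -
  have iter: "\<exists>C. cocycle_on K (2^k * \<delta>) C \<and> (\<forall>s\<in>K. \<forall>t\<in>K. dist s t < \<delta> \<longrightarrow> C s t = c s t)" for k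
  proof (induction k)
    case 0
    show ?case using c by auto
  next
    case (Suc k)
    then obtain C where C: "cocycle_on K (2^k * \<delta>) C" "\<forall>s\<in>K. \<forall>t\<in>K. dist s t < \<delta> \<longrightarrow> C s t = c s t"
      by blast
    have pos: "0 < 2^k * \<delta>" using \<open>0 < \<delta>\<close> by simp
    have le: "\<delta> \<le> 2^k * \<delta>" using \<open>0 < \<delta>\<close> by simp
    show ?case
      using cocycle_double[OF K(1) pos C(1)] C(2) le
      by (intro exI[of _ "\<lambda>s t v. C (midpoint s t) t (C s (midpoint s t) v)"]) (auto simp: mult.assoc)
  qed
  obtain k where k: "diameter K / \<delta> < 2^k"
    using real_arch_pow[of 2 "diameter K / \<delta>"] by auto
  obtain C where C: "cocycle_on K (2^k * \<delta>) C" "\<forall>s\<in>K. \<forall>t\<in>K. dist s t < \<delta> \<longrightarrow> C s t = c s t"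
    using iter by blast
  have "dist s t < 2^k * \<delta>" if "s \<in> K" "t \<in> K" for s t
    using diameter_bounded_bound[OF K(2) that] k \<open>0 < \<delta>\<close> by (simp add: field_simps)
  then show ?thesis
    using C by (intro that[of C]) (auto intro: cocycle_onD)
qed

text \<open>A globally defined cocycle is determined by its values at small scale, because the segment between
two points can be subdivided.\<close>

lemma cocycle_unique:
  fixes K :: "'k::real_normed_vector set"
  assumes K: "convex K" and "0 < \<delta>"
    and C: "\<And>s t r v. s \<in> K \<Longrightarrow> t \<in> K \<Longrightarrow> r \<in> K \<Longrightarrow> C t r (C s t v) = C s r v"
    and C': "\<And>s t r v. s \<in> K \<Longrightarrow> t \<in> K \<Longrightarrow> r \<in> K \<Longrightarrow> C' t r (C' s t v) = C' s r v"
    and eq: "\<And>s t. s \<in> K \<Longrightarrow> t \<in> K \<Longrightarrow> dist s t < \<delta> \<Longrightarrow> C s t = C' s t"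
    and st: "s \<in> K" "t \<in> K"
  shows "C s t = C' s t"
proof -
  obtain N :: nat where N: "dist s t / \<delta> < N" using reals_Archimedean2 by blast
  then have "N > 0" using \<open>0 < \<delta>\<close> by (metis divide_nonneg_pos not_gr_zero not_less of_nat_0 zero_le_dist)
  define p where "p k = s + (real k / N) *\<^sub>R (t - s)" for k
  have pK: "p k \<in> K" if "k \<le> N" for k
  proof -
    have "p k = (1 - real k / N) *\<^sub>R s + (real k / N) *\<^sub>R t"
      by (simp add: p_def algebra_simps)
    then show ?thesis using K st that \<open>N > 0\<close> by (simp add: convex_alt)
  qed
  have pd: "dist (p k) (p (Suc k)) < \<delta>" for k
  proof -
    have "p (Suc k) - p k = (1 / N) *\<^sub>R (t - s)"
      by (simp add: p_def algebra_simps add_divide_distrib)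
    then have "dist (p k) (p (Suc k)) = dist s t / N"
      by (subst (1 2) dist_commute) (simp add: dist_norm)
    also have "\<dots> < \<delta>" using N \<open>0 < \<delta>\<close> \<open>N > 0\<close> by (simp add: field_simps)
    finally show ?thesis .
  qed
  have "C s (p k) = C' s (p k)" if "k \<le> N" for k
    using that
  proof (induction k)
    case 0
    have "p 0 = s" by (simp add: p_def)
    then show ?case using eq st \<open>0 < \<delta>\<close> by simp
  next
    case (Suc k)
    show ?case
    proof
      fix v
      have "C s (p (Suc k)) v = C (p k) (p (Suc k)) (C s (p k) v)"
        using C st pK Suc.prems by simp
      also have "\<dots> = C' (p k) (p (Suc k)) (C' s (p k) v)"
        using Suc eq pK pd by simp
      also have "\<dots> = C' s (p (Suc k)) v"
        using C' st pK Suc.prems by simp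
      finally show "C s (p (Suc k)) v = C' s (p (Suc k)) v" .
    qed
  qed
  from this[of N] show ?thesis using \<open>N > 0\<close> by (simp add: p_def)
qed

text \<open>Transport of values between points of a common patch of an open cover, as given by the local solutions
of a differential equation.\<close>

locale local_transport =
  fixes \<B> :: "'a::euclidean_space set set" and T :: "'a \<Rightarrow> 'a \<Rightarrow> 'v \<Rightarrow> 'v"
  assumes open_patch: "B \<in> \<B> \<Longrightarrow> open B"
    and convex_patch: "B \<in> \<B> \<Longrightarrow> convex B"
    and transport_trans: "B \<in> \<B> \<Longrightarrow> x \<in> B \<Longrightarrow> y \<in> B \<Longrightarrow> z \<in> B \<Longrightarrow> T y z (T x y v) = T x z v"
    and transport_refl: "B \<in> \<B> \<Longrightarrow> x \<in> B \<Longrightarrow> T x x v = v"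
begin

text \<open>\<open>C\<close> is the transport along the parametrized figure \<open>\<phi>\<close>: it composes globally and agrees with the local
transport at small scale. For an interval \<open>K\<close> this is transport along a path; taking for \<open>K\<close> a square
makes the same notion serve for homotopies.\<close>

definition transport_along :: "'k::real_normed_vector set \<Rightarrow> ('k \<Rightarrow> 'a) \<Rightarrow> ('k \<Rightarrow> 'k \<Rightarrow> 'v \<Rightarrow> 'v) \<Rightarrow> bool" where
  "transport_along K \<phi> C \<longleftrightarrow>
     (\<forall>s\<in>K. \<forall>t\<in>K. \<forall>r\<in>K. \<forall>v. C t r (C s t v) = C s r v) \<and>
     (\<exists>\<delta>>0. \<forall>s\<in>K. \<forall>t\<in>K. dist s t < \<delta> \<longrightarrow> C s t = T (\<phi> s) (\<phi> t))"

lemma transport_along_comp: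
  "transport_along K \<phi> C \<Longrightarrow> s \<in> K \<Longrightarrow> t \<in> K \<Longrightarrow> r \<in> K \<Longrightarrow> C t r (C s t v) = C s r v"
  by (simp add: transport_along_def)

text \<open>By compactness, parameters at distance less than some \<delta> are mapped into a common patch. The pulled
back transport is then a cocycle at scale \<delta>, which extends.\<close>

lemma transport_along_exists:
  assumes K: "compact K" "convex K" and \<phi>: "continuous_on K \<phi>" "\<phi> ` K \<subseteq> \<Union>\<B>"
  obtains C where "transport_along K \<phi> C"
proof -
  obtain \<epsilon> where \<epsilon>: "0 < \<epsilon>" "\<And>x. x \<in> \<phi> ` K \<Longrightarrow> \<exists>B\<in>\<B>. ball x \<epsilon> \<subseteq> B"
    using Heine_Borel_lemma[OF compact_continuous_image[OF \<phi>(1) K(1)] \<phi>(2) open_patch] by blast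
  obtain \<delta> where \<delta>: "0 < \<delta>" "\<And>s t. s \<in> K \<Longrightarrow> t \<in> K \<Longrightarrow> dist t s < \<delta> \<Longrightarrow> dist (\<phi> t) (\<phi> s) < \<epsilon>"
    using compact_uniformly_continuous[OF \<phi>(1) K(1)] \<epsilon>(1)
    unfolding uniformly_continuous_on_def by metis
  have "cocycle_on K \<delta> (\<lambda>s t. T (\<phi> s) (\<phi> t))"
    unfolding cocycle_on_def
  proof (intro ballI allI impI)
    fix s t r v assume K3: "s \<in> K" "t \<in> K" "r \<in> K" and d: "dist s t < \<delta>" "dist t r < \<delta>" "dist s r < \<delta>"
    obtain B where B: "B \<in> \<B>" "ball (\<phi> s) \<epsilon> \<subseteq> B" using \<epsilon>(2) K3 by blast
    have "\<phi> s \<in> B" "\<phi> t \<in> B" "\<phi> r \<in> B" using \<epsilon>(1) \<delta>(2) B(2) K3 d by (auto simp: subset_iff)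
    then show "T (\<phi> t) (\<phi> r) (T (\<phi> s) (\<phi> t) v) = T (\<phi> s) (\<phi> r) v"
      using transport_trans B(1) by blast
  qed
  from cocycle_extend[OF K(2) compact_imp_bounded[OF K(1)] \<delta>(1) this]
  obtain C where "\<And>s t r v. s \<in> K \<Longrightarrow> t \<in> K \<Longrightarrow> r \<in> K \<Longrightarrow> C t r (C s t v) = C s r v"
    "\<And>s t. s \<in> K \<Longrightarrow> t \<in> K \<Longrightarrow> dist s t < \<delta> \<Longrightarrow> C s t = T (\<phi> s) (\<phi> t)" by metis
  then have "transport_along K \<phi> C" using \<delta>(1) by (auto simp: transport_along_def)
  then show ?thesis by (rule that)
qed

lemma transport_along_unique:
  assumes "convex K" "transport_along K \<phi> C" "transport_along K \<phi> C'" "s \<in> K" "t \<in> K"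
  shows "C s t = C' s t"
proof -
  obtain d where d: "d > 0" "\<forall>s\<in>K. \<forall>t\<in>K. dist s t < d \<longrightarrow> C s t = T (\<phi> s) (\<phi> t)"
    using assms(2) unfolding transport_along_def by blast
  obtain d' where d': "d' > 0" "\<forall>s\<in>K. \<forall>t\<in>K. dist s t < d' \<longrightarrow> C' s t = T (\<phi> s) (\<phi> t)"
    using assms(3) unfolding transport_along_def by blast
  show ?thesis
  proof (rule cocycle_unique[OF assms(1), of "min d d'"])
    show "0 < min d d'" using d(1) d'(1) by simp
    show "C s t = C' s t" if "s \<in> K" "t \<in> K" "dist s t < min d d'" for s t
      using d(2) d'(2) that by simp
  qed (use assms transport_along_comp in auto)
qed

lemma transport_along_pullback:
  assumes "transport_along K \<phi> C" "\<And>s. s \<in> K' \<Longrightarrow> g s \<in> K"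
    and "\<And>s t. s \<in> K' \<Longrightarrow> t \<in> K' \<Longrightarrow> dist (g s) (g t) \<le> dist s t"
    and "\<And>s. s \<in> K' \<Longrightarrow> \<phi> (g s) = \<psi> s"
  shows "transport_along K' \<psi> (\<lambda>s t. C (g s) (g t))"
proof -
  obtain d where d: "d > 0" "\<forall>s\<in>K. \<forall>t\<in>K. dist s t < d \<longrightarrow> C s t = T (\<phi> s) (\<phi> t)"
    using assms(1) unfolding transport_along_def by blast
  have "C (g s) (g t) = T (\<psi> s) (\<psi> t)" if "s \<in> K'" "t \<in> K'" "dist s t < d" for s t
  proof -
    have "dist (g s) (g t) < d" using assms(3)[OF that(1,2)] that(3) by linarith
    then have "C (g s) (g t) = T (\<phi> (g s)) (\<phi> (g t))" using d(2) assms(2) that by blast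
    then show ?thesis using assms(4) that by simp
  qed
  then show ?thesis
    using transport_along_comp[OF assms(1)] assms(2) d(1) unfolding transport_along_def by blast
qed

lemma transport_along_patch:
  assumes "B \<in> \<B>" "\<And>s. s \<in> K \<Longrightarrow> \<phi> s \<in> B"
  shows "transport_along K \<phi> (\<lambda>s t. T (\<phi> s) (\<phi> t))"
  unfolding transport_along_def
proof (intro conjI ballI allI)
  show "\<exists>\<delta>>0. \<forall>s\<in>K. \<forall>t\<in>K. dist s t < \<delta> \<longrightarrow> T (\<phi> s) (\<phi> t) = T (\<phi> s) (\<phi> t)"
    by (intro exI[of _ 1]) simp
qed (rule transport_trans[OF assms(1)]; rule assms(2); assumption)

text \<open>The transport over the square of the homotopy restricts to the transports along p and q on two
opposite edges. On the other two edges the homotopy is constant, so transport there is the identity,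
and composition along the two ways around the square gives the claim.\<close>

lemma transport_homotopic:
  assumes hom: "homotopic_paths S p q" and S: "S \<subseteq> \<Union>\<B>"
    and Cp: "transport_along {0..1} p Cp" and Cq: "transport_along {0..1} q Cq"
  shows "Cp 0 1 = Cq 0 1"
proof -
  obtain H where H: "continuous_on ({0..1} \<times> {0..1}) H" "H \<in> ({0..1} \<times> {0..1}) \<rightarrow> S"
    and Hpq: "\<forall>x\<in>{0..1::real}. H (0, x) = p x" "\<forall>x\<in>{0..1}. H (1, x) = q x"
    and Hends: "\<forall>t\<in>{0..1::real}. H (t, 0) = p 0 \<and> H (t, 1) = p 1"
    using hom[unfolded homotopic_paths pathstart_def pathfinish_def o_def] by blast
  let ?Q = "{0..1::real} \<times> {0..1::real}"
  have Q: "compact ?Q" "convex ?Q" by (auto intro: compact_Times convex_Times)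
  have im: "H ` ?Q \<subseteq> \<Union>\<B>" using funcset_image[OF H(2)] S by (rule subset_trans)
  obtain C where C: "transport_along ?Q H C" using transport_along_exists[OF Q H(1) im] .
  have edge: "transport_along {0..1} \<psi> (\<lambda>s t. C (g s) (g t))"
    if "\<And>s. s \<in> {0..1} \<Longrightarrow> g s \<in> ?Q" "\<And>s. s \<in> {0..1} \<Longrightarrow> H (g s) = \<psi> s"
      "\<And>s t. dist (g s) (g t) \<le> dist s t" for g and \<psi> :: "real \<Rightarrow> 'a"
    by (rule transport_along_pullback[OF C that(1) that(3) that(2)])
  have const: "C (g 0) (g 1) v = v"
    if g: "\<And>s. s \<in> {0..1} \<Longrightarrow> g s \<in> ?Q" "\<And>s. s \<in> {0..1} \<Longrightarrow> H (g s) = a"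
      "\<And>s t. dist (g s) (g t) \<le> dist s t" for g :: "real \<Rightarrow> _" and a v
  proof -
    have "a \<in> H ` ?Q" using g(1)[of 0] g(2)[of 0] by (intro image_eqI[of _ _ "g 0"]) simp_all
    then obtain B where B: "B \<in> \<B>" "a \<in> B" using im by blast
    have "C (g 0) (g 1) = T a a"
    proof (rule transport_along_unique[of "{0..1}" "\<lambda>_. a" "\<lambda>s t. C (g s) (g t)" "\<lambda>s t. T a a" 0 1])
      show "transport_along {0..1} (\<lambda>_. a) (\<lambda>s t. C (g s) (g t))" using g by (rule edge)
      show "transport_along {0..1} (\<lambda>_::real. a) (\<lambda>s t. T a a)"
        by (rule transport_along_patch[OF B(1)]) (rule B(2))
    qed auto
    then show ?thesis using transport_refl[OF B] by simp
  qed
  have "transport_along {0..1} p (\<lambda>s t. C (0,s) (0,t))"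
    by (rule edge) (use Hpq in \<open>auto simp: dist_Pair_Pair\<close>)
  from transport_along_unique[OF _ Cp this, of 0 1] have "Cp 0 1 = C (0,0) (0,1)" by simp
  moreover have "transport_along {0..1} q (\<lambda>s t. C (1,s) (1,t))"
    by (rule edge) (use Hpq in \<open>auto simp: dist_Pair_Pair\<close>)
  from transport_along_unique[OF _ Cq this, of 0 1] have "Cq 0 1 = C (1,0) (1,1)" by simp
  moreover have "C (0,0) (1,0) v = v" for v
    by (rule const[of "\<lambda>t. (t,0)" "p 0" v]) (use Hends in \<open>auto simp: dist_Pair_Pair\<close>)
  moreover have "C (0,1) (1,1) v = v" for v
    by (rule const[of "\<lambda>t. (t,1)" "p 1" v]) (use Hends in \<open>auto simp: dist_Pair_Pair\<close>)
  moreover have "C (1,0) (1,1) (C (0,0) (1,0) v) = C (0,1) (1,1) (C (0,0) (0,1) v)" for v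
    using transport_along_comp[OF C] by simp
  ultimately show ?thesis by (auto simp: fun_eq_iff)
qed

text \<open>The two halves of the joined path are affine images of the unit interval, so uniqueness identifies the
transport along each half.\<close>

lemma transport_join_segment:
  assumes p: "path p" and Cp: "transport_along {0..1} p Cp" and B: "B \<in> \<B>" "pathfinish p \<in> B" "y \<in> B"
    and Cj: "transport_along {0..1} (p +++ linepath (pathfinish p) y) Cj"
  shows "Cj 0 1 v = T (pathfinish p) y (Cp 0 1 v)"
proof -
  let ?l = "linepath (pathfinish p) y"
  have first: "transport_along {0..1} p (\<lambda>s t. Cj (s/2) (t/2))"
    by (rule transport_along_pullback[OF Cj]) (simp_all add: joinpaths_def dist_real_def)
  have second: "transport_along {0..1} ?l (\<lambda>s t. Cj ((1+s)/2) ((1+t)/2))"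
  proof (rule transport_along_pullback[OF Cj])
    show "(p +++ ?l) ((1 + s) / 2) = ?l s" if "s \<in> {0..1}" for s
      using that by (cases "s = 0") (simp_all add: joinpaths_def linepath_def pathfinish_def add_divide_distrib)
  qed (auto simp: dist_real_def field_simps abs_if)
  have line: "?l s \<in> B" if "s \<in> {0..1}" for s
    using convexD_alt[OF convex_patch[OF B(1)] B(2,3), of s] that by (simp add: linepath_def)
  have "Cp 0 1 = Cj (0/2) (1/2)"
    by (rule transport_along_unique[OF _ Cp first, of 0 1]) simp_all
  then have "Cp 0 1 = Cj 0 (1/2)" by simp
  moreover have "Cj ((1+0)/2) ((1+1)/2) = T (?l 0) (?l 1)"
    by (rule transport_along_unique[OF _ second transport_along_patch[OF B(1) line]]) simp_all
  then have "Cj (1/2) 1 = T (pathfinish p) y" by (simp add: linepath_def)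
  moreover have "Cj 0 1 v = Cj (1/2) 1 (Cj 0 (1/2) v)"
    using transport_along_comp[OF Cj, of 0 "1/2" 1] by simp
  ultimately show ?thesis by simp
qed

text \<open>The section is obtained by transporting the initial value along any path; this does not depend on the
path since the domain is simply connected.\<close>

theorem global_section:
  assumes S: "simply_connected S" "S = \<Union>\<B>" and a: "a \<in> S"
  obtains W where "W a = v" "\<And>B x y. B \<in> \<B> \<Longrightarrow> x \<in> B \<Longrightarrow> y \<in> B \<Longrightarrow> W y = T x y (W x)"
proof -
  note sc = S(1)[unfolded simply_connected_eq_homotopic_paths]
  have pc: "path_connected S" using sc by (rule conjunct1)
  have hom: "homotopic_paths S p q"
    if "path p" "path_image p \<subseteq> S" "path q" "path_image q \<subseteq> S"
      "pathstart q = pathstart p" "pathfinish q = pathfinish p" for p q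
    by (rule sc[THEN conjunct2, rule_format]) (use that in simp)
  have tr: "\<exists>C. transport_along {0..1} p C" if "path p" "path_image p \<subseteq> S" for p
  proof -
    have "compact {0..1::real}" "convex {0..1::real}" "continuous_on {0..1} p" "p ` {0..1} \<subseteq> \<Union>\<B>"
      using that S(2) by (simp_all add: path_def path_image_def)
    from transport_along_exists[OF this] show ?thesis by blast
  qed
  obtain \<gamma> where \<gamma>: "\<And>x. x \<in> S \<Longrightarrow> path (\<gamma> x) \<and> path_image (\<gamma> x) \<subseteq> S \<and> pathstart (\<gamma> x) = a \<and> pathfinish (\<gamma> x) = x"
    using pc a unfolding path_connected_def by metis
  define \<tau> where "\<tau> p = (SOME C. transport_along {0..1::real} p C) 0 1" for p
  have \<tau>: "\<tau> p = C 0 1" if "transport_along {0..1} p C" for p C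
  proof -
    have "transport_along {0..1} p (SOME C. transport_along {0..1::real} p C)"
      using that by (rule someI[of "transport_along {0..1} p"])
    then show ?thesis
      unfolding \<tau>_def using that by (intro transport_along_unique[of "{0..1}" p]) auto
  qed
  define W where "W x = \<tau> (\<gamma> x) v" for x
  have W: "W x = C 0 1 v"
    if p: "path p" "path_image p \<subseteq> S" "pathstart p = a" "pathfinish p = x" and C: "transport_along {0..1} p C" for x p C
  proof -
    have "x \<in> S" using p by auto
    obtain C' where C': "transport_along {0..1} (\<gamma> x) C'" using tr \<gamma>[OF \<open>x \<in> S\<close>] by blast
    have "homotopic_paths S (\<gamma> x) p"
      using \<gamma>[OF \<open>x \<in> S\<close>] p by (intro hom) auto
    then have "C' 0 1 = C 0 1"
      using transport_homotopic S(2) C' C by blast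
    then show ?thesis by (simp add: W_def \<tau>[OF C'])
  qed
  show ?thesis
  proof
    obtain B where B: "B \<in> \<B>" "a \<in> B" using a S(2) by blast
    have "W a = T a a v"
    proof (rule W)
      show "transport_along {0..1} (\<lambda>_::real. a) (\<lambda>s t. T a a)"
        by (rule transport_along_patch[OF B(1)]) (rule B(2))
    qed (use a in \<open>auto simp: path_def path_image_def pathstart_def pathfinish_def\<close>)
    then show "W a = v" using transport_refl[OF B] by simp
  next
    fix B x y assume B: "B \<in> \<B>" "x \<in> B" "y \<in> B"
    have xS: "x \<in> S" using B S(2) by blast
    note g = \<gamma>[OF xS]
    let ?j = "\<gamma> x +++ linepath x y"
    have "closed_segment x y \<subseteq> S"
      using convex_patch[OF B(1)] B S(2) by (metis Sup_upper closed_segment_subset subset_trans)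
    then have j: "path ?j" "path_image ?j \<subseteq> S" "pathstart ?j = a" "pathfinish ?j = y"
      using g by (auto simp: path_image_join)
    obtain Cj where Cj: "transport_along {0..1} ?j Cj" using tr j by blast
    obtain Cp where Cp: "transport_along {0..1} (\<gamma> x) Cp" using tr g by blast
    have "W y = Cj 0 1 v" using W[OF j Cj] .
    also have "\<dots> = T x y (Cp 0 1 v)"
      using transport_join_segment[of "\<gamma> x" Cp B y Cj v] Cp Cj g B by simp
    also have "Cp 0 1 v = W x" using W[of "\<gamma> x" x Cp] Cp g by simp
    finally show "W y = T x y (W x)" .
  qed
qed

end

section \<open>Linear total differential equations\<close>

text \<open>Integration of a 1-form \<open>A\<close> along the segments from a base point gives a potential up to an error that
is an integral of dA. The estimate bounds the error by the size of dA, so it yields the Poincare lemma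
for closed forms, and it stays useful for forms that are only approximately closed.\<close>

lemma poincare_homotopy:
  fixes A :: "'a::euclidean_space \<Rightarrow> 'a \<Rightarrow>\<^sub>L 'b::banach"
  assumes U: "open U" "convex U" "y \<in> U"
    and A: "\<And>x. x \<in> U \<Longrightarrow> (A has_derivative A' x) (at x)"
    and A': "\<And>v. continuous_on U (\<lambda>x. A' x v)"
  obtains D where "continuous_on U D"
    and "\<And>x. x \<in> U \<Longrightarrow>
      ((\<lambda>x. integral {0..1} (\<lambda>t. A (y + t *\<^sub>R (x - y)) (x - y))) has_derivative blinfun_apply (D x)) (at x)"
    and "\<And>e. 0 \<le> e \<Longrightarrow> \<forall>z\<in>U. \<forall>v w. norm (A' z v w - A' z w v) \<le> e * norm v * norm w \<Longrightarrow>
      \<forall>x\<in>U. norm (D x - A x) \<le> e * norm (x - y)"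
proof -
  define seg where "seg x t = y + t *\<^sub>R (x - y)" for x and t :: real
  have segU: "seg x t \<in> U" if "x \<in> U" "t \<in> {0..1}" for x t
    using convexD_alt[OF U(2) U(3) that(1), of t] that(2) by (simp add: seg_def algebra_simps)
  have bl: "bounded_linear (A' x)" if "x \<in> U" for x
    using A[OF that] by (rule has_derivative_bounded_linear)
  \<comment> \<open>The derivative of the integrand with respect to the end point of the segment.\<close>
  define F where "F x t = Blinfun (\<lambda>v. A (seg x t) v + t *\<^sub>R A' (seg x t) v (x - y))" for x t
  have F: "blinfun_apply (F x t) v = A (seg x t) v + t *\<^sub>R A' (seg x t) v (x - y)"
    if "x \<in> U" "t \<in> {0..1}" for x t v
  proof -
    have "bounded_linear (\<lambda>v. A (seg x t) v + t *\<^sub>R A' (seg x t) v (x - y))"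
      using bl[OF segU[OF that]]
      by (intro bounded_linear_add blinfun.bounded_linear_right
          bounded_linear_scaleR_right[THEN bounded_linear_compose]
          blinfun.bounded_linear_left[THEN bounded_linear_compose])
    then show ?thesis by (simp add: F_def bounded_linear_Blinfun_apply)
  qed
  have contA: "continuous_on U A"
    using A by (meson has_derivative_continuous continuous_at_imp_continuous_on)
  have seg_cont: "continuous_on (U \<times> {0..1}) (\<lambda>p. seg (fst p) (snd p))"
    unfolding seg_def by (intro continuous_intros)
  have seg_im: "(\<lambda>p. seg (fst p) (snd p)) ` (U \<times> {0..1}) \<subseteq> U"
    using segU by auto
  have cF: "continuous_on (U \<times> cbox 0 1) (\<lambda>(x, t). F x t)"
    unfolding case_prod_beta
  proof (rule continuous_on_blinfun_componentwise)
    fix b :: 'a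
    have "continuous_on (U \<times> {0..1}) (\<lambda>p. A (seg (fst p) (snd p)) b + snd p *\<^sub>R A' (seg (fst p) (snd p)) b (fst p - y))"
      by (intro continuous_intros continuous_on_compose2[OF contA seg_cont seg_im]
          continuous_on_compose2[OF A' seg_cont seg_im])
    then show "continuous_on (U \<times> cbox 0 1) (\<lambda>p. F (fst p) (snd p) b)"
      unfolding cbox_interval by (rule continuous_on_eq) (auto simp: F)
  qed
  have seg_cont_t: "continuous_on {0..1} (seg x)" for x
    unfolding seg_def by (intro continuous_intros)
  have seg_t: "(seg x has_derivative (\<lambda>h. h *\<^sub>R (x - y))) (at t within T)" for x t T
    unfolding seg_def by (auto intro!: derivative_eq_intros)
  have seg_x: "((\<lambda>x. seg x t) has_derivative (\<lambda>h. t *\<^sub>R h)) (at x within T)" for x t T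
    unfolding seg_def by (auto intro!: derivative_eq_intros)
  define D where "D x = integral (cbox 0 1) (F x)" for x
  have D_cont: "continuous_on U D"
    unfolding D_def by (rule integral_continuous_on_param[OF cF])
  have D_deriv: "((\<lambda>x. integral {0..1} (\<lambda>t. A (y + t *\<^sub>R (x - y)) (x - y))) has_derivative blinfun_apply (D x)) (at x)"
    if x: "x \<in> U" for x
  proof -
    have "((\<lambda>x. integral (cbox 0 1) (\<lambda>t. A (seg x t) (x - y))) has_derivative integral (cbox 0 1) (F x)) (at x within U)"
    proof (rule leibniz_rule[OF _ _ cF x U(2)])
      fix x t assume x: "x \<in> U" and t: "t \<in> cbox 0 (1::real)"
      then have t': "t \<in> {0..1}" by simp
      have "((\<lambda>x. A (seg x t)) has_derivative (\<lambda>h. A' (seg x t) (t *\<^sub>R h))) (at x within U)"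
        using has_derivative_compose[OF seg_x A[OF segU[OF x t']]] .
      then show "((\<lambda>x. A (seg x t) (x - y)) has_derivative blinfun_apply (F x t)) (at x within U)"
        by (rule has_derivative_eq_rhs[OF blinfun.FDERIV])
          (auto intro!: derivative_eq_intros simp: F[OF x t'] linear_cmul[OF bounded_linear.linear[OF bl[OF segU[OF x t']]]] blinfun.scaleR_left)
    next
      fix x assume x: "x \<in> U"
      show "(\<lambda>t. A (seg x t) (x - y)) integrable_on cbox 0 1"
        using segU[OF x]
        by (intro integrable_continuous continuous_intros continuous_on_compose2[OF contA]) (auto simp: seg_cont_t)
    qed
    then show ?thesis
      using at_within_open[OF x U(1)] by (simp add: D_def seg_def)
  qed
  have D_bound: "norm (D x - A x) \<le> e * norm (x - y)"
    if x: "x \<in> U" and e: "0 \<le> e"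
      and sym: "\<And>z v w. z \<in> U \<Longrightarrow> norm (A' z v w - A' z w v) \<le> e * norm v * norm w" for x e
  proof (rule norm_blinfun_bound)
    show "0 \<le> e * norm (x - y)" using e by simp
    fix v
    have FI: "F x integrable_on {0..1}"
    proof -
      have "continuous_on {0..1} (\<lambda>t. (\<lambda>(x, t). F x t) (x, t))"
        by (rule continuous_on_compose2[OF cF]) (use x in \<open>auto intro!: continuous_intros\<close>)
      then show ?thesis by (simp add: integrable_continuous_interval)
    qed
    have "((\<lambda>t. F x t v) has_integral D x v) {0..1}"
      using has_integral_linear[OF integrable_integral[OF FI] blinfun.bounded_linear_left[of v]]
      by (simp add: D_def o_def)
    then have I1: "((\<lambda>t. A (seg x t) v + t *\<^sub>R A' (seg x t) v (x - y)) has_integral D x v) {0..1}"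
      by (rule has_integral_eq[rotated]) (use F[OF x] in auto)
    \<comment> \<open>The integrand is the t-derivative of t A(seg x t) v, so it differs from F only by dA.\<close>
    have I2: "((\<lambda>t. A (seg x t) v + t *\<^sub>R A' (seg x t) (x - y) v) has_integral A x v) {0..1}"
    proof -
      have "((\<lambda>t. A (seg x t) v + t *\<^sub>R A' (seg x t) (x - y) v) has_integral
        1 *\<^sub>R A (seg x 1) v - 0 *\<^sub>R A (seg x 0) v) {0..1}"
      proof (rule fundamental_theorem_of_calculus)
        fix t :: real assume t: "t \<in> {0..1}"
        note l = bounded_linear.linear[OF bl[OF segU[OF x t]]]
        have "((\<lambda>t. A (seg x t)) has_derivative (\<lambda>h. A' (seg x t) (h *\<^sub>R (x - y)))) (at t within {0..1})"
          using has_derivative_compose[OF seg_t A[OF segU[OF x t]]] .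
        then have dv: "((\<lambda>t. A (seg x t) v) has_derivative (\<lambda>h. A' (seg x t) (h *\<^sub>R (x - y)) v)) (at t within {0..1})"
          by (auto intro!: derivative_eq_intros)
        show "((\<lambda>t. t *\<^sub>R A (seg x t) v) has_vector_derivative A (seg x t) v + t *\<^sub>R A' (seg x t) (x - y) v) (at t within {0..1})"
          unfolding has_vector_derivative_def
          by (rule has_derivative_eq_rhs[OF has_derivative_scaleR[OF has_derivative_ident dv]])
            (simp add: fun_eq_iff linear_cmul[OF l] blinfun.scaleR_left scaleR_add_right mult.commute)
      qed simp
      then show ?thesis by (simp add: seg_def)
    qed
    have "norm (D x v - A x v) \<le> e * norm v * norm (x - y) * measure lborel (cbox 0 (1::real))"
    proof (rule has_integral_bound)
      show "((\<lambda>t. (A (seg x t) v + t *\<^sub>R A' (seg x t) v (x - y)) - (A (seg x t) v + t *\<^sub>R A' (seg x t) (x - y) v))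
          has_integral D x v - A x v) (cbox 0 1)"
        using has_integral_diff[OF I1 I2] by simp
      show "0 \<le> e * norm v * norm (x - y)" using e by simp
      fix t :: real assume "t \<in> cbox 0 1"
      then have t: "t \<in> {0..1}" by simp
      have "norm (t *\<^sub>R (A' (seg x t) v (x - y) - A' (seg x t) (x - y) v))
          \<le> 1 * (e * norm v * norm (x - y))"
        unfolding norm_scaleR using t sym[OF segU[OF x t]] by (intro mult_mono) auto
      then show "norm ((A (seg x t) v + t *\<^sub>R A' (seg x t) v (x - y)) - (A (seg x t) v + t *\<^sub>R A' (seg x t) (x - y) v))
          \<le> e * norm v * norm (x - y)"
        by (simp only: add_diff_cancel_left scaleR_diff_right[symmetric] mult_1)
    qed
    then show "norm ((D x - A x) v) \<le> e * norm (x - y) * norm v"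
      by (simp add: blinfun.diff_left mult_ac)
  qed
  show ?thesis
  proof (rule that[OF D_cont D_deriv])
    show "\<forall>x\<in>U. norm (D x - A x) \<le> e * norm (x - y)"
      if "0 \<le> e" "\<forall>z\<in>U. \<forall>v w. norm (A' z v w - A' z w v) \<le> e * norm v * norm w" for e
      using D_bound that by blast
  qed
qed

lemma limit_of_geometric_steps:
  fixes f :: "nat \<Rightarrow> 'b::banach"
  assumes "\<And>n. norm (f (Suc n) - f n) \<le> K / 2 ^ n"
  obtains l where "\<And>n. norm (f n - l) \<le> 2 * K / 2 ^ n"
proof -
  have K: "0 \<le> K" using assms[of 0] by (metis norm_ge_zero order_trans power_0 div_by_1)
  have step: "norm (f (n + m) - f n) \<le> 2 * K / 2 ^ n - 2 * K / 2 ^ (n + m)" for n m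
  proof (induction m)
    case (Suc m)
    have "norm (f (n + Suc m) - f n) \<le> norm (f (Suc (n + m)) - f (n + m)) + norm (f (n + m) - f n)"
      using norm_triangle_ineq[of "f (Suc (n + m)) - f (n + m)" "f (n + m) - f n"] by simp
    also have "\<dots> \<le> K / 2 ^ (n + m) + (2 * K / 2 ^ n - 2 * K / 2 ^ (n + m))"
      using Suc assms[of "n + m"] by linarith
    also have "\<dots> = 2 * K / 2 ^ n - 2 * K / 2 ^ (n + Suc m)"
      by (simp add: field_simps)
    finally show ?case .
  qed simp
  have le: "norm (f (n + m) - f n) \<le> 2 * K / 2 ^ n" for n m
    using step[of n m] K by (smt (verit) divide_nonneg_nonneg mult_nonneg_nonneg zero_le_power)
  have lim0: "(\<lambda>n. 2 * K / 2 ^ n) \<longlonglongrightarrow> 0"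
    by (rule LIMSEQ_divide_realpow_zero) simp
  have "Cauchy f"
    unfolding Cauchy_altdef2
  proof (intro allI impI)
    fix e :: real assume "e > 0"
    then have "eventually (\<lambda>n. 2 * K / 2 ^ n < e) sequentially"
      using lim0 by (rule order_tendstoD(2)[rotated])
    then obtain N where "2 * K / 2 ^ N < e" by (auto simp: eventually_sequentially)
    then have "dist (f n) (f N) < e" if "n \<ge> N" for n
      using le[of N "n - N"] that by (simp add: dist_norm)
    then show "\<exists>N. \<forall>n\<ge>N. dist (f n) (f N) < e" by blast
  qed
  then obtain l where l: "f \<longlonglongrightarrow> l" using Cauchy_convergent_iff convergent_def by blast
  have "norm (f n - l) \<le> 2 * K / 2 ^ n" for n
  proof -
    have "(\<lambda>m. norm (f (m + n) - f n)) \<longlonglongrightarrow> norm (l - f n)"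
      using LIMSEQ_ignore_initial_segment[OF l, of n] by (intro tendsto_intros)
    then have "norm (l - f n) \<le> 2 * K / 2 ^ n"
      using le[of n] by (intro tendsto_upperbound) (auto simp: add.commute)
    then show ?thesis by (simp add: norm_minus_commute)
  qed
  then show ?thesis by (rule that)
qed

text \<open>Picard iteration along segments. Let \<epsilon> = dw - \<Theta>(w) be the defect of an iterate. By the integrability
condition \<open>flat\<close> the exterior derivative of the 1-form \<Theta>(w) depends on \<epsilon> alone,
so by the homotopy formula the next iterate w' satisfies dw' = \<Theta>(w) up to a multiple of \<epsilon>. Hence on a
small set the defects tend to 0 together with the differences of the iterates, and the derivatives of
the iterates converge uniformly to \<Theta>(w).\<close>

lemma integrable_system_local:
  fixes \<Theta> :: "'a::euclidean_space \<Rightarrow> 'b::banach \<Rightarrow>\<^sub>L ('a \<Rightarrow>\<^sub>L 'b)"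
  assumes U: "open U" "convex U" "y \<in> U"
    and \<Theta>: "\<And>x. x \<in> U \<Longrightarrow> (\<Theta> has_derivative \<Theta>' x) (at x)"
    and \<Theta>': "\<And>v. continuous_on U (\<lambda>x. \<Theta>' x v)"
    and flat: "\<And>x v w b. x \<in> U \<Longrightarrow> \<Theta>' x v b w - \<Theta>' x w b v + \<Theta> x (\<Theta> x b v) w - \<Theta> x (\<Theta> x b w) v = 0"
    and M: "\<And>x. x \<in> U \<Longrightarrow> norm (\<Theta> x) \<le> M" and d: "\<And>x. x \<in> U \<Longrightarrow> norm (x - y) \<le> d" and Md: "M * d \<le> 1/8"
  obtains w where "w y = w0" "\<And>x. x \<in> U \<Longrightarrow> (w has_derivative \<Theta> x (w x)) (at x)"
proof -
  have M0: "0 \<le> M" using M[OF U(3)] norm_ge_zero order_trans by blast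
  have d0: "0 \<le> d" using d[OF U(3)] by simp
  have segU: "y + t *\<^sub>R (x - y) \<in> U" if "x \<in> U" "t \<in> {0..1}" for x t
    using convexD_alt[OF U(2) U(3) that(1), of t] that(2) by (simp add: algebra_simps)
  have cont\<Theta>: "continuous_on U \<Theta>"
    using \<Theta> by (meson has_derivative_continuous continuous_at_imp_continuous_on)
  have \<Theta>_bound: "norm (\<Theta> x u) \<le> M * c" if "x \<in> U" "norm u \<le> c" for x u c
    by (rule order_trans[OF norm_blinfun mult_mono[OF M[OF that(1)] that(2) M0 norm_ge_zero]])
  define \<Phi> where "\<Phi> w x = w0 + integral {0..1} (\<lambda>t. \<Theta> (y + t *\<^sub>R (x - y)) (w (y + t *\<^sub>R (x - y))) (x - y))" for w x
  \<comment> \<open>The bound \<open>M * d \<le> 1/8\<close> gives the factor \<open>2 * M * d \<le> 1/4\<close> here and a contraction factor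
    below 1/2 in the next step.\<close>
  have \<Phi>_deriv: "\<exists>D1. continuous_on U D1 \<and> (\<forall>x\<in>U. (\<Phi> w has_derivative blinfun_apply (D1 x)) (at x)) \<and>
      (\<forall>x\<in>U. norm (D1 x - \<Theta> x (w x)) \<le> e / 4)"
    if D: "continuous_on U D" "\<forall>x\<in>U. (w has_derivative blinfun_apply (D x)) (at x)"
      and e: "\<forall>x\<in>U. norm (D x - \<Theta> x (w x)) \<le> e" for w D e
  proof -
    have e0: "0 \<le> e" using e U(3) norm_ge_zero order_trans by blast
    have contw: "continuous_on U w"
      using D(2) by (meson has_derivative_continuous continuous_at_imp_continuous_on)
    have A: "((\<lambda>x. \<Theta> x (w x)) has_derivative (\<lambda>v. \<Theta> x (D x v) + \<Theta>' x v (w x))) (at x)" if "x \<in> U" for x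
      using that D(2) \<Theta> by (intro blinfun.FDERIV) auto
    have A': "continuous_on U (\<lambda>x. \<Theta> x (D x v) + \<Theta>' x v (w x))" for v
      by (intro continuous_intros cont\<Theta> D(1) \<Theta>' contw)
    obtain D1 where D1: "continuous_on U D1"
      "\<And>x. x \<in> U \<Longrightarrow> ((\<lambda>x. integral {0..1} (\<lambda>t. \<Theta> (y + t *\<^sub>R (x - y)) (w (y + t *\<^sub>R (x - y))) (x - y)))
          has_derivative blinfun_apply (D1 x)) (at x)"
      "\<And>e. 0 \<le> e \<Longrightarrow> \<forall>z\<in>U. \<forall>v u.
          norm ((\<Theta> z (D z v) + \<Theta>' z v (w z)) u - (\<Theta> z (D z u) + \<Theta>' z u (w z)) v) \<le> e * norm v * norm u \<Longrightarrow>
        \<forall>x\<in>U. norm (D1 x - \<Theta> x (w x)) \<le> e * norm (x - y)"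
      using poincare_homotopy[OF U A A'] by blast
    have "norm ((\<Theta> z (D z v) + \<Theta>' z v (w z)) u - (\<Theta> z (D z u) + \<Theta>' z u (w z)) v) \<le> 2 * M * e * norm v * norm u"
      if z: "z \<in> U" for z v u
    proof -
      define \<epsilon> where "\<epsilon> = D z - \<Theta> z (w z)"
      have bound: "norm (\<Theta> z (\<epsilon> v) u) \<le> M * e * norm v * norm u" for u v
      proof -
        have "norm (\<Theta> z (\<epsilon> v) u) \<le> norm (\<Theta> z) * (norm \<epsilon> * norm v) * norm u"
          by (rule order_trans[OF norm_blinfun mult_right_mono[OF order_trans[OF norm_blinfun
                mult_left_mono[OF norm_blinfun]]]]) simp_all
        also have "\<dots> \<le> M * (e * norm v) * norm u"
          using M[OF z] e z M0 e0 by (intro mult_mono) (auto simp: \<epsilon>_def)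
        finally show ?thesis by (simp add: mult_ac)
      qed
      have "(\<Theta> z (D z v) + \<Theta>' z v (w z)) u - (\<Theta> z (D z u) + \<Theta>' z u (w z)) v = \<Theta> z (\<epsilon> v) u - \<Theta> z (\<epsilon> u) v"
        using flat[OF z, of v "w z" u] by (simp add: \<epsilon>_def blinfun.bilinear_simps algebra_simps)
      also have "norm \<dots> \<le> M * e * norm v * norm u + M * e * norm u * norm v"
        by (rule order_trans[OF norm_triangle_ineq4 add_mono[OF bound bound]])
      finally show ?thesis by (simp add: mult_ac)
    qed
    then have "\<forall>x\<in>U. norm (D1 x - \<Theta> x (w x)) \<le> 2 * M * e * norm (x - y)"
      using M0 e0 by (intro D1(3)) auto
    moreover have "2 * M * e * norm (x - y) \<le> e / 4" if "x \<in> U" for x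
    proof -
      have "2 * M * e * norm (x - y) \<le> 2 * M * e * d"
        using d[OF that] M0 e0 by (intro mult_left_mono) auto
      also have "\<dots> = 2 * e * (M * d)" by simp
      also have "\<dots> \<le> 2 * e * (1/8)" using Md e0 by (intro mult_left_mono) auto
      finally show ?thesis by simp
    qed
    ultimately have "\<forall>x\<in>U. norm (D1 x - \<Theta> x (w x)) \<le> e / 4"
      using order_trans by blast
    moreover have "\<forall>x\<in>U. (\<Phi> w has_derivative blinfun_apply (D1 x)) (at x)"
      unfolding \<Phi>_def using D1(2) by (auto intro!: derivative_eq_intros)
    ultimately show ?thesis using D1(1) by blast
  qed
  have \<Phi>_diff: "norm (\<Phi> w x - \<Phi> w' x) \<le> c / 2"
    if w: "continuous_on U w" "continuous_on U w'" and c: "\<And>x. x \<in> U \<Longrightarrow> norm (w x - w' x) \<le> c" and x: "x \<in> U" for w w' c x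
  proof -
    have c0: "0 \<le> c" using c[OF U(3)] norm_ge_zero order_trans by blast
    have I: "(\<lambda>t. \<Theta> (y + t *\<^sub>R (x - y)) (w (y + t *\<^sub>R (x - y))) (x - y)) integrable_on {0..1}"
      if "continuous_on U w" for w :: "'a \<Rightarrow> 'b"
      using segU[OF x]
      by (intro integrable_continuous_interval continuous_intros continuous_on_compose2[OF cont\<Theta>]
          continuous_on_compose2[OF that]) auto
    have "norm (\<Phi> w x - \<Phi> w' x) \<le> M * c * d * measure lborel (cbox 0 (1::real))"
    proof (rule has_integral_bound)
      show "((\<lambda>t. \<Theta> (y + t *\<^sub>R (x - y)) (w (y + t *\<^sub>R (x - y))) (x - y) -
          \<Theta> (y + t *\<^sub>R (x - y)) (w' (y + t *\<^sub>R (x - y))) (x - y)) has_integral \<Phi> w x - \<Phi> w' x) (cbox 0 1)"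
        using has_integral_diff[OF integrable_integral[OF I[OF w(1)]] integrable_integral[OF I[OF w(2)]]]
        by (simp add: \<Phi>_def)
      show "0 \<le> M * c * d" using M0 c0 d0 by simp
      fix t :: real assume "t \<in> cbox 0 1"
      then have z: "y + t *\<^sub>R (x - y) \<in> U" using segU[OF x] by simp
      let ?z = "y + t *\<^sub>R (x - y)"
      have "norm (\<Theta> ?z (w ?z - w' ?z) (x - y)) \<le> norm (\<Theta> ?z) * norm (w ?z - w' ?z) * norm (x - y)"
        by (rule order_trans[OF norm_blinfun mult_right_mono[OF norm_blinfun norm_ge_zero]])
      also have "\<dots> \<le> M * c * d" using M[OF z] c[OF z] d[OF x] M0 c0 by (intro mult_mono) auto
      finally show "norm (\<Theta> ?z (w ?z) (x - y) - \<Theta> ?z (w' ?z) (x - y)) \<le> M * c * d"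
        by (simp only: blinfun.diff_right[of "\<Theta> ?z"] blinfun.diff_left)
    qed
    also have "\<dots> = c * (M * d)" by simp
    also have "\<dots> \<le> c * (1/8)" using Md c0 by (intro mult_left_mono) auto
    finally show ?thesis using c0 by simp
  qed
  define W where "W n = (\<Phi> ^^ n) (\<lambda>_. w0)" for n
  have W0: "W 0 = (\<lambda>_. w0)" and WS: "W (Suc n) = \<Phi> (W n)" for n by (simp_all add: W_def)
  have Wy: "W n y = w0" for n by (cases n) (simp_all add: W0 WS \<Phi>_def blinfun.bilinear_simps)
  \<comment> \<open>With this constant, E/4 from the old defect and M |w0| = E/4 from the last increment add up to
    E/2, so the defects decrease by the factor 1/2.\<close>
  define E where "E = 4 * M * norm w0"
  have E0: "0 \<le> E" using M0 by (simp add: E_def)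
  have main: "(\<exists>D. continuous_on U D \<and> (\<forall>x\<in>U. (W n has_derivative blinfun_apply (D x)) (at x)) \<and>
        (\<forall>x\<in>U. norm (D x - \<Theta> x (W n x)) \<le> E / 2 ^ n)) \<and>
      (\<forall>x\<in>U. norm (W (Suc n) x - W n x) \<le> norm w0 / 2 ^ n)" for n
  proof (induction n)
    case 0
    have "norm (\<Theta> x w0) \<le> E" if "x \<in> U" for x
    proof -
      have "norm (\<Theta> x w0) \<le> M * norm w0" using that by (intro \<Theta>_bound) auto
      also have "\<dots> \<le> E" using M0 by (simp add: E_def)
      finally show ?thesis .
    qed
    then have D0: "\<exists>D. continuous_on U D \<and> (\<forall>x\<in>U. (W 0 has_derivative blinfun_apply (D x)) (at x)) \<and>
        (\<forall>x\<in>U. norm (D x - \<Theta> x (W 0 x)) \<le> E / 2 ^ 0)"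
      by (intro exI[of _ "\<lambda>_. 0"]) (simp add: W0 zero_blinfun.rep_eq)
    have "norm (\<Phi> (\<lambda>_. w0) x - \<Phi> (\<lambda>_. 0) x) \<le> norm w0 / 2" if "x \<in> U" for x
      using that by (intro \<Phi>_diff) auto
    moreover have "\<Phi> (\<lambda>_. 0) x = w0" for x by (simp add: \<Phi>_def)
    ultimately have "norm (W (Suc 0) x - W 0 x) \<le> norm w0 / 2" if "x \<in> U" for x
      using that by (simp only: W0 WS)
    moreover have "norm w0 / 2 \<le> norm w0 / 2 ^ 0" by simp
    ultimately have "\<forall>x\<in>U. norm (W (Suc 0) x - W 0 x) \<le> norm w0 / 2 ^ 0"
      using order_trans by blast
    with D0 show ?case by (rule conjI)
  next
    case (Suc n)
    then obtain D where D: "continuous_on U D" "\<forall>x\<in>U. (W n has_derivative blinfun_apply (D x)) (at x)"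
      "\<forall>x\<in>U. norm (D x - \<Theta> x (W n x)) \<le> E / 2 ^ n" by blast
    have step: "\<And>x. x \<in> U \<Longrightarrow> norm (W (Suc n) x - W n x) \<le> norm w0 / 2 ^ n" using Suc by blast
    obtain D1 where D1: "continuous_on U D1" "\<forall>x\<in>U. (W (Suc n) has_derivative blinfun_apply (D1 x)) (at x)"
      "\<forall>x\<in>U. norm (D1 x - \<Theta> x (W n x)) \<le> (E / 2 ^ n) / 4"
      using \<Phi>_deriv[OF D] unfolding WS by blast
    have "norm (D1 x - \<Theta> x (W (Suc n) x)) \<le> E / 2 ^ Suc n" if x: "x \<in> U" for x
    proof -
      have le: "norm (\<Theta> x (W (Suc n) x - W n x)) \<le> M * (norm w0 / 2 ^ n)"
        using x step[OF x] by (rule \<Theta>_bound)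
      have eq: "D1 x - \<Theta> x (W (Suc n) x) = (D1 x - \<Theta> x (W n x)) - \<Theta> x (W (Suc n) x - W n x)"
        by (simp add: blinfun.bilinear_simps)
      have "norm (D1 x - \<Theta> x (W (Suc n) x)) \<le> (E / 2 ^ n) / 4 + M * (norm w0 / 2 ^ n)"
        unfolding eq by (rule order_trans[OF norm_triangle_ineq4 add_mono[OF bspec[OF D1(3) x] le]])
      also have "\<dots> = E / 2 ^ Suc n" by (simp add: E_def field_simps)
      finally show ?thesis .
    qed
    moreover have "norm (W (Suc (Suc n)) x - W (Suc n) x) \<le> norm w0 / 2 ^ Suc n" if x: "x \<in> U" for x
    proof -
      have "continuous_on U (W n)" "continuous_on U (W (Suc n))"
        using D(2) D1(2) by (meson has_derivative_continuous continuous_at_imp_continuous_on)+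
      from \<Phi>_diff[OF this(2,1) step x] show ?thesis by (simp add: WS mult.commute)
    qed
    ultimately show ?case using D1(1,2) by blast
  qed
  have "\<forall>n. \<exists>D. (\<forall>x\<in>U. (W n has_derivative blinfun_apply (D x)) (at x)) \<and>
      (\<forall>x\<in>U. norm (D x - \<Theta> x (W n x)) \<le> E / 2 ^ n)"
    using main by blast
  from choice[OF this] obtain D where D: "\<And>n x. x \<in> U \<Longrightarrow> (W n has_derivative blinfun_apply (D n x)) (at x)"
    "\<And>n x. x \<in> U \<Longrightarrow> norm (D n x - \<Theta> x (W n x)) \<le> E / 2 ^ n"
    by blast
  have "\<exists>l. \<forall>n. norm (W n x - l) \<le> 2 * norm w0 / 2 ^ n" if "x \<in> U" for x
  proof -
    have "norm (W (Suc n) x - W n x) \<le> norm w0 / 2 ^ n" for n using main[of n] that by blast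
    from limit_of_geometric_steps[of "\<lambda>n. W n x", OF this] show ?thesis by blast
  qed
  then obtain w where w: "\<And>n x. x \<in> U \<Longrightarrow> norm (W n x - w x) \<le> 2 * norm w0 / 2 ^ n" by metis
  have lim0: "(\<lambda>n. c / 2 ^ n) \<longlonglongrightarrow> (0::real)" for c
    by (rule LIMSEQ_divide_realpow_zero) simp
  have Ww: "(\<lambda>n. W n x) \<longlonglongrightarrow> w x" if "x \<in> U" for x
  proof -
    have "(\<lambda>n. W n x - w x) \<longlonglongrightarrow> 0"
      by (rule Lim_null_comparison[OF _ lim0[of "2 * norm w0"]]) (simp add: w[OF that])
    then show ?thesis by (rule LIM_zero_cancel)
  qed
  have Dw: "norm (D n x h - \<Theta> x (w x) h) \<le> (2 * E / 2 ^ n) * norm h" if x: "x \<in> U" for n x h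
  proof -
    have le: "norm (\<Theta> x (W n x - w x)) \<le> M * (2 * norm w0 / 2 ^ n)"
      using x w[OF x] by (rule \<Theta>_bound)
    have eq: "D n x - \<Theta> x (w x) = (D n x - \<Theta> x (W n x)) + \<Theta> x (W n x - w x)"
      by (simp add: blinfun.bilinear_simps)
    have "norm (D n x - \<Theta> x (w x)) \<le> E / 2 ^ n + M * (2 * norm w0 / 2 ^ n)"
      unfolding eq by (rule order_trans[OF norm_triangle_ineq add_mono[OF D(2)[OF x] le]])
    also have "\<dots> = (3/2) * (E / 2 ^ n)" by (simp add: E_def field_simps)
    also have "\<dots> \<le> 2 * (E / 2 ^ n)" using E0 by (intro mult_right_mono) auto
    also have "\<dots> = 2 * E / 2 ^ n" by simp
    finally have "norm (D n x - \<Theta> x (w x)) * norm h \<le> (2 * E / 2 ^ n) * norm h"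
      by (rule mult_right_mono) simp
    then show ?thesis
      using norm_blinfun[of "D n x - \<Theta> x (w x)" h] by (simp add: blinfun.diff_left)
  qed
  have "\<exists>g. \<forall>x\<in>U. (\<lambda>n. W n x) \<longlonglongrightarrow> g x \<and> (g has_derivative blinfun_apply (\<Theta> x (w x))) (at x within U)"
  proof (rule has_derivative_sequence[where f = W and f' = "\<lambda>n x. blinfun_apply (D n x)"
        and g' = "\<lambda>x. blinfun_apply (\<Theta> x (w x))", OF U(2) _ _ U(3) Ww[OF U(3)]])
    show "(W n has_derivative blinfun_apply (D n x)) (at x within U)" if "x \<in> U" for n x
      using D(1)[OF that] by (rule has_derivative_at_withinI)
    fix e :: real assume "e > 0"
    then have "eventually (\<lambda>n. 2 * E / 2 ^ n < e) sequentially"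
      using lim0 by (rule order_tendstoD(2)[rotated])
    then show "\<forall>\<^sub>F n in sequentially. \<forall>x\<in>U. \<forall>h. norm (D n x h - \<Theta> x (w x) h) \<le> e * norm h"
    proof (rule eventually_mono, intro ballI allI)
      fix n x and h :: 'a assume n: "2 * E / 2 ^ n < e" and x: "x \<in> U"
      have "(2 * E / 2 ^ n) * norm h \<le> e * norm h" using n by (intro mult_right_mono) auto
      with Dw[OF x] show "norm (D n x h - \<Theta> x (w x) h) \<le> e * norm h" by (rule order_trans)
    qed
  qed
  then obtain g where g: "\<And>x. x \<in> U \<Longrightarrow> (\<lambda>n. W n x) \<longlonglongrightarrow> g x"
    "\<And>x. x \<in> U \<Longrightarrow> (g has_derivative blinfun_apply (\<Theta> x (w x))) (at x within U)" by blast
  have gw: "g x = w x" if "x \<in> U" for x using LIMSEQ_unique[OF g(1) Ww] that by blast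
  show ?thesis
  proof
    have "(\<lambda>n. W n y) \<longlonglongrightarrow> w0" by (simp add: Wy)
    then show "g y = w0" using g(1)[OF U(3)] LIMSEQ_unique by blast
    show "(g has_derivative \<Theta> x (g x)) (at x)" if "x \<in> U" for x
      using g(2)[OF that] at_within_open[OF that U(1)] gw[OF that] by simp
  qed
qed

text \<open>At a maximum point z of |w| on a ball of radius r around a zero of w, the mean value inequality gives
|w z| \<le> r M |w z|, where M bounds \<Theta> and r M \<le> 1/2. So w vanishes near each of its zeros, and the zero set is open
and closed.\<close>

lemma integrable_system_unique:
  fixes \<Theta> :: "'a::euclidean_space \<Rightarrow> 'b::real_normed_vector \<Rightarrow>\<^sub>L ('a \<Rightarrow>\<^sub>L 'b)"
  assumes S: "open S" "connected S" and \<Theta>: "continuous_on S \<Theta>"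
    and w: "\<And>x. x \<in> S \<Longrightarrow> (w has_derivative \<Theta> x (w x)) (at x)"
    and a: "a \<in> S" "w a = 0" and x: "x \<in> S"
  shows "w x = 0"
proof -
  have contw: "continuous_on S w"
    using w by (meson has_derivative_continuous continuous_at_imp_continuous_on)
  have loc: "\<exists>r>0. \<forall>z\<in>ball p r. z \<in> S \<and> w z = 0" if p: "p \<in> S" "w p = 0" for p
  proof -
    obtain R where R: "R > 0" "cball p R \<subseteq> S" using S(1) p(1) open_contains_cball by blast
    have "compact (\<Theta> ` cball p R)"
      using R(2) \<Theta> by (intro compact_continuous_image) (auto intro: continuous_on_subset)
    then obtain M where M: "M > 0" "\<And>z. z \<in> cball p R \<Longrightarrow> norm (\<Theta> z) \<le> M"
      using compact_imp_bounded bounded_pos by (metis imageI)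
    define r where "r = min R (1 / (2 * M))"
    have r: "r > 0" "r \<le> R" "M * r \<le> 1/2"
      using R(1) M(1) by (auto simp: r_def min_def field_simps)
    have sub: "cball p r \<subseteq> S" "cball p r \<subseteq> cball p R" using r(2) R(2) by (auto simp: subset_iff)
    have "continuous_on (cball p r) (\<lambda>z. norm (w z))"
      using contw sub(1) by (intro continuous_intros) (rule continuous_on_subset)
    then obtain z where z: "z \<in> cball p r" "\<And>y. y \<in> cball p r \<Longrightarrow> norm (w y) \<le> norm (w z)"
      using continuous_attains_sup[of "cball p r" "\<lambda>z. norm (w z)"] r(1) by auto
    have "norm (w z - w p) \<le> (M * norm (w z)) * norm (z - p)"
    proof (rule differentiable_bound[OF convex_cball])
      fix y assume y: "y \<in> cball p r"
      show "(w has_derivative \<Theta> y (w y)) (at y within cball p r)"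
        using w[OF subsetD[OF sub(1) y]] by (rule has_derivative_at_withinI)
      have "norm (\<Theta> y (w y)) \<le> norm (\<Theta> y) * norm (w y)" by (rule norm_blinfun)
      also have "\<dots> \<le> M * norm (w z)" using M y sub z(2) by (intro mult_mono) auto
      finally show "onorm (blinfun_apply (\<Theta> y (w y))) \<le> M * norm (w z)" by (simp add: norm_blinfun.rep_eq)
    qed (use z r in auto)
    also have "\<dots> \<le> (M * norm (w z)) * r"
      using z(1) M(1) by (intro mult_left_mono) (auto simp: dist_norm norm_minus_commute)
    also have "\<dots> = (M * r) * norm (w z)" by simp
    also have "\<dots> \<le> (1/2) * norm (w z)" using r(3) by (intro mult_right_mono) auto
    finally have "norm (w z) = 0" using p(2) by simp
    then have "w y = 0" if "y \<in> cball p r" for y using z(2)[OF that] by simp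
    then show ?thesis using r(1) sub(1) by (intro exI[of _ r]) auto
  qed
  have zero: "open {z \<in> S. w z = 0}"
    unfolding open_contains_ball
  proof
    fix p assume "p \<in> {z \<in> S. w z = 0}"
    then obtain r where "r > 0" "\<forall>z\<in>ball p r. z \<in> S \<and> w z = 0" using loc by blast
    then show "\<exists>e>0. ball p e \<subseteq> {z \<in> S. w z = 0}" by blast
  qed
  have "{z \<in> S. w z \<noteq> 0} = S \<inter> w -` (- {0})" by auto
  then have nonzero: "open {z \<in> S. w z \<noteq> 0}"
    using continuous_open_preimage[OF contw S(1), of "- {0}"]
    by (simp add: open_Compl[OF closed_singleton])
  have "{z \<in> S. w z = 0} \<inter> S = {} \<or> {z \<in> S. w z \<noteq> 0} \<inter> S = {}"
    by (rule connectedD[OF S(2) zero nonzero]) auto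
  then show ?thesis using a x by blast
qed

text \<open>The solutions on small balls define a local transport: a value at x is sent to the value at y of the
solution through it. Uniqueness makes this independent of the ball.\<close>

theorem integrable_system_global:
  fixes \<Theta> :: "'a::euclidean_space \<Rightarrow> 'b::banach \<Rightarrow>\<^sub>L ('a \<Rightarrow>\<^sub>L 'b)"
  assumes S: "open S" "simply_connected S" "a \<in> S"
    and \<Theta>: "\<And>x. x \<in> S \<Longrightarrow> (\<Theta> has_derivative \<Theta>' x) (at x)"
    and \<Theta>': "\<And>v. continuous_on S (\<lambda>x. \<Theta>' x v)"
    and flat: "\<And>x v w b. x \<in> S \<Longrightarrow> \<Theta>' x v b w - \<Theta>' x w b v + \<Theta> x (\<Theta> x b v) w - \<Theta> x (\<Theta> x b w) v = 0"
  obtains w where "w a = w0" "\<And>x. x \<in> S \<Longrightarrow> (w has_derivative \<Theta> x (w x)) (at x)"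
proof -
  have cont\<Theta>: "continuous_on S \<Theta>"
    using \<Theta> by (meson has_derivative_continuous continuous_at_imp_continuous_on)
  define sol where "sol B w \<longleftrightarrow> (\<forall>x\<in>B. (w has_derivative blinfun_apply (\<Theta> x (w x))) (at x))" for B w
  define \<B> where "\<B> = {B. open B \<and> convex B \<and> B \<subseteq> S \<and> (\<forall>y\<in>B. \<forall>v. \<exists>w. sol B w \<and> w y = v)}"
  have cover: "\<exists>B\<in>\<B>. p \<in> B" if p: "p \<in> S" for p
  proof -
    obtain R where R: "R > 0" "cball p R \<subseteq> S" using S(1) p open_contains_cball by blast
    have "compact (\<Theta> ` cball p R)"
      using R(2) cont\<Theta> by (intro compact_continuous_image) (auto intro: continuous_on_subset)
    then obtain M where M: "M > 0" "\<And>z. z \<in> cball p R \<Longrightarrow> norm (\<Theta> z) \<le> M"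
      using compact_imp_bounded bounded_pos by (metis imageI)
    \<comment> \<open>Two points of the ball have distance at most 2r, and \<open>M * (2 * r) \<le> 1/8\<close> is what the local
      existence lemma asks for.\<close>
    define r where "r = min R (1 / (16 * M))"
    have r: "r > 0" "r \<le> R" "M * (2 * r) \<le> 1/8"
      using R(1) M(1) by (auto simp: r_def min_def field_simps)
    have sub: "ball p r \<subseteq> S" "ball p r \<subseteq> cball p R" using r(2) R(2) by (auto simp: subset_iff)
    have "\<exists>w. sol (ball p r) w \<and> w y = v" if y: "y \<in> ball p r" for y v
    proof -
      have dist: "norm (x - y) \<le> 2 * r" if "x \<in> ball p r" for x
        using that y dist_triangle2[of x y p] by (simp add: dist_norm[symmetric] dist_commute)
      obtain w where "w y = v" "\<And>x. x \<in> ball p r \<Longrightarrow> (w has_derivative \<Theta> x (w x)) (at x)"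
      proof (rule integrable_system_local[of "ball p r" y \<Theta> \<Theta>' M "2 * r" v])
        show "continuous_on (ball p r) (\<lambda>x. \<Theta>' x v)" for v
          using \<Theta>' sub(1) by (rule continuous_on_subset)
        show "norm (\<Theta> x) \<le> M" if "x \<in> ball p r" for x using M(2) sub(2) that by blast
      qed (use y sub(1) r(3) \<Theta> flat dist in blast)+
      then show ?thesis unfolding sol_def by blast
    qed
    then have "ball p r \<in> \<B>" unfolding \<B>_def using sub(1) by blast
    then show ?thesis using r(1) by (intro bexI[of _ "ball p r"]) simp_all
  qed
  have sol_unique: "w z = w' z"
    if B: "B \<in> \<B>" "B' \<in> \<B>" and w: "sol B w" "sol B' w'" and x: "x \<in> B" "x \<in> B'" "w x = w' x"
      and z: "z \<in> B" "z \<in> B'" for B B' w w' x z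
  proof -
    have "w z - w' z = 0"
    proof (rule integrable_system_unique[of "B \<inter> B'" \<Theta>])
      show "open (B \<inter> B')" "connected (B \<inter> B')"
        using B unfolding \<B>_def by (blast intro: convex_connected convex_Int open_Int)+
      show "continuous_on (B \<inter> B') \<Theta>" using B unfolding \<B>_def by (intro continuous_on_subset[OF cont\<Theta>]) blast
      show "((\<lambda>z. w z - w' z) has_derivative blinfun_apply (\<Theta> y (w y - w' y))) (at y)" if "y \<in> B \<inter> B'" for y
      proof (rule has_derivative_eq_rhs)
        show "((\<lambda>z. w z - w' z) has_derivative (\<lambda>h. \<Theta> y (w y) h - \<Theta> y (w' y) h)) (at y)"
          using w that unfolding sol_def by (intro has_derivative_diff) blast+
      qed (simp add: fun_eq_iff blinfun.diff_right blinfun.diff_left)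
    qed (use x z in auto)
    then show ?thesis by simp
  qed
  define T where "T x y v = (SOME u. \<exists>B\<in>\<B>. \<exists>w. x \<in> B \<and> y \<in> B \<and> sol B w \<and> w x = v \<and> u = w y)" for x y v
  have T: "T x y (w x) = w y" if B: "B \<in> \<B>" "x \<in> B" "y \<in> B" "sol B w" for B x y w
  proof -
    have "\<exists>B'\<in>\<B>. \<exists>w'. x \<in> B' \<and> y \<in> B' \<and> sol B' w' \<and> w' x = w x \<and> T x y (w x) = w' y"
      unfolding T_def by (rule someI_ex) (use B in blast)
    then obtain B' w' where w': "B' \<in> \<B>" "x \<in> B'" "y \<in> B'" "sol B' w'" "w' x = w x" "T x y (w x) = w' y"
      by blast
    have "w' y = w y" by (rule sol_unique[OF w'(1) B(1) w'(4) B(4) w'(2) B(2) w'(5) w'(3) B(3)])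
    then show ?thesis using w'(6) by simp
  qed
  have solB: "\<exists>w. sol B w \<and> w x = v" if "B \<in> \<B>" "x \<in> B" for B x v using that unfolding \<B>_def by blast
  interpret local_transport \<B> T
  proof
    fix B x y z and v :: 'b assume B: "B \<in> \<B>" "x \<in> B" "y \<in> B" "z \<in> B"
    then obtain w where w: "sol B w" "w x = v" using solB by blast
    show "T y z (T x y v) = T x z v" using T[OF B(1,2,3) w(1)] T[OF B(1,3,4) w(1)] T[OF B(1,2,4) w(1)] w(2) by simp
  next
    fix B x and v :: 'b assume B: "B \<in> \<B>" "x \<in> B"
    then obtain w where w: "sol B w" "w x = v" using solB by blast
    show "T x x v = v" using T[OF B(1,2,2) w(1)] w(2) by simp
  qed (auto simp: \<B>_def)
  have SB: "S = \<Union>\<B>" using cover unfolding \<B>_def by blast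
  have "\<exists>W. W a = w0 \<and> (\<forall>B\<in>\<B>. \<forall>x\<in>B. \<forall>y\<in>B. W y = T x y (W x))"
  proof (rule global_section[OF S(2) SB S(3)])
    fix W assume "W a = w0" "\<And>B x y. B \<in> \<B> \<Longrightarrow> x \<in> B \<Longrightarrow> y \<in> B \<Longrightarrow> W y = T x y (W x)"
    then show ?thesis by blast
  qed
  then obtain W where W: "W a = w0" "\<And>B x y. B \<in> \<B> \<Longrightarrow> x \<in> B \<Longrightarrow> y \<in> B \<Longrightarrow> W y = T x y (W x)"
    by blast
  show ?thesis
  proof (rule that[of W, OF W(1)])
    fix x assume "x \<in> S"
    then obtain B where B: "B \<in> \<B>" "x \<in> B" using cover by blast
    then obtain w where w: "sol B w" "w x = W x" using solB by blast
    have eq: "w y = W y" if "y \<in> B" for y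
      using W(2)[OF B that] T[OF B that w(1)] w(2) by simp
    have "open B" using B(1) unfolding \<B>_def by blast
    moreover have "(w has_derivative \<Theta> x (W x)) (at x)"
      using w B(2) unfolding sol_def by metis
    ultimately show "(W has_derivative \<Theta> x (W x)) (at x)"
      using has_derivative_transform_within_open B(2) eq by blast
  qed
qed

section \<open>Calculus of smooth maps\<close>

lemma Dif_eq: "(F has_derivative F') (at x) \<Longrightarrow> Dif F x = F'"
  by (metis frechet_derivative_at)

lemma Dif_works: "F differentiable (at x) \<Longrightarrow> (F has_derivative Dif F x) (at x)"
  by (simp add: frechet_derivative_works)

lemma Dif_cong_open:
  assumes "open S" "x \<in> S" "F differentiable (at x)" "\<And>y. y \<in> S \<Longrightarrow> F y = G y"
  shows "G differentiable (at x)" and "Dif G x = Dif F x"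
proof -
  have G: "(G has_derivative Dif F x) (at x)"
    using has_derivative_transform_within_open[OF Dif_works[OF assms(3)] assms(1,2,4)] .
  then show "G differentiable (at x)" by (rule differentiableI)
  show "Dif G x = Dif F x" using G by (rule Dif_eq)
qed

lemma Ck_on_cong:
  assumes "open S" "\<And>x. x \<in> S \<Longrightarrow> F x = G x" "Ck_on k F S"
  shows "Ck_on k G S"
  using assms(2,3)
proof (induction k arbitrary: F G)
  case 0
  then show ?case by (simp cong: continuous_on_cong)
next
  case (Suc k)
  have d: "G differentiable (at x)" "Dif G x = Dif F x" if "x \<in> S" for x
  proof -
    have "F differentiable (at x)" using Suc.prems(2) that by simp
    from Dif_cong_open[OF assms(1) that this Suc.prems(1)]
    show "G differentiable (at x)" "Dif G x = Dif F x" by blast+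
  qed
  have "Ck_on k (\<lambda>x. Dif G x v) S" for v
  proof (rule Suc.IH)
    show "Ck_on k (\<lambda>x. Dif F x v) S" using Suc.prems(2) by simp
  qed (simp add: d)
  then show ?case using d(1) by simp
qed

lemma Ck_on_Suc_imp: "Ck_on (Suc k) F S \<Longrightarrow> Ck_on k F S"
proof (induction k arbitrary: F)
  case 0
  then show ?case
    by (auto intro!: continuous_at_imp_continuous_on differentiable_imp_continuous_within)
next
  case (Suc k)
  show ?case
    unfolding Ck_on.simps(2)[of k]
  proof (intro conjI allI)
    show "\<forall>x\<in>S. F differentiable at x" using Suc.prems by simp
    fix v
    have "Ck_on (Suc k) (\<lambda>x. Dif F x v) S" using Suc.prems by simp
    then show "Ck_on k (\<lambda>x. Dif F x v) S" by (rule Suc.IH)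
  qed
qed

lemma Ck_on_bounded_linear:
  assumes "open S" "bounded_linear L" "Ck_on k F S"
  shows "Ck_on k (\<lambda>x. L (F x)) S"
  using assms(3)
proof (induction k arbitrary: F)
  case 0
  then show ?case using assms(2) by (simp add: bounded_linear.continuous_on)
next
  case (Suc k)
  have D: "((\<lambda>x. L (F x)) has_derivative (\<lambda>v. L (Dif F x v))) (at x)" if "x \<in> S" for x
    using Suc.prems that by (intro bounded_linear.has_derivative[OF assms(2)] Dif_works) auto
  have "Ck_on k (\<lambda>x. Dif (\<lambda>x. L (F x)) x v) S" for v
    by (rule Ck_on_cong[OF assms(1) _ Suc.IH[of "\<lambda>x. Dif F x v"]]) (use Suc.prems in \<open>simp_all add: Dif_eq[OF D]\<close>)
  then show ?case using D by (auto intro: differentiableI)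
qed

lemma Ck_on_add:
  assumes "open S" "Ck_on k F S" "Ck_on k G S"
  shows "Ck_on k (\<lambda>x. F x + G x) S"
  using assms(2,3)
proof (induction k arbitrary: F G)
  case 0
  then show ?case by (simp add: continuous_on_add)
next
  case (Suc k)
  have D: "((\<lambda>x. F x + G x) has_derivative (\<lambda>v. Dif F x v + Dif G x v)) (at x)" if "x \<in> S" for x
    using Suc.prems that by (intro has_derivative_add Dif_works) auto
  have "Ck_on k (\<lambda>x. Dif (\<lambda>x. F x + G x) x v) S" for v
    by (rule Ck_on_cong[OF assms(1) _ Suc.IH[of "\<lambda>x. Dif F x v" "\<lambda>x. Dif G x v"]]) (use Suc.prems in \<open>simp_all add: Dif_eq[OF D]\<close>)
  then show ?case using D by (auto intro: differentiableI)
qed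

lemma Ck_on_bilinear:
  assumes "open S" "bounded_bilinear bop" "Ck_on k F S" "Ck_on k G S"
  shows "Ck_on k (\<lambda>x. bop (F x) (G x)) S"
  using assms(3,4)
proof (induction k arbitrary: F G)
  case 0
  then show ?case using bounded_bilinear.continuous_on[OF assms(2)] by simp
next
  case (Suc k)
  have D: "((\<lambda>x. bop (F x) (G x)) has_derivative (\<lambda>v. bop (F x) (Dif G x v) + bop (Dif F x v) (G x))) (at x)"
    if "x \<in> S" for x
    using Suc.prems that by (intro bounded_bilinear.FDERIV[OF assms(2)] Dif_works) auto
  have F: "Ck_on k F S" and G: "Ck_on k G S" using Suc.prems by (blast intro: Ck_on_Suc_imp)+
  have "Ck_on k (\<lambda>x. Dif (\<lambda>x. bop (F x) (G x)) x v) S" for v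
  proof (rule Ck_on_cong[OF assms(1)])
    show "Ck_on k (\<lambda>x. bop (F x) (Dif G x v) + bop (Dif F x v) (G x)) S"
      using Suc.prems F G by (intro Ck_on_add[OF assms(1)] Suc.IH) auto
  qed (simp add: Dif_eq[OF D])
  then show ?case using D by (auto intro: differentiableI)
qed

lemma smooth_on_cong: "open S \<Longrightarrow> (\<And>x. x \<in> S \<Longrightarrow> F x = G x) \<Longrightarrow> smooth_on F S \<Longrightarrow> smooth_on G S"
  unfolding smooth_on_def using Ck_on_cong by metis

lemma smooth_on_bounded_linear: "open S \<Longrightarrow> bounded_linear L \<Longrightarrow> smooth_on F S \<Longrightarrow> smooth_on (\<lambda>x. L (F x)) S"
  unfolding smooth_on_def using Ck_on_bounded_linear by blast

lemma smooth_on_add: "open S \<Longrightarrow> smooth_on F S \<Longrightarrow> smooth_on G S \<Longrightarrow> smooth_on (\<lambda>x. F x + G x) S"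
  unfolding smooth_on_def using Ck_on_add by blast

lemma smooth_on_Dif: "smooth_on F S \<Longrightarrow> smooth_on (\<lambda>x. Dif F x v) S"
  unfolding smooth_on_def using Ck_on.simps(2) by blast

lemma smooth_on_differentiable: "smooth_on F S \<Longrightarrow> x \<in> S \<Longrightarrow> F differentiable (at x)"
  unfolding smooth_on_def using Ck_on.simps(2) by blast

lemma smooth_on_continuous: "smooth_on F S \<Longrightarrow> continuous_on S F"
  unfolding smooth_on_def using Ck_on.simps(1) by blast

lemma smooth_on_has_derivative: "smooth_on F S \<Longrightarrow> x \<in> S \<Longrightarrow> (F has_derivative Dif F x) (at x)"
  by (simp add: Dif_works smooth_on_differentiable)

lemma smooth_on_const: "smooth_on (\<lambda>_. c) S"
proof -
  have "Ck_on k (\<lambda>_. c) S" for k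
  proof (induction k arbitrary: c)
    case (Suc k)
    have "Dif (\<lambda>_::'a. c) x v = 0" for x v by (simp add: frechet_derivative_const)
    then show ?case using Suc[of 0] by (simp add: Dif_eq)
  qed simp
  then show ?thesis by (simp add: smooth_on_def)
qed

text \<open>A solution of a linear equation with smooth coefficients is smooth, since its derivative is as smooth
as the solution itself.\<close>

lemma smooth_on_solution:
  assumes S: "open S" and bil: "bounded_bilinear bop"
    and w: "\<And>x. x \<in> S \<Longrightarrow> (w has_derivative (\<lambda>v. bop (w x) (\<theta> x v))) (at x)"
    and \<theta>: "\<And>v. smooth_on (\<lambda>x. \<theta> x v) S"
  shows "smooth_on w S"
proof -
  have "Ck_on k w S" for k
  proof (induction k)
    case 0
    then show ?case using w by (auto intro!: continuous_at_imp_continuous_on has_derivative_continuous)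
  next
    case (Suc k)
    have "Ck_on k (\<lambda>x. Dif w x v) S" for v
    proof (rule Ck_on_cong[OF S])
      show "Ck_on k (\<lambda>x. bop (w x) (\<theta> x v)) S"
        using \<theta> Suc unfolding smooth_on_def by (intro Ck_on_bilinear[OF S bil]) auto
    qed (simp add: Dif_eq[OF w])
    then show ?case using w by (auto intro: differentiableI)
  qed
  then show ?thesis by (simp add: smooth_on_def)
qed

lemma has_derivative_vec_iff:
  fixes F :: "'a::euclidean_space \<Rightarrow> 'b::euclidean_space ^ 'n::finite"
  shows "(F has_derivative F') (at x) \<longleftrightarrow> (\<forall>i. ((\<lambda>x. F x $ i) has_derivative (\<lambda>h. F' h $ i)) (at x))"
proof
  assume "(F has_derivative F') (at x)"
  then show "\<forall>i. ((\<lambda>x. F x $ i) has_derivative (\<lambda>h. F' h $ i)) (at x)"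
    using bounded_linear.has_derivative[OF bounded_linear_vec_nth] by blast
next
  assume *: "\<forall>i. ((\<lambda>x. F x $ i) has_derivative (\<lambda>h. F' h $ i)) (at x)"
  show "(F has_derivative F') (at x)"
    unfolding has_derivative_componentwise_within[of F]
  proof
    fix b :: "'b ^ 'n" assume "b \<in> Basis"
    then obtain i u where b: "b = axis i u" by (auto simp: Basis_vec_def)
    show "((\<lambda>x. F x \<bullet> b) has_derivative (\<lambda>h. F' h \<bullet> b)) (at x)"
      using *[rule_format, of i] by (auto simp: b inner_axis intro!: derivative_eq_intros)
  qed
qed

lemma has_derivative_vec:
  fixes F :: "'i::finite \<Rightarrow> 'a::euclidean_space \<Rightarrow> 'b::euclidean_space"
  assumes "\<And>i. (F i has_derivative F' i) (at x)"
  shows "((\<lambda>x. \<chi> i. F i x) has_derivative (\<lambda>h. \<chi> i. F' i h)) (at x)"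
  using assms by (subst has_derivative_vec_iff) simp

lemma Dif_vec_nth:
  fixes F :: "'a::euclidean_space \<Rightarrow> 'b::euclidean_space ^ 'n::finite"
  assumes "F differentiable (at x)"
  shows "(\<lambda>y. F y $ i) differentiable (at x)" and "Dif (\<lambda>y. F y $ i) x v = Dif F x v $ i"
proof -
  have "((\<lambda>y. F y $ i) has_derivative (\<lambda>h. Dif F x h $ i)) (at x)"
    using Dif_works[OF assms] has_derivative_vec_iff by blast
  then show "(\<lambda>y. F y $ i) differentiable (at x)" "Dif (\<lambda>y. F y $ i) x v = Dif F x v $ i"
    by (auto intro: differentiableI simp: Dif_eq)
qed

lemma smooth_on_vec:
  fixes F :: "'i::finite \<Rightarrow> 'a::euclidean_space \<Rightarrow> 'b::euclidean_space"
  assumes "open S" "\<And>i. smooth_on (F i) S"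
  shows "smooth_on (\<lambda>x. \<chi> i. F i x) S"
proof -
  have "Ck_on k (\<lambda>x. \<chi> i. F i x) S" if "\<And>i. Ck_on k (F i) S" for k and F :: "'i::finite \<Rightarrow> 'a \<Rightarrow> 'b"
    using that
  proof (induction k arbitrary: F)
    case 0
    then show ?case by (auto intro!: continuous_on_vec_lambda)
  next
    case (Suc k)
    have D: "((\<lambda>x. \<chi> i. F i x) has_derivative (\<lambda>v. \<chi> i. Dif (F i) x v)) (at x)" if "x \<in> S" for x
      using Suc.prems that by (intro has_derivative_vec Dif_works) auto
    have "Ck_on k (\<lambda>x. Dif (\<lambda>x. \<chi> i. F i x) x v) S" for v
      by (rule Ck_on_cong[OF assms(1) _ Suc.IH[of "\<lambda>i x. Dif (F i) x v"]]) (use Suc.prems in \<open>simp_all add: Dif_eq[OF D]\<close>)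
    then show ?case using D by (auto intro: differentiableI)
  qed
  then show ?thesis using assms(2) by (simp add: smooth_on_def)
qed

lemma smooth_on_nth: "open S \<Longrightarrow> smooth_on F S \<Longrightarrow> smooth_on (\<lambda>x. F x $ i) S"
  by (rule smooth_on_bounded_linear[OF _ bounded_linear_vec_nth])

subsection \<open>Symmetry of second derivatives\<close>

text \<open>The second difference over a small parallelogram is s^2 times the iterated derivative, up to o(s^2).
To see this, the mean value inequality is applied to the increment of F over s w, as a function of
the position t v along v; its derivative is an increment of the derivative of F in direction v,
which is linear up to o(s).\<close>

lemma second_difference:
  assumes S: "open S" "x \<in> S" and F: "\<And>y. y \<in> S \<Longrightarrow> (F has_derivative F' y) (at y)"
    and L: "((\<lambda>y. F' y v) has_derivative L) (at x)" and e: "e > 0"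
  obtains \<delta> where "\<delta> > 0" "\<And>s. 0 < s \<Longrightarrow> s < \<delta> \<Longrightarrow>
    norm (F (x + s *\<^sub>R v + s *\<^sub>R w) - F (x + s *\<^sub>R v) - F (x + s *\<^sub>R w) + F x - s\<^sup>2 *\<^sub>R L w) \<le> e * s\<^sup>2"
proof -
  define N where "N = norm v + norm w + 1"
  have N: "N > 0" by (simp add: N_def add_nonneg_pos)
  obtain r where r: "r > 0" "ball x r \<subseteq> S" using S open_contains_ball by blast
  have "e / (2 * N) > 0" using e N by simp
  then obtain d where d: "d > 0" "\<And>y. norm (y - x) < d \<Longrightarrow> norm (F' y v - F' x v - L (y - x)) \<le> e / (2 * N) * norm (y - x)"
    using L unfolding has_derivative_at_alt by blast
  have lin: "linear L" using L has_derivative_linear by blast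
  define \<delta> where "\<delta> = min d r / N"
  have \<delta>: "\<delta> > 0" using d r N by (simp add: \<delta>_def)
  have "norm (F (x + s *\<^sub>R v + s *\<^sub>R w) - F (x + s *\<^sub>R v) - F (x + s *\<^sub>R w) + F x - s\<^sup>2 *\<^sub>R L w) \<le> e * s\<^sup>2"
    if s: "0 < s" "s < \<delta>" for s
  proof -
    have sN: "s * N < d" "s * N < r" using s N by (auto simp: \<delta>_def field_simps)
    have small: "norm (t *\<^sub>R v + c *\<^sub>R w) \<le> s * N" if "0 \<le> t" "t \<le> s" "0 \<le> c" "c \<le> s" for t c
    proof -
      have "norm (t *\<^sub>R v + c *\<^sub>R w) \<le> t * norm v + c * norm w"
        using norm_triangle_ineq[of "t *\<^sub>R v" "c *\<^sub>R w"] that by simp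
      also have "\<dots> \<le> s * norm v + s * norm w" using that by (intro add_mono mult_right_mono) auto
      also have "\<dots> \<le> s * N" using s by (simp add: N_def algebra_simps)
      finally show ?thesis .
    qed
    have inS: "x + t *\<^sub>R v + c *\<^sub>R w \<in> S" if "0 \<le> t" "t \<le> s" "0 \<le> c" "c \<le> s" for t c
    proof -
      have "dist x (x + (t *\<^sub>R v + c *\<^sub>R w)) < r"
        using small[OF that] sN(2) by (subst dist_commute) (simp add: dist_norm)
      then show ?thesis using r(2) by (auto simp: add.assoc)
    qed
    have est: "norm (F' (x + t *\<^sub>R v + c *\<^sub>R w) v - F' x v - L (t *\<^sub>R v + c *\<^sub>R w)) \<le> e / 2 * s"
      if "0 \<le> t" "t \<le> s" "0 \<le> c" "c \<le> s" for t c
    proof -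
      have "norm (F' (x + t *\<^sub>R v + c *\<^sub>R w) v - F' x v - L (t *\<^sub>R v + c *\<^sub>R w))
          \<le> e / (2 * N) * norm (t *\<^sub>R v + c *\<^sub>R w)"
        using d(2)[of "x + t *\<^sub>R v + c *\<^sub>R w"] small[OF that] sN(1) by (simp add: add.assoc)
      also have "\<dots> \<le> e / (2 * N) * (s * N)"
        using small[OF that] e N by (intro mult_left_mono) auto
      also have "\<dots> = e / 2 * s" using N by simp
      finally show ?thesis .
    qed
    define \<phi> where "\<phi> t = F (x + t *\<^sub>R v + s *\<^sub>R w) - F (x + t *\<^sub>R v + 0 *\<^sub>R w) - (t * s) *\<^sub>R L w" for t
    define \<phi>' where "\<phi>' t = F' (x + t *\<^sub>R v + s *\<^sub>R w) v - F' (x + t *\<^sub>R v + 0 *\<^sub>R w) v - s *\<^sub>R L w" for t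
    have \<phi>: "(\<phi> has_derivative (\<lambda>h. h *\<^sub>R \<phi>' t)) (at t within {0..s})" if t: "t \<in> {0..s}" for t
    proof -
      have F1: "((\<lambda>t. F (x + t *\<^sub>R v + c *\<^sub>R w)) has_derivative (\<lambda>h. F' (x + t *\<^sub>R v + c *\<^sub>R w) (h *\<^sub>R v))) (at t within {0..s})"
        if "c = 0 \<or> c = s" for c
      proof (rule has_derivative_compose[of _ "\<lambda>h. h *\<^sub>R v"])
        show "((\<lambda>t. x + t *\<^sub>R v + c *\<^sub>R w) has_derivative (\<lambda>h. h *\<^sub>R v)) (at t within {0..s})"
          by (auto intro!: derivative_eq_intros)
        show "(F has_derivative F' (x + t *\<^sub>R v + c *\<^sub>R w)) (at (x + t *\<^sub>R v + c *\<^sub>R w))"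
          using that t s by (intro F inS) auto
      qed
      have sc: "F' (x + t *\<^sub>R v + c *\<^sub>R w) (h *\<^sub>R v) = h *\<^sub>R F' (x + t *\<^sub>R v + c *\<^sub>R w) v" if "c = 0 \<or> c = s" for c h
        by (rule linear_cmul[OF has_derivative_linear[OF F[OF inS]]]) (use that t s in auto)
      have "((\<lambda>t. (t * s) *\<^sub>R L w) has_derivative (\<lambda>h. (h * s) *\<^sub>R L w)) (at t within {0..s})"
        by (auto intro!: derivative_eq_intros)
      from has_derivative_diff[OF has_derivative_diff[OF F1[of s] F1[of 0]] this]
      show ?thesis
        unfolding \<phi>_def[abs_def] \<phi>'_def
        by (rule has_derivative_eq_rhs) (simp_all add: fun_eq_iff sc scaleR_diff_right del: scaleR_zero_left)
    qed
    have "norm (\<phi> s - \<phi> 0) \<le> e * s * norm (s - 0)"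
    proof (rule differentiable_bound[OF _ \<phi>])
      fix t assume t: "t \<in> {0..s}"
      have "\<phi>' t = (F' (x + t *\<^sub>R v + s *\<^sub>R w) v - F' x v - L (t *\<^sub>R v + s *\<^sub>R w))
          - (F' (x + t *\<^sub>R v + 0 *\<^sub>R w) v - F' x v - L (t *\<^sub>R v + 0 *\<^sub>R w))"
        by (simp add: \<phi>'_def linear_add[OF lin] linear_cmul[OF lin])
      also have "norm \<dots> \<le> e / 2 * s + e / 2 * s"
        using t s by (intro order_trans[OF norm_triangle_ineq4] add_mono est) auto
      finally have "norm (\<phi>' t) \<le> e * s" by simp
      then show "onorm (\<lambda>h. h *\<^sub>R \<phi>' t) \<le> e * s"
        using e s(1) by (intro onorm_bound) (auto simp: mult.commute mult_left_mono)
    qed (use s in auto)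
    then show ?thesis
      using s(1) by (simp add: \<phi>_def power2_eq_square algebra_simps)
  qed
  then show ?thesis using \<delta> by (rule that[rotated])
qed

text \<open>The second difference is symmetric in the two directions.\<close>

theorem second_derivative_symmetric:
  assumes S: "open S" "x \<in> S" and F: "\<And>y. y \<in> S \<Longrightarrow> F differentiable (at y)"
    and v: "(\<lambda>y. Dif F y v) differentiable (at x)" and w: "(\<lambda>y. Dif F y w) differentiable (at x)"
  shows "Dif (\<lambda>y. Dif F y v) x w = Dif (\<lambda>y. Dif F y w) x v"
proof -
  define A where "A = Dif (\<lambda>y. Dif F y v) x w"
  define B where "B = Dif (\<lambda>y. Dif F y w) x v"
  have "norm (A - B) \<le> e" if e: "e > 0" for e
  proof -
    note D = second_difference[OF S Dif_works[OF F]]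
    obtain d1 where d1: "d1 > 0" "\<And>s. 0 < s \<Longrightarrow> s < d1 \<Longrightarrow>
      norm (F (x + s *\<^sub>R v + s *\<^sub>R w) - F (x + s *\<^sub>R v) - F (x + s *\<^sub>R w) + F x - s\<^sup>2 *\<^sub>R A) \<le> (e/2) * s\<^sup>2"
      using D[OF _ Dif_works[OF v], of "e/2" w] e unfolding A_def by (metis half_gt_zero)
    obtain d2 where d2: "d2 > 0" "\<And>s. 0 < s \<Longrightarrow> s < d2 \<Longrightarrow>
      norm (F (x + s *\<^sub>R w + s *\<^sub>R v) - F (x + s *\<^sub>R w) - F (x + s *\<^sub>R v) + F x - s\<^sup>2 *\<^sub>R B) \<le> (e/2) * s\<^sup>2"
      using D[OF _ Dif_works[OF w], of "e/2" v] e unfolding B_def by (metis half_gt_zero)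
    define s where "s = min d1 d2 / 2"
    have s: "0 < s" "s < d1" "s < d2" using d1(1) d2(1) by (auto simp: s_def min_def)
    define P where "P = F (x + s *\<^sub>R v + s *\<^sub>R w) - F (x + s *\<^sub>R v) - F (x + s *\<^sub>R w) + F x"
    have P1: "norm (P - s\<^sup>2 *\<^sub>R A) \<le> (e/2) * s\<^sup>2" using d1(2)[OF s(1,2)] by (simp add: P_def)
    have "F (x + s *\<^sub>R w + s *\<^sub>R v) - F (x + s *\<^sub>R w) - F (x + s *\<^sub>R v) + F x = P"
      by (simp add: P_def add.commute add.left_commute)
    then have P2: "norm (P - s\<^sup>2 *\<^sub>R B) \<le> (e/2) * s\<^sup>2" using d2(2)[OF s(1,3)] by simp
    have "s\<^sup>2 * norm (A - B) = norm ((P - s\<^sup>2 *\<^sub>R B) - (P - s\<^sup>2 *\<^sub>R A))"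
      using s(1) by (simp add: scaleR_diff_right[symmetric])
    also have "\<dots> \<le> (e/2) * s\<^sup>2 + (e/2) * s\<^sup>2"
      by (rule order_trans[OF norm_triangle_ineq4 add_mono[OF P2 P1]])
    also have "\<dots> = s\<^sup>2 * e" by simp
    finally show ?thesis using s(1) by simp
  qed
  then have "norm (A - B) = 0" by (meson field_le_epsilon norm_ge_zero order_antisym add_0 less_imp_le zero_less_one dense_ge)
  then show ?thesis by (simp add: A_def B_def)
qed

lemma smooth_on_symmetric:
  assumes "open S" "smooth_on F S" "x \<in> S"
  shows "Dif (\<lambda>y. Dif F y v) x w = Dif (\<lambda>y. Dif F y w) x v"
  using assms by (intro second_derivative_symmetric[OF assms(1,3)]) (auto intro: smooth_on_differentiable smooth_on_Dif)

section \<open>The curvature equations\<close>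

lemma sum_UNIV_Plus:
  "(\<Sum>r\<in>(UNIV::('a::finite + 'b::finite) set). f r) = (\<Sum>a\<in>UNIV. f (Inl a)) + (\<Sum>b\<in>UNIV. f (Inr b))"
  by (simp add: UNIV_Plus_UNIV[symmetric] sum.Plus del: UNIV_Plus_UNIV)

lemma linear_eq_sum_axis:
  fixes L :: "real^'n::finite \<Rightarrow> 'b::real_vector"
  assumes "linear L"
  shows "L v = (\<Sum>k\<in>UNIV. v $ k *\<^sub>R L (axis k 1))"
proof -
  have "L v = L (\<Sum>k\<in>UNIV. v $ k *\<^sub>R axis k 1)"
    using basis_expansion[of v] by (simp add: scalar_mult_eq_scaleR)
  also have "\<dots> = (\<Sum>k\<in>UNIV. v $ k *\<^sub>R L (axis k 1))"
    by (simp add: linear_sum[OF assms] linear_cmul[OF assms])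
  finally show ?thesis .
qed

lemma linear_eq_on_axis:
  fixes L :: "real^'n::finite \<Rightarrow> 'b::real_vector"
  assumes "linear L" "linear L'" "\<And>i. L (axis i 1) = L' (axis i 1)"
  shows "L v = L' v"
  unfolding linear_eq_sum_axis[OF assms(1), of v] linear_eq_sum_axis[OF assms(2), of v] assms(3) ..

text \<open>This reduces identities between 2-forms to pairs of distinct coordinate vectors.\<close>

lemma alternating_eq_0:
  fixes K :: "real^'n::finite \<Rightarrow> real^'n \<Rightarrow> 'b::real_vector"
  assumes lin: "\<And>w. linear (\<lambda>v. K v w)" and alt: "\<And>v w. K v w = - K w v"
    and basis: "\<And>i j. i \<noteq> j \<Longrightarrow> K (axis i 1) (axis j 1) = 0"
  shows "K v w = 0"
proof -
  have "K (axis i 1) (axis i 1) = 0" for i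
    using alt[of "axis i 1" "axis i 1"] by (simp add: eq_neg_iff_add_eq_0 scaleR_2[symmetric])
  then have "K (axis i 1) (axis j 1) = 0" for i j
    using basis by (cases "i = j") auto
  then have "K (axis i 1) w = 0" for i w
    using linear_eq_sum_axis[OF lin, of w "axis i 1"] alt[of "axis i 1" w] by simp
  then show ?thesis using linear_eq_sum_axis[OF lin, of v w] by simp
qed

lemma Dif_linear: "F differentiable (at x) \<Longrightarrow> linear (Dif F x)"
  using Dif_works has_derivative_linear by blast

lemma delta_axis: "delta x (axis i 1) = elem_mat i i"
  by (auto simp: delta_def elem_mat_def vec_eq_iff axis_def)

lemma delta_nth: "delta x v $ i $ j = (if i = j then v $ i else 0)"
  by (simp add: delta_def)

lemma comm_delta_nth: "comm (delta x v) B $ i $ j = (v $ i - v $ j) * B $ i $ j"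
  by (simp add: comm_def matrix_matrix_mult_def delta_def if_distrib[of "\<lambda>z. z * _"]
      if_distrib[of "\<lambda>z. _ * z"] sum.delta sum.delta' algebra_simps cong: if_cong)

lemma delta_mult_vec_nth: "(delta x v *v u) $ i = v $ i * u $ i"
  by (simp add: matrix_vector_mult_def delta_def if_distrib[of "\<lambda>z. z * _"] sum.delta cong: if_cong)

lemma comm_nth: "comm A B $ i $ j = (\<Sum>k\<in>UNIV. A $ i $ k * B $ k $ j - B $ i $ k * A $ k $ j)"
  by (simp add: comm_def matrix_matrix_mult_def sum_subtractf)

lemma linear_comm_right: "linear (comm (A :: real^'m::finite^'m))"
  by (intro linearI) (simp_all add: vec_eq_iff comm_nth sum.distrib sum_subtractf sum_distrib_left algebra_simps)

lemma linear_comm_left: "linear (\<lambda>A. comm A (B :: real^'m::finite^'m))"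
  by (intro linearI) (simp_all add: vec_eq_iff comm_nth sum.distrib sum_subtractf sum_distrib_left algebra_simps)

text \<open>The 1-form [\<delta>, \<beta>] with entries \<beta>_ij (du_i - du_j). If \<beta> is symmetric and
(h_i)_{u_j} = \<beta>_ij h_j, it is the Levi-Civita connection form of the metric \<Sum> h_i^2 du_i^2 in the frame of
normalized coordinate vectors.\<close>

definition rot_form :: "(real^'n \<Rightarrow> real^'n^'n) \<Rightarrow> ('n::finite, real, 'n) mform1" where
  "rot_form \<beta> x v = comm (delta x v) (\<beta> x)"

definition curvature :: "('n::finite, 'a::real_normed_field, 'm::finite) mform1 \<Rightarrow> ('n, 'a, 'm) mform2" where
  "curvature \<theta> x v w = ext_d \<theta> x v w + wedge \<theta> \<theta> x v w"

text \<open>The 2-form d(\<delta>h) + [\<delta>, \<beta>] \<and> \<delta>h of Cartan's first structure equation.\<close>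

definition torsion :: "(real^'n \<Rightarrow> real^'n^'n) \<Rightarrow> (real^'n \<Rightarrow> real^'n) \<Rightarrow> real^'n \<Rightarrow> real^'n \<Rightarrow> real^'n \<Rightarrow> real^'n::finite" where
  "torsion \<beta> h x v w = delta x w *v Dif h x v - delta x v *v Dif h x w
     + (rot_form \<beta> x v *v (delta x w *v h x) - rot_form \<beta> x w *v (delta x v *v h x))"

lemma rot_form_nth: "rot_form \<beta> x v $ i $ j = (v $ i - v $ j) * \<beta> x $ i $ j"
  by (simp add: rot_form_def comm_delta_nth)

lemma has_derivative_nth_nth:
  fixes F :: "'a::euclidean_space \<Rightarrow> real^'n::finite^'m::finite"
  assumes "F differentiable (at x)"
  shows "((\<lambda>y. F y $ i $ j) has_derivative (\<lambda>v. Dif F x v $ i $ j)) (at x)"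
  by (intro bounded_linear.has_derivative[OF bounded_linear_vec_nth] Dif_works[OF assms])

lemma has_derivative_matrix:
  fixes F :: "'a::euclidean_space \<Rightarrow> 'b::euclidean_space^'n::finite^'m::finite"
  assumes "\<And>i j. ((\<lambda>y. F y $ i $ j) has_derivative (\<lambda>v. F' v $ i $ j)) (at x)"
  shows "(F has_derivative F') (at x)"
  by (subst has_derivative_vec_iff, intro allI, subst has_derivative_vec_iff) (simp add: assms)

lemma Dif_rot_form:
  fixes \<beta> :: "real^'n::finite \<Rightarrow> real^'n^'n"
  assumes "\<beta> differentiable (at x)"
  shows "Dif (\<lambda>y. rot_form \<beta> y w) x v = comm (delta x w) (Dif \<beta> x v)"
proof -
  have "((\<lambda>y. rot_form \<beta> y w) has_derivative (\<lambda>v. comm (delta x w) (Dif \<beta> x v))) (at x)"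
    unfolding has_derivative_vec_iff rot_form_nth comm_delta_nth
    using has_derivative_nth_nth[OF assms] by (auto intro!: derivative_eq_intros)
  then show ?thesis by (simp add: Dif_eq)
qed

lemma curvature_rot_form:
  fixes \<beta> :: "real^'n::finite \<Rightarrow> real^'n^'n"
  assumes "\<beta> differentiable (at x)"
  shows "curvature (rot_form \<beta>) x v w = comm (delta x w) (Dif \<beta> x v) - comm (delta x v) (Dif \<beta> x w)
    + comm (rot_form \<beta> x v) (rot_form \<beta> x w)"
  by (simp add: curvature_def ext_d_def wedge_def Dif_rot_form[OF assms] comm_def)

lemma curvature_rot_form_eq_0:
  fixes \<beta> :: "real^'n::finite \<Rightarrow> real^'n^'n"
  assumes \<beta>: "\<beta> differentiable (at x)"
    and "\<And>i j. i \<noteq> j \<Longrightarrow> curvature (rot_form \<beta>) x (axis i 1) (axis j 1) = 0"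
  shows "curvature (rot_form \<beta>) x v w = 0"
proof (rule alternating_eq_0[where K = "curvature (rot_form \<beta>) x"])
  note D = Dif_linear[OF \<beta>]
  have delta: "linear (delta x)" by (intro linearI) (simp_all add: vec_eq_iff delta_nth)
  have 1: "linear (\<lambda>v. comm (delta x w) (Dif \<beta> x v))" for w
    using linear_compose[OF D linear_comm_right] by (simp add: o_def)
  have 2: "linear (\<lambda>v. comm (delta x v) B)" for B
    using linear_compose[OF delta linear_comm_left] by (simp add: o_def)
  have 3: "linear (\<lambda>v. comm (rot_form \<beta> x v) B)" for B
    using linear_compose[OF 2 linear_comm_left] by (simp add: o_def rot_form_def)
  show "linear (\<lambda>v. curvature (rot_form \<beta>) x v w)" for w
    unfolding curvature_rot_form[OF \<beta>] by (rule linear_compose_add[OF linear_compose_sub[OF 1 2] 3])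
  show "curvature (rot_form \<beta>) x v w = - curvature (rot_form \<beta>) x w v" for v w
    by (simp add: curvature_rot_form[OF \<beta>] comm_def)
qed (rule assms(2))

text \<open>Each term of the sum contains the factor w_i v_k - v_i w_k, which is the value of du_k \<and> du_i. The term
with k = i drops out, and the others compare the derivatives of h with \<beta> h.\<close>

lemma torsion_nth:
  assumes "h differentiable (at x)"
  shows "torsion \<beta> h x v w $ i =
    (\<Sum>k\<in>UNIV. (w $ i * v $ k - v $ i * w $ k) * (pd k (\<lambda>y. h y $ i) x - \<beta> x $ i $ k * h x $ k))"
proof -
  have D: "Dif h x v $ i = (\<Sum>k\<in>UNIV. v $ k * pd k (\<lambda>y. h y $ i) x)" for v
    using linear_eq_sum_axis[OF Dif_linear[OF assms], of v]
    by (simp add: pd_def Dif_vec_nth(2)[OF assms])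
  have rot: "(rot_form \<beta> x v *v u) $ i = (\<Sum>k\<in>UNIV. (v $ i - v $ k) * \<beta> x $ i $ k * u $ k)" for v u
    by (simp add: matrix_vector_mult_def rot_form_nth)
  define p where "p k = pd k (\<lambda>y. h y $ i) x" for k
  have "torsion \<beta> h x v w $ i = (\<Sum>k\<in>UNIV. w $ i * (v $ k * p k) - v $ i * (w $ k * p k) +
      ((v $ i - v $ k) * \<beta> x $ i $ k * (w $ k * h x $ k) - (w $ i - w $ k) * \<beta> x $ i $ k * (v $ k * h x $ k)))"
    by (simp add: torsion_def delta_mult_vec_nth rot D p_def[symmetric] sum_distrib_left sum_subtractf sum.distrib)
  also have "\<dots> = (\<Sum>k\<in>UNIV. (w $ i * v $ k - v $ i * w $ k) * (p k - \<beta> x $ i $ k * h x $ k))"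
    by (rule sum.cong) (simp_all add: algebra_simps)
  finally show ?thesis by (simp add: p_def)
qed

lemma torsion_eq_0_iff:
  assumes "h differentiable (at x)"
  shows "(\<forall>v w. torsion \<beta> h x v w = 0) \<longleftrightarrow>
    (\<forall>i j. i \<noteq> j \<longrightarrow> pd j (\<lambda>y. h y $ i) x = \<beta> x $ i $ j * h x $ j)"
    and "(\<forall>i j. i \<noteq> j \<longrightarrow> torsion \<beta> h x (axis i 1) (axis j 1) = 0) \<longleftrightarrow> (\<forall>v w. torsion \<beta> h x v w = 0)"
proof -
  have 1: "pd j (\<lambda>y. h y $ i) x = \<beta> x $ i $ j * h x $ j"
    if "torsion \<beta> h x (axis j 1) (axis i 1) = 0" "i \<noteq> j" for i j
  proof -
    have "0 = torsion \<beta> h x (axis j 1) (axis i 1) $ i" using that by simp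
    also have "\<dots> = pd j (\<lambda>y. h y $ i) x - \<beta> x $ i $ j * h x $ j"
      using that(2) by (simp add: torsion_nth[OF assms] axis_def if_distrib[of "\<lambda>z. z * _"] cong: if_cong)
    finally show ?thesis by simp
  qed
  have 2: "torsion \<beta> h x v w = 0" if "\<forall>i j. i \<noteq> j \<longrightarrow> pd j (\<lambda>y. h y $ i) x = \<beta> x $ i $ j * h x $ j" for v w
  proof -
    have z: "(w $ i * v $ k - v $ i * w $ k) * (pd k (\<lambda>y. h y $ i) x - \<beta> x $ i $ k * h x $ k) = 0" for i k
      using that by (cases "i = k") auto
    show ?thesis unfolding vec_eq_iff torsion_nth[OF assms] z by simp
  qed
  show iff: "(\<forall>v w. torsion \<beta> h x v w = 0) \<longleftrightarrow>
    (\<forall>i j. i \<noteq> j \<longrightarrow> pd j (\<lambda>y. h y $ i) x = \<beta> x $ i $ j * h x $ j)" (is "?T \<longleftrightarrow> ?h")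
  proof
    assume t: ?T
    show ?h by (intro allI impI) (rule 1, use t in auto)
  qed (use 2 in auto)
  show "(\<forall>i j. i \<noteq> j \<longrightarrow> torsion \<beta> h x (axis i 1) (axis j 1) = 0) \<longleftrightarrow> ?T"
  proof
    assume t: "\<forall>i j. i \<noteq> j \<longrightarrow> torsion \<beta> h x (axis i 1) (axis j 1) = 0"
    have ?h by (intro allI impI) (rule 1, use t in auto)
    then show ?T using iff by simp
  qed auto
qed

subsection \<open>The Lax pair\<close>

lemma Dif_lax_form:
  fixes \<beta> :: "real^'n::finite \<Rightarrow> real^'n^'n"
  assumes "\<beta> differentiable (at x)" "h differentiable (at x)"
  shows "Dif (\<lambda>y. lax_form \<beta> h lam y w) x v = (\<chi> r s. case r of
      Inl i \<Rightarrow> (case s of Inl j \<Rightarrow> of_real (comm (delta x w) (Dif \<beta> x v) $ i $ j)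
        | Inr _ \<Rightarrow> of_real ((delta x w *v Dif h x v) $ i))
    | Inr _ \<Rightarrow> 0)" (is "_ = ?D v")
proof -
  have h: "((\<lambda>y. h y $ i) has_derivative (\<lambda>v. Dif h x v $ i)) (at x)" for i
    using Dif_works[OF assms(2)] has_derivative_vec_iff by blast
  have "((\<lambda>y. lax_form \<beta> h lam y w $ r $ s) has_derivative (\<lambda>v. ?D v $ r $ s)) (at x)" for r s
    using has_derivative_nth_nth[OF assms(1)] h
    by (cases r; cases s)
      (auto simp: lax_form_def comm_delta_nth delta_mult_vec_nth delta_nth intro!: derivative_eq_intros)
  then show ?thesis by (intro Dif_eq[THEN fun_cong] has_derivative_matrix)
qed

text \<open>The terms of \<theta> \<and> \<theta> quadratic in \<lambda> cancel because diagonal matrices commute. The linear ones cancel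
because \<delta>(v) and [\<delta>(w), \<beta>] combine to (v_i - v_j)(w_i - w_j) \<beta>_ij, which is symmetric in v and w.\<close>

lemma curvature_lax_form:
  fixes \<beta> :: "real^'n::finite \<Rightarrow> real^'n^'n"
  assumes "\<beta> differentiable (at x)" "h differentiable (at x)"
  shows "curvature (lax_form \<beta> h lam) x v w = (\<chi> r s. case r of
      Inl i \<Rightarrow> (case s of Inl j \<Rightarrow> of_real (curvature (rot_form \<beta>) x v w $ i $ j)
        | Inr _ \<Rightarrow> of_real (torsion \<beta> h x v w $ i))
    | Inr _ \<Rightarrow> 0)"
proof -
  let ?L = "lax_form \<beta> h lam x"
  define c where "c = \<i> * lam"
  define R where "R v i j = complex_of_real (rot_form \<beta> x v $ i $ j)" for v i j
  have R: "R v i j = of_real (v $ i - v $ j) * of_real (\<beta> x $ i $ j)" for v i j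
    by (simp add: R_def rot_form_nth)
  have ll: "?L v $ Inl i $ Inl j = (if i = j then c * of_real (v $ i) else 0) + R v i j"
    and lr: "?L v $ Inl i $ Inr u = of_real (v $ i * h x $ i)" and r: "?L v $ Inr u $ s = 0" for v i j u s
    by (auto simp: lax_form_def R_def c_def rot_form_def delta_nth delta_mult_vec_nth)
  have prod: "(\<Sum>k\<in>UNIV. ?L v $ Inl i $ Inl k * ?L w $ Inl k $ Inl j) =
      (if i = j then c * of_real (v $ i) * (c * of_real (w $ i)) else 0)
      + c * of_real (v $ i) * R w i j + R v i j * (c * of_real (w $ j)) + (\<Sum>k\<in>UNIV. R v i k * R w k j)" for v w i j
    by (simp add: ll distrib_left distrib_right sum.distrib mult_delta_left mult_delta_right)
  have RR: "(\<Sum>k\<in>UNIV. R v i k * R w k j) = of_real ((rot_form \<beta> x v ** rot_form \<beta> x w) $ i $ j)" for v w i j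
    by (simp add: R_def matrix_matrix_mult_def)
  have cancel: "c * of_real (v $ i) * R w i j + R v i j * (c * of_real (w $ j)) =
      c * of_real (w $ i) * R v i j + R w i j * (c * of_real (v $ j))" for i j
    unfolding R by (simp add: algebra_simps)
  have LL: "(?L v ** ?L w) $ Inl i $ Inl j = (\<Sum>k\<in>UNIV. ?L v $ Inl i $ Inl k * ?L w $ Inl k $ Inl j)" for v w i j
    by (simp add: matrix_matrix_mult_def sum_UNIV_Plus r)
  have LR: "(?L v ** ?L w) $ Inl i $ Inr u = c * of_real (v $ i * (w $ i * h x $ i))
      + of_real ((rot_form \<beta> x v *v (delta x w *v h x)) $ i)" for v w i u
    by (simp add: matrix_matrix_mult_def sum_UNIV_Plus r lr ll distrib_right sum.distrib mult_delta_left
        matrix_vector_mult_def[of "rot_form _ _ _"] delta_mult_vec_nth R_def)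
  have top: "wedge (lax_form \<beta> h lam) (lax_form \<beta> h lam) x v w $ Inl i $ Inl j
      = of_real (wedge (rot_form \<beta>) (rot_form \<beta>) x v w $ i $ j)" for i j
  proof -
    have "wedge (lax_form \<beta> h lam) (lax_form \<beta> h lam) x v w $ Inl i $ Inl j =
        (\<Sum>k\<in>UNIV. R v i k * R w k j) - (\<Sum>k\<in>UNIV. R w i k * R v k j)"
      unfolding wedge_def vector_minus_component LL prod using cancel[of i j] by (simp add: algebra_simps)
    then show ?thesis unfolding RR wedge_def by simp
  qed
  have right: "wedge (lax_form \<beta> h lam) (lax_form \<beta> h lam) x v w $ Inl i $ Inr u
      = of_real ((rot_form \<beta> x v *v (delta x w *v h x) - rot_form \<beta> x w *v (delta x v *v h x)) $ i)" for i u
    unfolding wedge_def vector_minus_component LR by (simp add: algebra_simps)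
  have bottom: "wedge (lax_form \<beta> h lam) (lax_form \<beta> h lam) x v w $ Inr u $ s = 0" for u s
    by (simp add: wedge_def matrix_matrix_mult_def r)
  have "curvature (lax_form \<beta> h lam) x v w $ a $ b = (case a of
      Inl i \<Rightarrow> (case b of Inl j \<Rightarrow> of_real (curvature (rot_form \<beta>) x v w $ i $ j)
        | Inr _ \<Rightarrow> of_real (torsion \<beta> h x v w $ i))
    | Inr _ \<Rightarrow> 0)" for a b
    by (cases a; cases b)
      (simp_all add: curvature_def ext_d_def top right bottom Dif_lax_form[OF assms] Dif_rot_form[OF assms(1)] torsion_def)
  then show ?thesis by (simp add: vec_eq_iff)
qed

lemma flat_lax_form_iff:
  fixes \<beta> :: "real^'n::finite \<Rightarrow> real^'n^'n"
  assumes "\<And>x. x \<in> S \<Longrightarrow> \<beta> differentiable (at x)" "\<And>x. x \<in> S \<Longrightarrow> h differentiable (at x)"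
  shows "flat_form_on S (lax_form \<beta> h lam) \<longleftrightarrow>
    (\<forall>x\<in>S. \<forall>v w. curvature (rot_form \<beta>) x v w = 0 \<and> torsion \<beta> h x v w = 0)"
proof -
  have "curvature (lax_form \<beta> h lam) x v w = 0 \<longleftrightarrow> curvature (rot_form \<beta>) x v w = 0 \<and> torsion \<beta> h x v w = 0"
    if "x \<in> S" for x v w
  proof -
    let ?C = "curvature (lax_form \<beta> h lam) x v w"
    have "?C = 0 \<longleftrightarrow> (\<forall>i. (\<forall>j. ?C $ Inl i $ Inl j = 0) \<and> ?C $ Inl i $ Inr () = 0) \<and> (\<forall>s. ?C $ Inr () $ s = 0)"
      unfolding vec_eq_iff by (auto simp: split_sum_all)
    then show ?thesis
      by (auto simp: curvature_lax_form[OF assms(1)[OF that] assms(2)[OF that]] vec_eq_iff)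
  qed
  then show ?thesis unfolding flat_form_on_def curvature_def[symmetric] by blast
qed

subsection \<open>The system of the symmetric pair\<close>

lemma blk_simps [simp]:
  "blk b c x y $ Inl i $ Inl j = b $ i $ j"
  "blk b c x y $ Inl i $ Inr (Inl j) = - (c $ i $ j)"
  "blk b c x y $ Inl i $ Inr (Inr u) = x $ i"
  "blk b c x y $ Inr (Inl i) $ Inl j = c $ i $ j"
  "blk b c x y $ Inr (Inl i) $ Inr (Inl j) = b $ i $ j"
  "blk b c x y $ Inr (Inl i) $ Inr (Inr u) = y $ i"
  "blk b c x y $ Inr (Inr u) $ s = 0"
  by (simp_all add: blk_def)

lemma idx_cases:
  obtains i where "r = Inl i" | i where "r = Inr (Inl i)" | "(r :: 'n + 'n + unit) = Inr (Inr ())"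
  by (cases r rule: sum.exhaust; metis sum.exhaust unit.exhaust)

lemma blk_cases_eq:
  assumes "\<And>i j. M $ Inl i $ Inl j = N $ Inl i $ Inl j" "\<And>i j. M $ Inl i $ Inr (Inl j) = N $ Inl i $ Inr (Inl j)"
    "\<And>i. M $ Inl i $ Inr (Inr ()) = N $ Inl i $ Inr (Inr ())"
    "\<And>i j. M $ Inr (Inl i) $ Inl j = N $ Inr (Inl i) $ Inl j"
    "\<And>i j. M $ Inr (Inl i) $ Inr (Inl j) = N $ Inr (Inl i) $ Inr (Inl j)"
    "\<And>i. M $ Inr (Inl i) $ Inr (Inr ()) = N $ Inr (Inl i) $ Inr (Inr ())"
    "\<And>s. M $ Inr (Inr ()) $ s = N $ Inr (Inr ()) $ s"
  shows "(M :: real^'n::finite idx^'n idx) = N"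
proof -
  have "M $ r $ s = N $ r $ s" for r s
    by (cases r rule: idx_cases; cases s rule: idx_cases) (simp_all add: assms)
  then show ?thesis by (simp add: vec_eq_iff)
qed

lemma blk_add: "blk b c x y + blk b' c' x' y' = blk (b + b') (c + c') (x + x') (y + y')"
  by (rule blk_cases_eq) simp_all

lemma blk_diff: "blk b c x y - blk b' c' x' y' = blk (b - b') (c - c') (x - x') (y - y')"
  by (rule blk_cases_eq) simp_all

lemma blk_minus: "- blk b c x y = blk (- b) (- c) (- x) (- y)"
  by (rule blk_cases_eq) simp_all

lemma blk_eq_0_iff: "blk b c x y = 0 \<longleftrightarrow> b = 0 \<and> c = 0 \<and> x = 0 \<and> y = 0"
proof
  assume *: "blk b c x y = 0"
  have "blk b c x y $ r $ s = 0" for r s by (simp add: *)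
  from this[of "Inl _" "Inl _"] this[of "Inr (Inl _)" "Inl _"] this[of "Inl _" "Inr (Inr ())"]
    this[of "Inr (Inl _)" "Inr (Inr ())"]
  show "b = 0 \<and> c = 0 \<and> x = 0 \<and> y = 0" by (simp add: vec_eq_iff)
next
  assume "b = 0 \<and> c = 0 \<and> x = 0 \<and> y = 0"
  then show "blk b c x y = 0" by (intro blk_cases_eq) simp_all
qed

text \<open>The matrices \<open>blk b c x y\<close> multiply like complex block matrices with first row (b + ic, x + iy) and
last row 0.\<close>

lemma blk_mult:
  "blk b c x y ** blk b' c' x' y' =
    blk (b ** b' - c ** c') (c ** b' + b ** c') (b *v x' - c *v y') (c *v x' + b *v y')"
  by (rule blk_cases_eq)
    (simp_all add: matrix_matrix_mult_def matrix_vector_mult_def sum_UNIV_Plus sum_negf sum_subtractf)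

lemma a_gen_eq_blk: "a_gen j = blk 0 (delta x (axis j 1)) 0 0"
  unfolding delta_axis by (rule blk_cases_eq) (auto simp: a_gen_def elem_mat_def)

lemma pd_q_mat:
  assumes "\<beta> differentiable (at x)" "h differentiable (at x)"
  shows "pd j (q_mat \<beta> h) x = blk 0 (- Dif \<beta> x (axis j 1)) 0 (- Dif h x (axis j 1))"
proof -
  have h: "((\<lambda>y. h y $ i) has_derivative (\<lambda>v. Dif h x v $ i)) (at x)" for i
    using Dif_works[OF assms(2)] has_derivative_vec_iff by blast
  have "((\<lambda>y. q_mat \<beta> h y $ r $ s) has_derivative (\<lambda>v. blk 0 (- Dif \<beta> x v) 0 (- Dif h x v) $ r $ s)) (at x)" for r s
    unfolding q_mat_def using has_derivative_nth_nth[OF assms(1)] h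
    by (cases r rule: idx_cases; cases s rule: idx_cases) (auto intro!: derivative_eq_intros)
  then show ?thesis unfolding pd_def by (intro Dif_eq[THEN fun_cong] has_derivative_matrix)
qed

text \<open>In complex notation a_i is i e_ii and q is -i(\<beta>, h), so the bracket is real: linear part
[e_ii, \<beta>] and translation part e_ii h.\<close>

lemma comm_a_gen: "comm (a_gen i) (blk 0 (- B) 0 (- u)) = blk (comm (delta x (axis i 1)) B) 0 (delta x (axis i 1) *v u) 0"
proof -
  let ?E = "delta x (axis i 1)"
  have neg: "?E ** (- B) = - (?E ** B)" "(- B) ** ?E = - (B ** ?E)" "?E *v (- u) = - (?E *v u)"
    by (simp_all add: matrix_matrix_mult_def matrix_vector_mult_def vec_eq_iff sum_negf)
  show ?thesis
    by (simp add: a_gen_eq_blk[of i x] comm_def[of "blk _ _ _ _"] blk_mult blk_diff neg) (simp add: comm_def)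
qed

lemma system_expression:
  fixes \<beta> :: "real^'n::finite \<Rightarrow> real^'n^'n"
  assumes "\<beta> differentiable (at x)" "h differentiable (at x)"
  shows "- comm (a_gen i) (pd j (q_mat \<beta> h) x) + comm (a_gen j) (pd i (q_mat \<beta> h) x)
      + comm (comm (a_gen i) (q_mat \<beta> h x)) (comm (a_gen j) (q_mat \<beta> h x))
    = blk (curvature (rot_form \<beta>) x (axis i 1) (axis j 1)) 0 (torsion \<beta> h x (axis i 1) (axis j 1)) 0"
proof -
  have "comm (blk B 0 X 0) (blk B' 0 X' 0) = blk (comm B B') 0 (B *v X' - B' *v X) 0" for B B' :: "real^'n^'n" and X X'
    by (simp add: comm_def blk_mult blk_diff)
  then show ?thesis
    unfolding pd_q_mat[OF assms] unfolding q_mat_def comm_a_gen[of _ _ _ x]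
    by (simp add: blk_minus blk_add curvature_rot_form[OF assms(1)] torsion_def rot_form_def)
qed

lemma solves_system_iff:
  fixes \<beta> :: "real^'n::finite \<Rightarrow> real^'n^'n"
  assumes "\<And>x. x \<in> S \<Longrightarrow> \<beta> differentiable (at x)" "\<And>x. x \<in> S \<Longrightarrow> h differentiable (at x)"
    and sym: "\<And>x. x \<in> S \<Longrightarrow> transpose (\<beta> x) = \<beta> x"
  shows "solves_system S (q_mat \<beta> h) \<longleftrightarrow>
    (\<forall>x\<in>S. \<forall>v w. curvature (rot_form \<beta>) x v w = 0 \<and> torsion \<beta> h x v w = 0)"
proof -
  have P: "q_mat \<beta> h x \<in> cartan_P" if "x \<in> S" for x
  proof -
    have "- \<beta> x = transpose (- \<beta> x)" "(0 :: real^'n^'n) = - transpose 0"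
      using sym[OF that] by (auto simp: transpose_def vec_eq_iff)
    then show ?thesis unfolding cartan_P_def lie_alg_def q_mat_def by blast
  qed
  have key: "(\<forall>i j. i \<noteq> j \<longrightarrow> - comm (a_gen i) (pd j (q_mat \<beta> h) x) + comm (a_gen j) (pd i (q_mat \<beta> h) x)
        + comm (comm (a_gen i) (q_mat \<beta> h x)) (comm (a_gen j) (q_mat \<beta> h x)) = 0)
     \<longleftrightarrow> (\<forall>v w. curvature (rot_form \<beta>) x v w = 0 \<and> torsion \<beta> h x v w = 0)" if "x \<in> S" for x
  proof -
    have c: "(\<forall>i j. i \<noteq> j \<longrightarrow> curvature (rot_form \<beta>) x (axis i 1) (axis j 1) = 0) \<longleftrightarrow>
        (\<forall>v w. curvature (rot_form \<beta>) x v w = 0)"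
    proof (intro iffI allI)
      fix v w assume c: "\<forall>i j. i \<noteq> j \<longrightarrow> curvature (rot_form \<beta>) x (axis i 1) (axis j 1) = 0"
      show "curvature (rot_form \<beta>) x v w = 0"
        by (rule curvature_rot_form_eq_0[OF assms(1)[OF that]]) (use c in auto)
    qed auto
    note t = torsion_eq_0_iff(2)[OF assms(2)[OF that], of \<beta>]
    have "(\<forall>i j. i \<noteq> j \<longrightarrow> curvature (rot_form \<beta>) x (axis i 1) (axis j 1) = 0 \<and> (0::real^'n^'n) = 0 \<and>
          torsion \<beta> h x (axis i 1) (axis j 1) = 0 \<and> (0::real^'n) = 0) \<longleftrightarrow>
        (\<forall>v w. curvature (rot_form \<beta>) x v w = 0) \<and> (\<forall>v w. torsion \<beta> h x v w = 0)"
      unfolding c[symmetric] t[symmetric] by blast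
    then show ?thesis
      unfolding system_expression[OF assms(1)[OF that] assms(2)[OF that]] blk_eq_0_iff by blast
  qed
  show ?thesis (is "_ \<longleftrightarrow> ?R")
  proof
    assume L: "solves_system S (q_mat \<beta> h)"
    show ?R by (intro ballI, rule key[THEN iffD1]) (use L[unfolded solves_system_def] in simp_all)
  next
    assume R: ?R
    show "solves_system S (q_mat \<beta> h)"
      unfolding solves_system_def
    proof (intro conjI ballI)
      fix x assume x: "x \<in> S"
      show "q_mat \<beta> h x \<in> cartan_P" using x by (rule P)
      show "\<forall>i j. i \<noteq> j \<longrightarrow> - comm (a_gen i) (pd j (q_mat \<beta> h) x) + comm (a_gen j) (pd i (q_mat \<beta> h) x)
        + comm (comm (a_gen i) (q_mat \<beta> h x)) (comm (a_gen j) (q_mat \<beta> h x)) = 0"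
        using R x by (intro key[THEN iffD2]) simp_all
    qed
  qed
qed

section \<open>Lagrangian immersions in line of curvature coordinates\<close>

lemma Jmul_inner: "Jmul Z \<bullet> Jmul W = Z \<bullet> W" "Z \<bullet> Jmul W = - symp Z W"
  by (simp_all add: inner_eq_Re_herm symp_def herm_def Jmul_def sum_negf[symmetric] sum_subtractf algebra_simps)

lemma normal_part_eq:
  assumes lin: "linear (Dif f x)" and \<xi>: "\<xi> \<in> normal_space_at f x" "Z - \<xi> \<in> range (Dif f x)"
  shows "normal_part f x Z = \<xi>"
  unfolding normal_part_def
proof (rule the_equality)
  fix \<eta> assume \<eta>: "\<eta> \<in> normal_space_at f x \<and> Z - \<eta> \<in> range (Dif f x)"
  obtain u v where u: "Z - \<xi> = Dif f x u" and v: "Z - \<eta> = Dif f x v" using \<xi> \<eta> by blast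
  have "\<eta> - \<xi> = Dif f x (u - v)" by (simp add: linear_diff[OF lin] u[symmetric] v[symmetric])
  moreover have "(\<eta> - \<xi>) \<bullet> Dif f x w = 0" for w
    using \<xi> \<eta> by (simp add: normal_space_at_def inner_diff_left)
  ultimately have "(\<eta> - \<xi>) \<bullet> (\<eta> - \<xi>) = 0" by metis
  then show "\<eta> = \<xi>" by simp
qed (use \<xi> in blast)

text \<open>The definite description in \<open>normal_part\<close> is proper, since the tangent space has an orthogonal
complement.\<close>

lemma normal_part_props:
  assumes lin: "linear (Dif f x)"
  shows "normal_part f x Z \<in> normal_space_at f x" and "Z - normal_part f x Z \<in> range (Dif f x)"
proof -
  have sub: "span (range (Dif f x)) = range (Dif f x)"
    using linear_subspace_image[OF lin subspace_UNIV] span_eq_iff by blast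
  obtain y z where yz: "y \<in> range (Dif f x)" "\<And>w. w \<in> range (Dif f x) \<Longrightarrow> orthogonal z w" "Z = y + z"
    using orthogonal_subspace_decomp_exists[of "range (Dif f x)" Z] unfolding sub by blast
  have "z \<in> normal_space_at f x" "Z - z \<in> range (Dif f x)"
    using yz by (auto simp: normal_space_at_def orthogonal_def)
  with normal_part_eq[OF lin this]
  show "normal_part f x Z \<in> normal_space_at f x" "Z - normal_part f x Z \<in> range (Dif f x)" by simp_all
qed

lemma matrix_inv_diagonal:
  fixes d :: "real^'n::finite"
  assumes "\<And>i. d $ i \<noteq> 0"
  shows "matrix_inv (delta x d) = delta x (\<chi> i. 1 / d $ i)"
proof -
  have mult: "delta x u ** delta x v = delta x (\<chi> i. u $ i * v $ i)" for u v :: "real^'n"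
    by (simp add: vec_eq_iff matrix_matrix_mult_def delta_nth mult_delta_left)
  have one: "delta x (\<chi> i. 1) = (mat 1 :: real^'n^'n)"
    by (simp add: vec_eq_iff delta_nth mat_def)
  have inv: "delta x d ** delta x (\<chi> i. 1 / d $ i) = mat 1" "delta x (\<chi> i. 1 / d $ i) ** delta x d = mat 1"
    using assms one by (simp_all add: mult)
  have "delta x d ** matrix_inv (delta x d) = mat 1 \<and> matrix_inv (delta x d) ** delta x d = mat 1"
    unfolding matrix_inv_def by (rule someI[of _ "delta x (\<chi> i. 1 / d $ i)"]) (simp add: inv)
  then have "matrix_inv (delta x d) ** delta x d = mat 1" by (rule conjunct2)
  then have "matrix_inv (delta x d) ** (delta x d ** delta x (\<chi> i. 1 / d $ i)) = delta x (\<chi> i. 1 / d $ i)"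
    by (simp add: matrix_mul_assoc)
  then show ?thesis by (simp add: inv)
qed

text \<open>A Lagrangian map with first fundamental form \<Sum> h_i^2 du_i^2 and second fundamental form
\<Sum> du_i^2 \<otimes> J f_{u_i}. Both the given and the constructed immersions are instances, so flatness and
non-degeneracy are proved here once.\<close>

locale curvature_coordinates =
  fixes \<Omega> :: "(real^'n::finite) set" and f :: "real^'n \<Rightarrow> complex^'n" and h :: "real^'n \<Rightarrow> real^'n"
  assumes open_domain: "open \<Omega>"
    and smooth_f: "smooth_on f \<Omega>"
    and smooth_h: "smooth_on h \<Omega>"
    and h_nonzero: "x \<in> \<Omega> \<Longrightarrow> h x $ i \<noteq> 0"
    and lagrangian: "lagrangian_on \<Omega> f"
    and first_form: "x \<in> \<Omega> \<Longrightarrow> first_form f x v w = (\<Sum>i\<in>UNIV. (h x $ i)\<^sup>2 * (v $ i) * (w $ i))"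
    and second_form: "x \<in> \<Omega> \<Longrightarrow> second_form f x v w = (\<Sum>i\<in>UNIV. (v $ i * w $ i) *\<^sub>R Jmul (pd i f x))"
begin

abbreviation X :: "'n \<Rightarrow> real^'n \<Rightarrow> complex^'n" where "X i \<equiv> pd i f"
abbreviation Y :: "'n \<Rightarrow> 'n \<Rightarrow> real^'n \<Rightarrow> complex^'n" where "Y i j \<equiv> pd i (pd j f)"

lemma smooth_pd: "smooth_on F \<Omega> \<Longrightarrow> smooth_on (pd i F) \<Omega>"
  unfolding pd_def[abs_def] by (rule smooth_on_Dif)

lemma smooth_X: "smooth_on (X i) \<Omega>"
  by (rule smooth_pd[OF smooth_f])

lemma smooth_Y: "smooth_on (Y i j) \<Omega>"
  by (rule smooth_pd[OF smooth_X])

lemma linear_Dif: "x \<in> \<Omega> \<Longrightarrow> linear (Dif f x)"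
  by (rule Dif_linear[OF smooth_on_differentiable[OF smooth_f]])

lemma Dif_eq_sum_X: "x \<in> \<Omega> \<Longrightarrow> Dif f x v = (\<Sum>k\<in>UNIV. v $ k *\<^sub>R X k x)"
  using linear_eq_sum_axis[OF linear_Dif, of x v] by (simp add: pd_def)

lemma X_inner: "x \<in> \<Omega> \<Longrightarrow> X i x \<bullet> X j x = (if i = j then (h x $ i)\<^sup>2 else 0)"
  using first_form[of x "axis i 1" "axis j 1"]
  by (simp add: first_form_def pd_def axis_def mult_delta_left mult_delta_right)

lemma X_symp: "x \<in> \<Omega> \<Longrightarrow> symp (X i x) (X j x) = 0"
  using lagrangian by (simp add: lagrangian_on_def pd_def)

lemma Y_sym: "x \<in> \<Omega> \<Longrightarrow> Y i j x = Y j i x"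
  unfolding pd_def using smooth_on_symmetric[OF open_domain smooth_f] by blast

lemma pd_Y_sym: "x \<in> \<Omega> \<Longrightarrow> pd i (Y j k) x = pd j (Y i k) x"
  using smooth_on_symmetric[OF open_domain smooth_X] unfolding pd_def[of i] pd_def[of j] by blast

lemma has_derivative_inner_smooth:
  assumes "smooth_on F \<Omega>" "smooth_on G \<Omega>" "x \<in> \<Omega>"
  shows "((\<lambda>y. F y \<bullet> G y) has_derivative (\<lambda>v. F x \<bullet> Dif G x v + Dif F x v \<bullet> G x)) (at x)"
  using assms by (intro has_derivative_inner smooth_on_has_derivative)

lemma pd_inner:
  assumes "smooth_on F \<Omega>" "smooth_on G \<Omega>" "x \<in> \<Omega>"
  shows "pd i (\<lambda>y. F y \<bullet> G y) x = pd i F x \<bullet> G x + F x \<bullet> pd i G x"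
  using Dif_eq[OF has_derivative_inner_smooth[OF assms]] by (simp add: pd_def)

lemma metric_derivative:
  assumes "x \<in> \<Omega>"
  shows "Y k i x \<bullet> X j x + X i x \<bullet> Y k j x = (if i = j then 2 * h x $ i * pd k (\<lambda>y. h y $ i) x else 0)"
proof -
  have h: "(\<lambda>y. h y $ i) differentiable (at x)"
    using Dif_vec_nth(1)[OF smooth_on_differentiable[OF smooth_h assms]] .
  have "((\<lambda>y. if i = j then (h y $ i)\<^sup>2 else 0) has_derivative
      (\<lambda>v. if i = j then 2 * h x $ i * Dif (\<lambda>y. h y $ i) x v else 0)) (at x)"
    using Dif_works[OF h] by (cases "i = j") (auto intro!: derivative_eq_intros)
  then have "((\<lambda>y. X i y \<bullet> X j y) has_derivative
      (\<lambda>v. if i = j then 2 * h x $ i * Dif (\<lambda>y. h y $ i) x v else 0)) (at x)"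
    by (rule has_derivative_transform_within_open[OF _ open_domain assms]) (simp add: X_inner)
  from Dif_eq[OF this] show ?thesis
    using pd_inner[OF smooth_X smooth_X assms, of k i j] by (cases "i = j") (auto simp: pd_def[of k])
qed

text \<open>Each bracket is a derivative of a coefficient of the metric; four of the six terms cancel by the
symmetry of second derivatives.\<close>

lemma koszul:
  assumes x: "x \<in> \<Omega>"
  shows "2 * (Y i j x \<bullet> X k x) = (Y i j x \<bullet> X k x + X j x \<bullet> Y i k x)
    + (Y j i x \<bullet> X k x + X i x \<bullet> Y j k x) - (Y k i x \<bullet> X j x + X i x \<bullet> Y k j x)"
  using Y_sym[OF x, of i j] Y_sym[OF x, of i k] Y_sym[OF x, of k j] by (simp add: inner_commute)

text \<open>The tangential coefficients are read off by taking inner products with the mutually orthogonal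
coordinate vectors; the normal part is the second fundamental form.\<close>

lemma Y_expansion:
  assumes x: "x \<in> \<Omega>"
  shows "Y i j x = (\<Sum>k\<in>UNIV. (Y i j x \<bullet> X k x / (h x $ k)\<^sup>2) *\<^sub>R X k x) + (if i = j then Jmul (X j x) else 0)"
proof -
  have "normal_part f x (Y i j x) = second_form f x (axis i 1) (axis j 1)"
    by (simp add: second_form_def pd_def[abs_def])
  also have "\<dots> = (if i = j then Jmul (X j x) else 0)"
    by (simp add: second_form[OF x] axis_def mult_delta_left if_distrib[of "\<lambda>c. c *\<^sub>R _"] cong: if_cong)
  finally have "Y i j x - (if i = j then Jmul (X j x) else 0) \<in> range (Dif f x)"
    using normal_part_props(2)[OF linear_Dif[OF x], of "Y i j x"] by simp
  then obtain u where u: "Y i j x - (if i = j then Jmul (X j x) else 0) = (\<Sum>k\<in>UNIV. u $ k *\<^sub>R X k x)"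
    using Dif_eq_sum_X[OF x] by auto
  have J0: "Jmul (X j x) \<bullet> X k x = 0" for k
    using X_symp[OF x, of k j] by (simp add: inner_commute[of "Jmul _"] Jmul_inner)
  have "Y i j x \<bullet> X k x = (\<Sum>l\<in>UNIV. u $ l *\<^sub>R X l x) \<bullet> X k x" for k
    unfolding u[symmetric] by (simp add: inner_diff_left J0)
  also have "\<dots> k = u $ k * (h x $ k)\<^sup>2" for k
    by (simp add: inner_sum_left X_inner[OF x] mult_delta_right)
  finally have "Y i j x \<bullet> X k x / (h x $ k)\<^sup>2 = u $ k" for k
    using h_nonzero[OF x, of k] by simp
  then show ?thesis using u by (simp add: algebra_simps)
qed

subsection \<open>Flatness of the induced metric\<close>

lemma metric_matrix_eq: "x \<in> \<Omega> \<Longrightarrow> metric_matrix f x = delta x (\<chi> i. (h x $ i)\<^sup>2)"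
  using X_inner by (simp add: metric_matrix_def first_form_def pd_def vec_eq_iff delta_nth)

lemma christoffel_eq:
  assumes x: "x \<in> \<Omega>"
  shows "christoffel (metric_matrix f) k i j x = Y i j x \<bullet> X k x / (h x $ k)\<^sup>2"
proof -
  have G: "pd i (\<lambda>y. metric_matrix f y $ j $ l) x = Y i j x \<bullet> X l x + X j x \<bullet> Y i l x" for i j l
    using pd_inner[OF smooth_X smooth_X x] by (simp add: metric_matrix_def first_form_def pd_def[abs_def])
  have inv: "matrix_inv (metric_matrix f x) = delta x (\<chi> i. 1 / (h x $ i)\<^sup>2)"
    using matrix_inv_diagonal[of "\<chi> i. (h x $ i)\<^sup>2" x] h_nonzero[OF x] by (simp add: metric_matrix_eq[OF x])
  show ?thesis
    unfolding christoffel_def G koszul[OF x, symmetric] inv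
    by (simp add: delta_nth mult_delta_left)
qed

text \<open>The Gauss equation. The tangential part of the third derivatives of f is symmetric in i and j. It
consists of the terms of the curvature tensor and of products of second fundamental forms
\<langle>II(\<partial>_j, \<partial>_k), II(\<partial>_i, \<partial>_l)\<rangle>. The latter vanish unless i = j = k = l, so they are symmetric in i and j
as well and cancel in the antisymmetrization.\<close>

theorem flat_induced_metric: "flat_immersion_on \<Omega> f"
  unfolding flat_immersion_on_def flat_metric_on_def
proof (intro ballI allI)
  fix x l k i j assume x: "x \<in> \<Omega>"
  define \<Gamma> where "\<Gamma> l j k y = Y j k y \<bullet> X l y / (h y $ l)\<^sup>2" for l j k y
  have \<Gamma>: "Y j k x \<bullet> X l x = \<Gamma> l j k x * (h x $ l)\<^sup>2" for l j k
    using h_nonzero[OF x, of l] by (simp add: \<Gamma>_def)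
  have pd_christoffel: "(h x $ l)\<^sup>2 * pd i (christoffel (metric_matrix f) l j k) x
      = pd i (Y j k) x \<bullet> X l x + Y j k x \<bullet> Y i l x - \<Gamma> l j k x * (2 * (X l x \<bullet> Y i l x))" for i j k
  proof -
    note N = has_derivative_inner_smooth[OF smooth_Y smooth_X x, of j k l]
    note D = has_derivative_inner_smooth[OF smooth_X smooth_X x, of l l]
    define G where "G = (h x $ l)\<^sup>2"
    have G: "X l x \<bullet> X l x = G" by (simp add: G_def X_inner[OF x])
    have nz: "X l x \<bullet> X l x \<noteq> 0" using h_nonzero[OF x] by (simp add: X_inner[OF x])
    have "((\<lambda>y. (Y j k y \<bullet> X l y) / (X l y \<bullet> X l y)) has_derivative
        (\<lambda>v. ((Y j k x \<bullet> Dif (X l) x v + Dif (Y j k) x v \<bullet> X l x) * (X l x \<bullet> X l x)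
          - (Y j k x \<bullet> X l x) * (X l x \<bullet> Dif (X l) x v + Dif (X l) x v \<bullet> X l x)) / ((X l x \<bullet> X l x) * (X l x \<bullet> X l x)))) (at x)"
      by (rule has_derivative_divide'[OF N D nz])
    then have "(christoffel (metric_matrix f) l j k has_derivative
        (\<lambda>v. ((Y j k x \<bullet> Dif (X l) x v + Dif (Y j k) x v \<bullet> X l x) * (X l x \<bullet> X l x)
          - (Y j k x \<bullet> X l x) * (X l x \<bullet> Dif (X l) x v + Dif (X l) x v \<bullet> X l x)) / ((X l x \<bullet> X l x) * (X l x \<bullet> X l x)))) (at x)"
      by (rule has_derivative_transform_within_open[OF _ open_domain x]) (simp add: christoffel_eq X_inner)
    from Dif_eq[OF this] have "pd i (christoffel (metric_matrix f) l j k) x =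
       ((Y j k x \<bullet> Y i l x + pd i (Y j k) x \<bullet> X l x) * (X l x \<bullet> X l x)
          - (Y j k x \<bullet> X l x) * (X l x \<bullet> Y i l x + Y i l x \<bullet> X l x)) / ((X l x \<bullet> X l x) * (X l x \<bullet> X l x))"
      by (simp add: pd_def[of i])
    then have pd: "pd i (christoffel (metric_matrix f) l j k) x = ((Y j k x \<bullet> Y i l x + pd i (Y j k) x \<bullet> X l x) * G
          - \<Gamma> l j k x * G * (2 * (X l x \<bullet> Y i l x))) / (G * G)"
      unfolding G \<Gamma>[of j k l, folded G_def] inner_commute[of "Y i l x" "X l x"] by simp
    show ?thesis
      unfolding pd G_def[symmetric] using nz unfolding G by (simp add: field_simps)
  qed
  \<comment> \<open>The last term is the product of the second fundamental forms.\<close>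
  have YY: "Y j k x \<bullet> Y i l x = (\<Sum>m\<in>UNIV. \<Gamma> m j k x * (X m x \<bullet> Y i l x))
      + (if j = k \<and> i = l \<and> k = l then (h x $ l)\<^sup>2 else 0)" for i j
  proof -
    have JY: "Jmul (X k x) \<bullet> Y i l x = (if i = l \<and> k = l then (h x $ l)\<^sup>2 else 0)"
    proof -
      have "Jmul (X k x) \<bullet> X m x = 0" for m
        using X_symp[OF x, of m k] by (simp add: inner_commute[of "Jmul _"] Jmul_inner)
      then show ?thesis
        by (subst Y_expansion[OF x]) (simp add: inner_add_right inner_sum_right Jmul_inner(1) X_inner[OF x])
    qed
    have "Y j k x = (\<Sum>m\<in>UNIV. \<Gamma> m j k x *\<^sub>R X m x) + (if j = k then Jmul (X k x) else 0)"
      unfolding \<Gamma>_def by (rule Y_expansion[OF x])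
    then have "Y j k x \<bullet> Y i l x = ((\<Sum>m\<in>UNIV. \<Gamma> m j k x *\<^sub>R X m x) + (if j = k then Jmul (X k x) else 0)) \<bullet> Y i l x"
      by (rule arg_cong)
    then show ?thesis using JY by (cases "j = k") (auto simp: inner_add_left inner_sum_left)
  qed
  \<comment> \<open>The derivative of the metric coefficient of m and l is zero unless m = l.\<close>
  have quad: "(h x $ l)\<^sup>2 * (\<Sum>m\<in>UNIV. \<Gamma> l i m x * \<Gamma> m j k x) + (\<Sum>m\<in>UNIV. \<Gamma> m j k x * (X m x \<bullet> Y i l x))
      = \<Gamma> l j k x * (2 * (X l x \<bullet> Y i l x))" for i j
  proof -
    have "(h x $ l)\<^sup>2 * (\<Gamma> l i m x * \<Gamma> m j k x) + \<Gamma> m j k x * (X m x \<bullet> Y i l x)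
        = (if m = l then \<Gamma> l j k x * (2 * (X l x \<bullet> Y i l x)) else 0)" for m
    proof -
      have "(h x $ l)\<^sup>2 * (\<Gamma> l i m x * \<Gamma> m j k x) + \<Gamma> m j k x * (X m x \<bullet> Y i l x)
          = \<Gamma> m j k x * (Y i m x \<bullet> X l x + X m x \<bullet> Y i l x)"
        by (simp add: \<Gamma> algebra_simps)
      then show ?thesis
        using metric_derivative[OF x, of i m l] by (auto simp: inner_commute)
    qed
    then show ?thesis by (simp add: sum_distrib_left sum.distrib[symmetric])
  qed
  have half: "(h x $ l)\<^sup>2 * (pd i (christoffel (metric_matrix f) l j k) x + (\<Sum>m\<in>UNIV. \<Gamma> l i m x * \<Gamma> m j k x))
      = pd i (Y j k) x \<bullet> X l x + (if j = k \<and> i = l \<and> k = l then (h x $ l)\<^sup>2 else 0)" for i j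
    using pd_christoffel[of i j k] YY[of j i] quad[of i j] by (simp add: distrib_left)
  have c: "christoffel (metric_matrix f) l j k x = \<Gamma> l j k x" for l j k
    by (simp add: christoffel_eq[OF x] \<Gamma>_def)
  have "(h x $ l)\<^sup>2 * riemann (metric_matrix f) l k i j x =
      (h x $ l)\<^sup>2 * (pd i (christoffel (metric_matrix f) l j k) x + (\<Sum>m\<in>UNIV. \<Gamma> l i m x * \<Gamma> m j k x))
    - (h x $ l)\<^sup>2 * (pd j (christoffel (metric_matrix f) l i k) x + (\<Sum>m\<in>UNIV. \<Gamma> l j m x * \<Gamma> m i k x))"
    by (simp add: riemann_def c sum_subtractf algebra_simps)
  also have "\<dots> = 0"
    unfolding half using pd_Y_sym[OF x, of i j k] by auto
  finally show "riemann (metric_matrix f) l k i j x = 0" using h_nonzero[OF x, of l] by simp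
qed

subsection \<open>Non-degeneracy of the normal bundle\<close>

text \<open>The entry A_ij of the shape operator of \<xi> satisfies h_i^2 A_ij = (J f_{u_j}) \<bullet> \<xi> if i = j, and it is 0
otherwise. So shape operators are diagonal, and every diagonal matrix occurs because the vectors J f_{u_i} are normal and orthogonal to each other.\<close>

theorem nondegenerate_normal_bundle: "nondegenerate_normal_bundle_on \<Omega> f"
  unfolding nondegenerate_normal_bundle_on_def
proof
  fix x assume x: "x \<in> \<Omega>"
  have lin: "linear (delta x :: real^'n \<Rightarrow> real^'n^'n)" by (intro linearI) (simp_all add: vec_eq_iff delta_nth)
  have inj: "inj (delta x :: real^'n \<Rightarrow> real^'n^'n)"
    by (rule injI) (auto simp: vec_eq_iff delta_nth split: if_splits)
  have J0: "Jmul (X j x) \<bullet> X k x = 0" for j k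
    using X_symp[OF x, of k j] by (simp add: inner_commute[of "Jmul _"] Jmul_inner)
  have "shape_operators f x = range (delta x)"
  proof (intro equalityI subsetI)
    fix A assume "A \<in> shape_operators f x"
    then obtain \<xi> where \<xi>: "\<And>v w. first_form f x (A *v v) w = second_form f x v w \<bullet> \<xi>"
      unfolding shape_operators_def is_shape_operator_def by blast
    have "A $ i $ j = 0" if "i \<noteq> j" for i j
    proof -
      have "(h x $ i)\<^sup>2 * A $ i $ j = first_form f x (A *v axis j 1) (axis i 1)"
        by (simp add: first_form[OF x] matrix_vector_mult_basis column_def axis_def[of i] mult_delta_right)
      also have "\<dots> = 0"
        unfolding \<xi> using that by (simp add: second_form[OF x] axis_def mult_delta_left if_distrib[of "\<lambda>c. c *\<^sub>R _"] cong: if_cong)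
      finally show ?thesis using h_nonzero[OF x, of i] by simp
    qed
    then have "A = delta x (\<chi> i. A $ i $ i)" by (auto simp: vec_eq_iff delta_nth)
    then show "A \<in> range (delta x)" by blast
  next
    fix A assume "A \<in> range (delta x)"
    then obtain c where A: "A = delta x c" by blast
    define \<xi> where "\<xi> = (\<Sum>k\<in>UNIV. c $ k *\<^sub>R Jmul (X k x))"
    have "\<xi> \<in> normal_space_at f x"
      by (simp add: normal_space_at_def \<xi>_def Dif_eq_sum_X[OF x] inner_sum_left inner_sum_right J0)
    moreover have "is_shape_operator f x \<xi> A"
      unfolding is_shape_operator_def
      by (simp add: A \<xi>_def first_form[OF x] second_form[OF x] delta_mult_vec_nth inner_sum_left inner_sum_right
          Jmul_inner(1) X_inner[OF x] mult_delta_right mult_ac)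
    ultimately show "A \<in> shape_operators f x" unfolding shape_operators_def by blast
  qed
  then show "dim (shape_operators f x) = CARD('n)"
    using dim_image_eq[OF lin, of UNIV] inj by (simp add: inj_on_def)
qed

end

section \<open>Parallel frames\<close>

lemma bounded_bilinear_matrix_mult:
  "bounded_bilinear ((**) :: complex^'m::finite^'m \<Rightarrow> complex^'m^'m \<Rightarrow> complex^'m^'m)"
  unfolding bilinear_conv_bounded_bilinear[symmetric] bilinear_def
  by (intro conjI allI linearI)
    (simp_all add: vec_eq_iff matrix_matrix_mult_def sum.distrib scaleR_sum_right distrib_left distrib_right)

lemma linear_lax_form: "linear (lax_form \<beta> h lam x)"
proof (rule linearI)
  fix u v :: "real^'a" and c :: real
  have "lax_form \<beta> h lam x (u + v) $ r $ s = (lax_form \<beta> h lam x u + lax_form \<beta> h lam x v) $ r $ s" for r s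
    by (cases r; cases s)
      (auto simp: lax_form_def comm_delta_nth delta_nth delta_mult_vec_nth algebra_simps)
  then show "lax_form \<beta> h lam x (u + v) = lax_form \<beta> h lam x u + lax_form \<beta> h lam x v"
    by (simp add: vec_eq_iff)
  have "lax_form \<beta> h lam x (c *\<^sub>R u) $ r $ s = (c *\<^sub>R lax_form \<beta> h lam x u) $ r $ s" for r s
    by (cases r; cases s)
      (auto simp: lax_form_def comm_delta_nth delta_nth delta_mult_vec_nth scaleR_conv_of_real[where 'a = complex] algebra_simps)
  then show "lax_form \<beta> h lam x (c *\<^sub>R u) = c *\<^sub>R lax_form \<beta> h lam x u"
    by (simp add: vec_eq_iff)
qed

lemma smooth_lax_form:
  fixes \<beta> :: "real^'n::finite \<Rightarrow> real^'n^'n"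
  assumes S: "open S" and \<beta>: "smooth_on \<beta> S" and h: "smooth_on h S"
  shows "smooth_on (\<lambda>x. lax_form \<beta> h lam x v) S"
proof -
  have \<beta>_ij: "smooth_on (\<lambda>x. c *\<^sub>R complex_of_real (\<beta> x $ i $ j)) S" for c i j
    by (intro smooth_on_bounded_linear[OF S bounded_linear_scaleR_right] smooth_on_bounded_linear[OF S bounded_linear_of_real]
        smooth_on_nth[OF S] \<beta>)
  have h_i: "smooth_on (\<lambda>x. c *\<^sub>R complex_of_real (h x $ i)) S" for c i
    by (intro smooth_on_bounded_linear[OF S bounded_linear_scaleR_right] smooth_on_bounded_linear[OF S bounded_linear_of_real]
        smooth_on_nth[OF S] h)
  have entry: "smooth_on (\<lambda>x. lax_form \<beta> h lam x v $ r $ s) S" for r s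
  proof (cases r)
    case r: (Inl i)
    show ?thesis
    proof (cases s)
      case (Inl j)
      have "smooth_on (\<lambda>x. (\<i> * lam * of_real (delta 0 v $ i $ j)) + (v $ i - v $ j) *\<^sub>R complex_of_real (\<beta> x $ i $ j)) S"
        by (intro smooth_on_add[OF S] smooth_on_const \<beta>_ij)
      then show ?thesis
        by (rule smooth_on_cong[OF S, rotated])
          (simp add: r Inl lax_form_def comm_delta_nth delta_nth scaleR_conv_of_real)
    next
      case (Inr u)
      show ?thesis
        by (rule smooth_on_cong[OF S _ h_i[of "v $ i" i]])
          (simp add: r Inr lax_form_def delta_mult_vec_nth scaleR_conv_of_real)
    qed
  next
    case (Inr u)
    then show ?thesis by (simp add: lax_form_def smooth_on_const)
  qed
  have "smooth_on (\<lambda>x. \<chi> r. \<chi> s. lax_form \<beta> h lam x v $ r $ s) S"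
    by (intro smooth_on_vec[OF S] entry)
  then show ?thesis by simp
qed

lemma parallel_frame_smooth:
  fixes G :: "real^'n::finite \<Rightarrow> complex^'m::finite^'m"
  assumes "open S" "\<And>v. smooth_on (\<lambda>x. \<theta> x v) S"
    and "\<And>x. x \<in> S \<Longrightarrow> (G has_derivative (\<lambda>v. G x ** \<theta> x v)) (at x)"
  shows "smooth_on G S"
  by (rule smooth_on_solution[OF assms(1) bounded_bilinear_matrix_mult assms(3,2)])

text \<open>Differentiating dG = G\<theta> once more, the part of the second derivative of G that is antisymmetric in the
two directions is G(d\<theta> + \<theta> \<and> \<theta>).\<close>

lemma parallel_frame_curvature:
  fixes G :: "real^'n::finite \<Rightarrow> complex^'m::finite^'m"
  assumes S: "open S" and \<theta>: "\<And>v. smooth_on (\<lambda>x. \<theta> x v) S"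
    and G: "\<And>x. x \<in> S \<Longrightarrow> (G has_derivative (\<lambda>v. G x ** \<theta> x v)) (at x)" and x: "x \<in> S"
  shows "G x ** curvature \<theta> x v w = 0"
proof -
  have D: "Dif (\<lambda>y. Dif G y w) x v = G x ** Dif (\<lambda>y. \<theta> y w) x v + (G x ** \<theta> x v) ** \<theta> x w" for v w
  proof (rule Dif_eq[THEN fun_cong])
    have "((\<lambda>y. G y ** \<theta> y w) has_derivative (\<lambda>v. G x ** Dif (\<lambda>y. \<theta> y w) x v + (G x ** \<theta> x v) ** \<theta> x w)) (at x)"
      by (rule bounded_bilinear.FDERIV[OF bounded_bilinear_matrix_mult G[OF x] smooth_on_has_derivative[OF \<theta> x]])
    then show "((\<lambda>y. Dif G y w) has_derivative (\<lambda>v. G x ** Dif (\<lambda>y. \<theta> y w) x v + (G x ** \<theta> x v) ** \<theta> x w)) (at x)"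
      by (rule has_derivative_transform_within_open[OF _ S x]) (simp add: Dif_eq[OF G])
  qed
  have "Dif (\<lambda>y. Dif G y w) x v = Dif (\<lambda>y. Dif G y v) x w"
    using smooth_on_symmetric[OF S parallel_frame_smooth[OF S \<theta> G] x] by blast
  then have "G x ** Dif (\<lambda>y. \<theta> y w) x v + (G x ** \<theta> x v) ** \<theta> x w
      = G x ** Dif (\<lambda>y. \<theta> y v) x w + (G x ** \<theta> x w) ** \<theta> x v"
    unfolding D .
  then show ?thesis
    by (simp add: curvature_def ext_d_def wedge_def matrix_mul_assoc
        bounded_bilinear.add_right[OF bounded_bilinear_matrix_mult] bounded_bilinear.diff_right[OF bounded_bilinear_matrix_mult] algebra_simps)
qed

text \<open>An instance of the integrability theorem, with matrices as values and right multiplication by \<theta> as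
the coefficient; flatness of \<theta> is its integrability condition.\<close>

theorem flat_form_parallel_frame:
  fixes \<theta> :: "('n::finite, complex, 'm::finite) mform1"
  assumes S: "open S" "simply_connected S" "a \<in> S"
    and lin: "\<And>x. linear (\<theta> x)" and smooth: "\<And>v. smooth_on (\<lambda>x. \<theta> x v) S"
    and flat: "flat_form_on S \<theta>"
  obtains G where "G a = mat 1" "\<And>x. x \<in> S \<Longrightarrow> (G has_derivative (\<lambda>v. G x ** \<theta> x v)) (at x)"
proof -
  interpret mm: bounded_bilinear "(**) :: complex^'m^'m \<Rightarrow> complex^'m^'m \<Rightarrow> complex^'m^'m"
    by (rule bounded_bilinear_matrix_mult)
  define N :: "'n \<Rightarrow> (real^'n) \<Rightarrow>\<^sub>L real" where "N i = Blinfun (\<lambda>v. v $ i)" for i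
  have N: "blinfun_apply (N i) v = v $ i" for i v
    by (simp add: N_def bounded_linear_Blinfun_apply bounded_linear_vec_nth)
  define Q :: "'n \<Rightarrow> (complex^'m^'m) \<Rightarrow>\<^sub>L ((real^'n) \<Rightarrow>\<^sub>L (complex^'m^'m))"
    where "Q i = Blinfun (\<lambda>c. blinfun_scaleR_left c o\<^sub>L N i)" for i
  have Q: "blinfun_apply (Q i) c = blinfun_scaleR_left c o\<^sub>L N i" for i c
    unfolding Q_def by (subst bounded_linear_Blinfun_apply) (auto intro!: bounded_linear_intros)
  define P where "P i A = Q i o\<^sub>L mm.prod_left A" for i A
  have P: "P i A b v = v $ i *\<^sub>R (b ** A)" for i A b v
    by (simp add: P_def Q N)
  have P_lin: "bounded_linear (P i)" for i
    unfolding P_def by (auto intro!: bounded_linear_intros)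
  \<comment> \<open>Smoothness of \<theta> is known for each fixed tangent vector, so the operator-valued coefficient is
    assembled from the coordinate vectors.\<close>
  define \<Theta> where "\<Theta> x = (\<Sum>i\<in>UNIV. P i (\<theta> x (axis i 1)))" for x
  define \<Theta>' where "\<Theta>' x u = (\<Sum>i\<in>UNIV. P i (Dif (\<lambda>y. \<theta> y (axis i 1)) x u))" for x u
  have \<theta>_sum: "\<theta> x v = (\<Sum>i\<in>UNIV. v $ i *\<^sub>R \<theta> x (axis i 1))" for x v
    by (rule linear_eq_sum_axis[OF lin])
  have D\<theta>_sum: "Dif (\<lambda>y. \<theta> y v) x u = (\<Sum>i\<in>UNIV. v $ i *\<^sub>R Dif (\<lambda>y. \<theta> y (axis i 1)) x u)" if "x \<in> S" for x v u
  proof (rule Dif_eq[THEN fun_cong])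
    show "((\<lambda>y. \<theta> y v) has_derivative (\<lambda>u. \<Sum>i\<in>UNIV. v $ i *\<^sub>R Dif (\<lambda>y. \<theta> y (axis i 1)) x u)) (at x)"
      unfolding \<theta>_sum[of _ v]
      by (intro has_derivative_sum has_derivative_scaleR_right smooth_on_has_derivative[OF smooth that])
  qed
  have \<Theta>_apply: "\<Theta> x b v = b ** \<theta> x v" for x b v
    by (subst \<theta>_sum) (simp add: \<Theta>_def blinfun.sum_left P mm.sum_right mm.scaleR_right)
  have \<Theta>'_apply: "\<Theta>' x u b v = b ** Dif (\<lambda>y. \<theta> y v) x u" if "x \<in> S" for x u b v
    by (subst D\<theta>_sum[OF that]) (simp add: \<Theta>'_def blinfun.sum_left P mm.sum_right mm.scaleR_right)
  have "\<exists>G. G a = mat 1 \<and> (\<forall>x\<in>S. (G has_derivative blinfun_apply (\<Theta> x (G x))) (at x))"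
  proof (rule integrable_system_global[OF S, of \<Theta> \<Theta>' "mat 1"])
    show "(\<Theta> has_derivative \<Theta>' x) (at x)" if "x \<in> S" for x
      unfolding \<Theta>_def[abs_def] \<Theta>'_def[abs_def]
      by (intro has_derivative_sum bounded_linear.has_derivative[OF P_lin] smooth_on_has_derivative[OF smooth that])
    show "continuous_on S (\<lambda>x. \<Theta>' x v)" for v
      unfolding \<Theta>'_def
      by (intro continuous_on_sum bounded_linear.continuous_on[OF P_lin] smooth_on_continuous[OF smooth_on_Dif[OF smooth]])
    show "\<Theta>' x v b w - \<Theta>' x w b v + \<Theta> x (\<Theta> x b v) w - \<Theta> x (\<Theta> x b w) v = 0" if "x \<in> S" for x v w b
    proof -
      have "b ** (ext_d \<theta> x v w + wedge \<theta> \<theta> x v w) = 0"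
        using flat that by (simp add: flat_form_on_def mm.zero_right)
      then have "b ** Dif (\<lambda>y. \<theta> y w) x v - b ** Dif (\<lambda>y. \<theta> y v) x w
          + (b ** \<theta> x v ** \<theta> x w - b ** \<theta> x w ** \<theta> x v) = 0"
        by (simp add: ext_d_def wedge_def mm.add_right mm.diff_right matrix_mul_assoc)
      then show ?thesis unfolding \<Theta>_apply \<Theta>'_apply[OF that] by (simp add: algebra_simps)
    qed
    fix G assume "G a = mat 1" "\<And>x. x \<in> S \<Longrightarrow> (G has_derivative blinfun_apply (\<Theta> x (G x))) (at x)"
    then show ?thesis by blast
  qed
  then obtain G where G: "G a = mat 1" "\<And>x. x \<in> S \<Longrightarrow> (G has_derivative blinfun_apply (\<Theta> x (G x))) (at x)"
    by blast
  show ?thesis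
  proof (rule that[of G, OF G(1)])
    fix x assume "x \<in> S"
    then show "(G has_derivative (\<lambda>v. G x ** \<theta> x v)) (at x)"
      using G(2)[of x] by (simp add: \<Theta>_apply[symmetric] eta_contract_eq)
  qed
qed

lemma lax_form_mult:
  fixes A :: "complex^('n::finite + unit)^('n + unit)"
  shows "(A ** lax_form \<beta> h lam x v) $ r $ Inl j = (\<Sum>k\<in>UNIV. A $ r $ Inl k * of_real (rot_form \<beta> x v $ k $ j))
      + \<i> * lam * of_real (v $ j) * A $ r $ Inl j"
    and "(A ** lax_form \<beta> h lam x v) $ r $ Inr u = (\<Sum>k\<in>UNIV. A $ r $ Inl k * of_real (v $ k * h x $ k))"
  by (simp_all add: matrix_matrix_mult_def sum_UNIV_Plus lax_form_def rot_form_def delta_nth delta_mult_vec_nth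
      distrib_left distrib_right sum.distrib mult_delta_left mult_delta_right
      if_distrib[of complex_of_real] mult_ac cong: if_cong)

lemma herm_orthonormal_columns:
  fixes U :: "complex^'n::finite^'n"
  assumes "\<And>j k. (\<Sum>a\<in>UNIV. cnj (U $ a $ j) * U $ a $ k) = (if j = k then 1 else 0)"
  shows "herm (\<chi> a. \<Sum>k\<in>UNIV. U $ a $ k * c k) (\<chi> a. \<Sum>k\<in>UNIV. U $ a $ k * d k) = (\<Sum>k\<in>UNIV. cnj (c k) * d k)"
proof -
  have "herm (\<chi> a. \<Sum>k\<in>UNIV. U $ a $ k * c k) (\<chi> a. \<Sum>k\<in>UNIV. U $ a $ k * d k)
      = (\<Sum>a\<in>UNIV. \<Sum>j\<in>UNIV. \<Sum>k\<in>UNIV. cnj (c j) * d k * (cnj (U $ a $ j) * U $ a $ k))"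
    by (simp only: herm_def vec_lambda_beta cnj_sum complex_cnj_mult sum_product) (simp only: mult_ac)
  also have "\<dots> = (\<Sum>j\<in>UNIV. \<Sum>k\<in>UNIV. cnj (c j) * d k * (\<Sum>a\<in>UNIV. cnj (U $ a $ j) * U $ a $ k))"
    unfolding sum_distrib_left by (subst sum.swap, rule sum.cong[OF refl], rule sum.swap)
  also have "\<dots> = (\<Sum>k\<in>UNIV. cnj (c k) * d k)"
    by (simp add: assms mult_delta_right)
  finally show ?thesis .
qed

section \<open>The moving frame of an immersion\<close>

context curvature_coordinates
begin

text \<open>Normalized by h and not by the length |h|, in accordance with the frame equation df = U\<delta>h.\<close>

definition unit_frame :: "'n \<Rightarrow> real^'n \<Rightarrow> complex^'n" where
  "unit_frame j x = (1 / h x $ j) *\<^sub>R X j x"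

text \<open>The second term is the coefficient of the connection form [\<delta>, \<beta>] for the frame of normalized
coordinate vectors, rescaled to the coordinate vectors themselves; the first one comes from the
variation of their lengths.\<close>

lemma Y_inner_X:
  assumes x: "x \<in> \<Omega>" and sym: "\<And>i j. \<beta> x $ i $ j = \<beta> x $ j $ i"
    and h: "\<And>i j. i \<noteq> j \<Longrightarrow> pd j (\<lambda>y. h y $ i) x = \<beta> x $ i $ j * h x $ j"
  shows "Y i j x \<bullet> X k x = (if j = k then h x $ j * pd i (\<lambda>y. h y $ j) x else 0)
    + (axis i 1 $ k - axis i 1 $ j) * \<beta> x $ k $ j * h x $ j * h x $ k"
proof -
  note K = koszul[OF x, of i j k, unfolded metric_derivative[OF x]]
  show ?thesis
  proof (cases "j = k")
    case True
    with K show ?thesis by (simp add: inner_commute split: if_splits)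
  next
    case False
    then have "pd j (\<lambda>y. h y $ k) x = \<beta> x $ k $ j * h x $ j" "pd k (\<lambda>y. h y $ j) x = \<beta> x $ k $ j * h x $ k"
      using h[of k j] h[of j k] sym[of j k] by simp_all
    with K False show ?thesis by (cases "i = k"; cases "i = j") (simp_all add: axis_def)
  qed
qed

text \<open>The structure equation. The term containing J is the normal part, which is the \<lambda>-term of the Lax form
at \<lambda> = 1.\<close>

lemma has_derivative_unit_frame:
  assumes x: "x \<in> \<Omega>" and sym: "\<And>i j. \<beta> x $ i $ j = \<beta> x $ j $ i"
    and h: "\<And>i j. i \<noteq> j \<Longrightarrow> pd j (\<lambda>y. h y $ i) x = \<beta> x $ i $ j * h x $ j"
  shows "(unit_frame j has_derivative (\<lambda>v. (\<Sum>k\<in>UNIV. rot_form \<beta> x v $ k $ j *\<^sub>R unit_frame k x) + v $ j *\<^sub>R Jmul (unit_frame j x))) (at x)"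
proof -
  have hD: "((\<lambda>y. h y $ j) has_derivative Dif (\<lambda>y. h y $ j) x) (at x)"
    using Dif_works[OF Dif_vec_nth(1)[OF smooth_on_differentiable[OF smooth_h x]]] .
  have nz: "h x $ j \<noteq> 0" using h_nonzero[OF x] .
  define L where "L v = (1 / h x $ j) *\<^sub>R Dif (X j) x v + (- (1 / h x $ j * Dif (\<lambda>y. h y $ j) x v * (1 / h x $ j))) *\<^sub>R X j x" for v
  have "((\<lambda>y. inverse (h y $ j)) has_derivative (\<lambda>v. - (inverse (h x $ j) * Dif (\<lambda>y. h y $ j) x v * inverse (h x $ j)))) (at x)"
    by (rule Deriv.has_derivative_inverse[OF nz hD])
  from has_derivative_scaleR[OF this smooth_on_has_derivative[OF smooth_X x, of j]]
  have D: "(unit_frame j has_derivative L) (at x)"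
    unfolding unit_frame_def[abs_def] L_def[abs_def] by (simp add: inverse_eq_divide)
  have "L v = (\<Sum>k\<in>UNIV. rot_form \<beta> x v $ k $ j *\<^sub>R unit_frame k x) + v $ j *\<^sub>R Jmul (unit_frame j x)" for v
  proof (rule linear_eq_on_axis[where L = L and
        L' = "\<lambda>v. (\<Sum>k\<in>UNIV. rot_form \<beta> x v $ k $ j *\<^sub>R unit_frame k x) + v $ j *\<^sub>R Jmul (unit_frame j x)"])
    show "linear L" using D by (rule has_derivative_linear)
    show "linear (\<lambda>v. (\<Sum>k\<in>UNIV. rot_form \<beta> x v $ k $ j *\<^sub>R unit_frame k x) + v $ j *\<^sub>R Jmul (unit_frame j x))"
      by (intro linearI) (simp_all add: rot_form_nth sum.distrib sum_subtractf scaleR_sum_right scaleR_add_left algebra_simps)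
    fix i
    have J: "(1 / h x $ j) *\<^sub>R Jmul (X j x) = Jmul (unit_frame j x)"
      by (simp add: unit_frame_def Jmul_def vec_eq_iff)
    have coeff: "(1 / h x $ j) * (Y i j x \<bullet> X k x / (h x $ k)\<^sup>2) =
        rot_form \<beta> x (axis i 1) $ k $ j * (1 / h x $ k) + (if j = k then (1 / h x $ j * pd i (\<lambda>y. h y $ j) x * (1 / h x $ j)) else 0)" for k
      using nz h_nonzero[OF x, of k]
      by (auto simp: Y_inner_X[where \<beta> = \<beta>, OF x sym h] rot_form_nth field_simps power2_eq_square)
    have "L (axis i 1) = (1 / h x $ j) *\<^sub>R Y i j x - (1 / h x $ j * pd i (\<lambda>y. h y $ j) x * (1 / h x $ j)) *\<^sub>R X j x"
      by (simp add: L_def pd_def[of i])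
    also have "(1 / h x $ j) *\<^sub>R Y i j x = (1 / h x $ j) *\<^sub>R ((\<Sum>k\<in>UNIV. (Y i j x \<bullet> X k x / (h x $ k)\<^sup>2) *\<^sub>R X k x)
        + (if i = j then Jmul (X j x) else 0))"
      using Y_expansion[OF x, of i j] by simp
    also have "\<dots> = (\<Sum>k\<in>UNIV. ((1 / h x $ j) * (Y i j x \<bullet> X k x / (h x $ k)\<^sup>2)) *\<^sub>R X k x)
        + axis i 1 $ j *\<^sub>R Jmul (unit_frame j x)"
      using J by (cases "i = j") (auto simp: scaleR_add_right scaleR_sum_right axis_def)
    also have "(\<Sum>k\<in>UNIV. ((1 / h x $ j) * (Y i j x \<bullet> X k x / (h x $ k)\<^sup>2)) *\<^sub>R X k x)
        = (\<Sum>k\<in>UNIV. rot_form \<beta> x (axis i 1) $ k $ j *\<^sub>R unit_frame k x)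
          + (1 / h x $ j * pd i (\<lambda>y. h y $ j) x * (1 / h x $ j)) *\<^sub>R X j x"
      unfolding coeff by (simp add: scaleR_add_left sum.distrib unit_frame_def if_distrib[of "\<lambda>c. c *\<^sub>R _"] cong: if_cong)
    finally show "L (axis i 1) = (\<Sum>k\<in>UNIV. rot_form \<beta> x (axis i 1) $ k $ j *\<^sub>R unit_frame k x) + axis i 1 $ j *\<^sub>R Jmul (unit_frame j x)"
      by simp
  qed
  then have "L = (\<lambda>v. (\<Sum>k\<in>UNIV. rot_form \<beta> x v $ k $ j *\<^sub>R unit_frame k x) + v $ j *\<^sub>R Jmul (unit_frame j x))"
    by (rule ext)
  with D show ?thesis by (rule back_subst)
qed

theorem rotation_coefficients_flat:
  assumes \<beta>: "smooth_on \<beta> \<Omega>" and sym: "\<And>x. x \<in> \<Omega> \<Longrightarrow> transpose (\<beta> x) = \<beta> x"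
    and h: "\<And>x i j. x \<in> \<Omega> \<Longrightarrow> i \<noteq> j \<Longrightarrow> pd j (\<lambda>y. h y $ i) x = \<beta> x $ i $ j * h x $ j"
    and x: "x \<in> \<Omega>"
  shows "curvature (rot_form \<beta>) x v w = 0"
proof -
  \<comment> \<open>The frame as an affine motion: the normalized coordinate vectors form its linear part and f its
    translation part. The structure equation is dG = G\<theta>.\<close>
  define G :: "real^'n \<Rightarrow> complex^('n + unit)^('n + unit)" where "G y = (\<chi> r s. case r of
      Inl a \<Rightarrow> (case s of Inl j \<Rightarrow> unit_frame j y $ a | Inr u \<Rightarrow> f y $ a)
    | Inr u \<Rightarrow> (case s of Inl j \<Rightarrow> 0 | Inr u \<Rightarrow> 1))" for y
  have G_simps: "G y $ Inl a $ Inl j = unit_frame j y $ a" "G y $ Inl a $ Inr u = f y $ a" "G y $ Inr u $ Inl j = 0" "G y $ Inr u $ Inr u = 1"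
    for y a j u by (simp_all add: G_def)
  have G: "(G has_derivative (\<lambda>v. G y ** lax_form \<beta> h 1 y v)) (at y)" if y: "y \<in> \<Omega>" for y
  proof (rule has_derivative_matrix)
    have sym': "\<beta> y $ i $ j = \<beta> y $ j $ i" for i j
      using arg_cong[OF sym[OF y], of "\<lambda>M. M $ j $ i"] by (simp add: transpose_def)
    note E' = has_derivative_unit_frame[where \<beta> = \<beta>, OF y sym' h[OF y]]
    fix r s
    show "((\<lambda>y. G y $ r $ s) has_derivative (\<lambda>v. (G y ** lax_form \<beta> h 1 y v) $ r $ s)) (at y)"
    proof (cases r)
      case r: (Inl a)
      show ?thesis
      proof (cases s)
        case (Inl j)
        show ?thesis
          unfolding r Inl G_simps
        proof (rule has_derivative_eq_rhs)
          show "((\<lambda>y. unit_frame j y $ a) has_derivative (\<lambda>v. ((\<Sum>k\<in>UNIV. rot_form \<beta> y v $ k $ j *\<^sub>R unit_frame k y) + v $ j *\<^sub>R Jmul (unit_frame j y)) $ a)) (at y)"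
            by (rule bounded_linear.has_derivative[OF bounded_linear_vec_nth E'])
          show "(\<lambda>v. ((\<Sum>k\<in>UNIV. rot_form \<beta> y v $ k $ j *\<^sub>R unit_frame k y) + v $ j *\<^sub>R Jmul (unit_frame j y)) $ a)
              = (\<lambda>v. (G y ** lax_form \<beta> h 1 y v) $ Inl a $ Inl j)"
            by (simp add: fun_eq_iff G_simps lax_form_mult Jmul_def scaleR_conv_of_real[where 'a = complex] mult_ac)
        qed
      next
        case (Inr u)
        have "Dif f y v $ a = (\<Sum>k\<in>UNIV. unit_frame k y $ a * of_real (v $ k * h y $ k))" for v
          using h_nonzero[OF y] by (simp add: Dif_eq_sum_X[OF y] unit_frame_def scaleR_conv_of_real[where 'a = complex] mult_ac)
        with bounded_linear.has_derivative[OF bounded_linear_vec_nth smooth_on_has_derivative[OF smooth_f y], of a]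
        show ?thesis by (simp add: r Inr G_simps lax_form_mult)
      qed
    next
      case r: (Inr u)
      show ?thesis by (cases s) (simp_all add: r G_simps lax_form_mult)
    qed
  qed
  have d\<beta>: "\<beta> differentiable (at x)" and dh: "h differentiable (at x)"
    using smooth_on_differentiable \<beta> smooth_h x by blast+
  have GC: "G x ** curvature (lax_form \<beta> h 1) x v w = 0"
    by (rule parallel_frame_curvature[OF open_domain smooth_lax_form[OF open_domain \<beta> smooth_h] G x])
  have "unit_frame l x \<bullet> (\<Sum>k\<in>UNIV. curvature (rot_form \<beta>) x v w $ k $ j *\<^sub>R unit_frame k x) = curvature (rot_form \<beta>) x v w $ l $ j" for l j
    using h_nonzero[OF x] by (simp add: inner_sum_right unit_frame_def X_inner[OF x] power2_eq_square mult_delta_right)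
  moreover have "(\<Sum>k\<in>UNIV. curvature (rot_form \<beta>) x v w $ k $ j *\<^sub>R unit_frame k x) = 0" for j
  proof -
    have "(\<Sum>k\<in>UNIV. curvature (rot_form \<beta>) x v w $ k $ j *\<^sub>R unit_frame k x) $ a = (G x ** curvature (lax_form \<beta> h 1) x v w) $ Inl a $ Inl j" for a
      by (simp add: matrix_matrix_mult_def sum_UNIV_Plus curvature_lax_form[OF d\<beta> dh] G_simps
          scaleR_conv_of_real[where 'a = complex] mult_ac)
    then show ?thesis unfolding GC by (simp add: vec_eq_iff)
  qed
  ultimately show ?thesis by (simp add: vec_eq_iff)
qed

end

section \<open>Reconstruction of the immersion\<close>

text \<open>The frame equation dG = G\<theta> at \<lambda> = 1 contains dU = U(i\<delta> + [\<delta>, \<beta>]) and df = U\<delta>h. As U is unitary, f_{u_j} is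
h_j times a column of U, and these columns are a Hermitian orthonormal frame; this gives the first
fundamental form and the Lagrangian property. In the second derivatives of f the real multiples of
the columns are tangent, and the term i\<delta> contributes the normal part.\<close>

theorem immersion_from_flat_lax_form:
  fixes \<Omega> :: "(real^'n::finite) set"
  assumes \<Omega>: "open \<Omega>" "connected \<Omega>" "simply_connected \<Omega>" "p \<in> \<Omega>"
    and \<beta>: "smooth_on \<beta> \<Omega>" and h: "smooth_on h \<Omega>"
    and sym: "\<And>x. x \<in> \<Omega> \<Longrightarrow> transpose (\<beta> x) = \<beta> x"
    and nz: "\<And>x i. x \<in> \<Omega> \<Longrightarrow> h x $ i \<noteq> 0"
    and flat: "flat_form_on \<Omega> (lax_form \<beta> h 1)"
  obtains f where "curvature_coordinates \<Omega> f h" "immersion_on \<Omega> f"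
proof -
  define \<theta> where "\<theta> = lax_form \<beta> h 1"
  have smooth_\<theta>: "smooth_on (\<lambda>x. \<theta> x v) \<Omega>" for v
    unfolding \<theta>_def by (rule smooth_lax_form[OF \<Omega>(1) \<beta> h])
  obtain G where Gp: "G p = mat 1" and G: "\<And>x. x \<in> \<Omega> \<Longrightarrow> (G has_derivative (\<lambda>v. G x ** \<theta> x v)) (at x)"
    using flat_form_parallel_frame[OF \<Omega>(1,3,4), of \<theta>] flat linear_lax_form smooth_\<theta> unfolding \<theta>_def by blast
  define U where "U x = (\<chi> a k. G x $ Inl a $ Inl k)" for x
  define f where "f x = (\<chi> a. G x $ Inl a $ Inr ())" for x
  define R where "R x v i j = complex_of_real (rot_form \<beta> x v $ i $ j)" for x v i j
  have smooth_G: "smooth_on G \<Omega>" by (rule parallel_frame_smooth[OF \<Omega>(1) smooth_\<theta> G])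
  have smooth_f: "smooth_on f \<Omega>"
    unfolding f_def[abs_def] by (intro smooth_on_vec[OF \<Omega>(1)] smooth_on_nth[OF \<Omega>(1)] smooth_G)
  have G_nth: "((\<lambda>y. G y $ r $ s) has_derivative (\<lambda>v. (G x ** \<theta> x v) $ r $ s)) (at x)" if "x \<in> \<Omega>" for x r s
    by (intro bounded_linear.has_derivative[OF bounded_linear_vec_nth] G[OF that])
  have DU: "((\<lambda>y. U y $ a $ j) has_derivative (\<lambda>v. (\<Sum>k\<in>UNIV. U x $ a $ k * R x v k j) + \<i> * of_real (v $ j) * U x $ a $ j)) (at x)"
    if "x \<in> \<Omega>" for x a j
    using G_nth[OF that, of "Inl a" "Inl j"] unfolding \<theta>_def lax_form_mult by (simp add: U_def R_def)
  have Df: "(f has_derivative (\<lambda>v. \<chi> a. \<Sum>k\<in>UNIV. U x $ a $ k * of_real (v $ k * h x $ k))) (at x)"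
    if "x \<in> \<Omega>" for x
    unfolding f_def[abs_def]
    using G_nth[OF that, of "Inl _" "Inr ()"] unfolding \<theta>_def lax_form_mult
    by (intro has_derivative_vec) (simp add: U_def)
  have R_skew: "R x v m k = - R x v k m" if "x \<in> \<Omega>" for x v m k
  proof -
    have "\<beta> x $ m $ k = \<beta> x $ k $ m" 
      using arg_cong[OF sym[OF that], of "\<lambda>M. M $ k $ m"] by (simp add: transpose_def)
    then show ?thesis by (simp add: R_def rot_form_nth algebra_simps)
  qed
  have cnj_R: "cnj (R x v i j) = R x v i j" for x v i j by (simp add: R_def)
  \<comment> \<open>U U^* is constant because i\<delta> + [\<delta>, \<beta>] is skew-Hermitian.\<close>
  have unitary: "(\<Sum>k\<in>UNIV. U x $ r $ k * cnj (U x $ s $ k)) = (if r = s then 1 else 0)" if x: "x \<in> \<Omega>" for x r s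
  proof -
    have "((\<lambda>y. \<Sum>k\<in>UNIV. U y $ r $ k * cnj (U y $ s $ k)) has_derivative (\<lambda>v. 0)) (at y)" if y: "y \<in> \<Omega>" for y
    proof (rule has_derivative_eq_rhs)
      show "((\<lambda>y. \<Sum>k\<in>UNIV. U y $ r $ k * cnj (U y $ s $ k)) has_derivative
        (\<lambda>v. \<Sum>k\<in>UNIV. U y $ r $ k * cnj ((\<Sum>m\<in>UNIV. U y $ s $ m * R y v m k) + \<i> * of_real (v $ k) * U y $ s $ k)
          + ((\<Sum>m\<in>UNIV. U y $ r $ m * R y v m k) + \<i> * of_real (v $ k) * U y $ r $ k) * cnj (U y $ s $ k))) (at y)"
        by (intro has_derivative_sum has_derivative_mult DU[OF y] bounded_linear.has_derivative[OF bounded_linear_cnj])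
      show "(\<lambda>v. \<Sum>k\<in>UNIV. U y $ r $ k * cnj ((\<Sum>m\<in>UNIV. U y $ s $ m * R y v m k) + \<i> * of_real (v $ k) * U y $ s $ k)
          + ((\<Sum>m\<in>UNIV. U y $ r $ m * R y v m k) + \<i> * of_real (v $ k) * U y $ r $ k) * cnj (U y $ s $ k)) = (\<lambda>v. 0)"
      proof
        fix v
        have summand: "U y $ r $ k * cnj ((\<Sum>m\<in>UNIV. U y $ s $ m * R y v m k) + \<i> * of_real (v $ k) * U y $ s $ k)
            + ((\<Sum>m\<in>UNIV. U y $ r $ m * R y v m k) + \<i> * of_real (v $ k) * U y $ r $ k) * cnj (U y $ s $ k)
          = (\<Sum>m\<in>UNIV. U y $ r $ k * cnj (U y $ s $ m) * R y v m k)
            + (\<Sum>m\<in>UNIV. U y $ r $ m * cnj (U y $ s $ k) * R y v m k)" for k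
          by (simp add: cnj_R sum_distrib_left sum_distrib_right distrib_left distrib_right right_diff_distrib mult_ac)
        have "(\<Sum>k\<in>UNIV. U y $ r $ k * cnj ((\<Sum>m\<in>UNIV. U y $ s $ m * R y v m k) + \<i> * of_real (v $ k) * U y $ s $ k)
            + ((\<Sum>m\<in>UNIV. U y $ r $ m * R y v m k) + \<i> * of_real (v $ k) * U y $ r $ k) * cnj (U y $ s $ k))
          = (\<Sum>k\<in>UNIV. \<Sum>m\<in>UNIV. U y $ r $ k * cnj (U y $ s $ m) * R y v m k)
            + (\<Sum>k\<in>UNIV. \<Sum>m\<in>UNIV. U y $ r $ m * cnj (U y $ s $ k) * R y v m k)"
          unfolding summand by (rule sum.distrib)
        also have "(\<Sum>k\<in>UNIV. \<Sum>m\<in>UNIV. U y $ r $ m * cnj (U y $ s $ k) * R y v m k)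
            = (\<Sum>k\<in>UNIV. \<Sum>m\<in>UNIV. U y $ r $ k * cnj (U y $ s $ m) * R y v k m)"
          by (rule sum.swap)
        also have "\<dots> = - (\<Sum>k\<in>UNIV. \<Sum>m\<in>UNIV. U y $ r $ k * cnj (U y $ s $ m) * R y v m k)"
          by (subst R_skew[OF y]) (simp add: sum_negf)
        finally show "(\<Sum>k\<in>UNIV. U y $ r $ k * cnj ((\<Sum>m\<in>UNIV. U y $ s $ m * R y v m k) + \<i> * of_real (v $ k) * U y $ s $ k)
            + ((\<Sum>m\<in>UNIV. U y $ r $ m * R y v m k) + \<i> * of_real (v $ k) * U y $ r $ k) * cnj (U y $ s $ k)) = 0"
          by simp
      qed
    qed
    from has_derivative_zero_unique_connected[OF \<Omega>(1,2) this x \<Omega>(4)]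
    have "(\<Sum>k\<in>UNIV. U x $ r $ k * cnj (U x $ s $ k)) = (\<Sum>k\<in>UNIV. U p $ r $ k * cnj (U p $ s $ k))" .
    also have "\<dots> = (if r = s then 1 else 0)"
      by (simp add: U_def Gp mat_def mult_delta_left if_distrib[of cnj] cong: if_cong)
    finally show ?thesis .
  qed
  have orth: "(\<Sum>a\<in>UNIV. cnj (U x $ a $ j) * U x $ a $ k) = (if j = k then 1 else 0)" if x: "x \<in> \<Omega>" for x j k
  proof -
    define V where "V = (\<chi> k a. cnj (U x $ a $ k))"
    have "U x ** V = mat 1"
      using unitary[OF x] by (simp add: V_def vec_eq_iff matrix_matrix_mult_def mat_def)
    then have "V ** U x = mat 1" using matrix_left_right_inverse by blast
    then have "(V ** U x) $ j $ k = mat 1 $ j $ k" by simp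
    then show ?thesis by (simp add: V_def matrix_matrix_mult_def mat_def)
  qed
  have Dif_f: "Dif f x v = (\<chi> a. \<Sum>k\<in>UNIV. U x $ a $ k * of_real (v $ k * h x $ k))" if "x \<in> \<Omega>" for x v
    using Dif_eq[OF Df[OF that]] by simp
  have herm_Df: "herm (Dif f x v) (Dif f x w) = of_real (\<Sum>i\<in>UNIV. (h x $ i)\<^sup>2 * (v $ i) * (w $ i))" if "x \<in> \<Omega>" for x v w
    unfolding Dif_f[OF that] herm_orthonormal_columns[OF orth[OF that]] by (simp add: power2_eq_square mult_ac)
  have lin: "linear (Dif f x)" if "x \<in> \<Omega>" for x
    by (rule Dif_linear[OF smooth_on_differentiable[OF smooth_f that]])
  have first: "first_form f x v w = (\<Sum>i\<in>UNIV. (h x $ i)\<^sup>2 * (v $ i) * (w $ i))" if "x \<in> \<Omega>" for x v w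
    unfolding first_form_def inner_eq_Re_herm herm_Df[OF that] by simp
  have lagr: "lagrangian_on \<Omega> f"
    unfolding lagrangian_on_def symp_def using herm_Df by simp
  have inj: "inj (Dif f x)" if x: "x \<in> \<Omega>" for x
    unfolding linear_injective_0[OF lin[OF x]]
  proof (intro allI impI)
    fix v assume "Dif f x v = 0"
    then have "(\<Sum>i\<in>UNIV. (h x $ i)\<^sup>2 * (v $ i) * (v $ i)) = 0"
      using first[OF x, of v v] by (simp add: first_form_def)
    then have "(\<Sum>i\<in>UNIV. (h x $ i * v $ i)\<^sup>2) = 0" by (simp add: power2_eq_square mult_ac)
    then have "(h x $ i * v $ i)\<^sup>2 = 0" for i
      using sum_nonneg_eq_0_iff[of UNIV "\<lambda>i. (h x $ i * v $ i)\<^sup>2"] by simp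
    then show "v = 0" using nz[OF x] by (simp add: vec_eq_iff)
  qed
  have second: "second_form f x v w = (\<Sum>i\<in>UNIV. (v $ i * w $ i) *\<^sub>R Jmul (pd i f x))" if x: "x \<in> \<Omega>" for x v w
  proof -
    \<comment> \<open>The tangential coefficients of the second derivative in the frame U; \<xi> is its normal part.\<close>
    define c where "c k = w $ k * Dif h x v $ k + (\<Sum>m\<in>UNIV. rot_form \<beta> x v $ k $ m * (w $ m * h x $ m))" for k
    define \<xi> where "\<xi> = (\<chi> a. \<Sum>k\<in>UNIV. U x $ a $ k * (\<i> * of_real (v $ k * w $ k * h x $ k)))"
    have h_nth: "((\<lambda>y. h y $ k) has_derivative (\<lambda>v. Dif h x v $ k)) (at x)" for k
      by (rule bounded_linear.has_derivative[OF bounded_linear_vec_nth smooth_on_has_derivative[OF h x]])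
    have "((\<lambda>y. \<chi> a. \<Sum>k\<in>UNIV. U y $ a $ k * of_real (w $ k * h y $ k)) has_derivative
      (\<lambda>v. \<chi> a. \<Sum>k\<in>UNIV. U x $ a $ k * of_real (w $ k * Dif h x v $ k)
        + ((\<Sum>m\<in>UNIV. U x $ a $ m * R x v m k) + \<i> * of_real (v $ k) * U x $ a $ k) * of_real (w $ k * h x $ k))) (at x)"
      by (intro has_derivative_vec has_derivative_sum has_derivative_mult DU[OF x] has_derivative_of_real
          has_derivative_mult_right h_nth)
    then have "((\<lambda>y. Dif f y w) has_derivative
      (\<lambda>v. \<chi> a. \<Sum>k\<in>UNIV. U x $ a $ k * of_real (w $ k * Dif h x v $ k)
        + ((\<Sum>m\<in>UNIV. U x $ a $ m * R x v m k) + \<i> * of_real (v $ k) * U x $ a $ k) * of_real (w $ k * h x $ k))) (at x)"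
      by (rule has_derivative_transform_within_open[OF _ \<Omega>(1) x]) (simp add: Dif_f)
    from Dif_eq[OF this] have Z: "Dif (\<lambda>y. Dif f y w) x v = (\<chi> a. \<Sum>k\<in>UNIV. U x $ a $ k * of_real (w $ k * Dif h x v $ k)
        + ((\<Sum>m\<in>UNIV. U x $ a $ m * R x v m k) + \<i> * of_real (v $ k) * U x $ a $ k) * of_real (w $ k * h x $ k))"
      by simp
    have "(\<Sum>k\<in>UNIV. (\<Sum>m\<in>UNIV. U x $ a $ m * R x v m k) * of_real (w $ k * h x $ k))
        = (\<Sum>m\<in>UNIV. U x $ a $ m * of_real (\<Sum>k\<in>UNIV. rot_form \<beta> x v $ m $ k * (w $ k * h x $ k)))" for a
      unfolding sum_distrib_right by (subst sum.swap) (simp add: R_def sum_distrib_left mult_ac)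
    then have "Dif (\<lambda>y. Dif f y w) x v - \<xi> = (\<chi> a. \<Sum>k\<in>UNIV. U x $ a $ k * of_real (c k))"
      unfolding Z by (simp add: vec_eq_iff \<xi>_def c_def sum.distrib distrib_left distrib_right mult_ac)
    also have "\<dots> = Dif f x (\<chi> k. c k / h x $ k)"
      using nz[OF x] by (simp add: Dif_f[OF x])
    finally have range: "Dif (\<lambda>y. Dif f y w) x v - \<xi> \<in> range (Dif f x)" by simp
    have "\<xi> \<bullet> Dif f x u = 0" for u
      unfolding inner_eq_Re_herm \<xi>_def Dif_f[OF x] herm_orthonormal_columns[OF orth[OF x]] by simp
    then have normal: "\<xi> \<in> normal_space_at f x" by (simp add: normal_space_at_def)
    have "pd i f x $ a = U x $ a $ i * of_real (h x $ i)" for i a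
      by (simp add: pd_def Dif_f[OF x] axis_def mult_delta_left mult_delta_right if_distrib[of complex_of_real] cong: if_cong)
    then have "\<xi> = (\<Sum>i\<in>UNIV. (v $ i * w $ i) *\<^sub>R Jmul (pd i f x))"
      by (simp add: \<xi>_def Jmul_def vec_eq_iff scaleR_conv_of_real[where 'a = complex] mult_ac)
    then show ?thesis
      using normal_part_eq[OF lin[OF x] normal range] by (simp add: second_form_def)
  qed
  have "curvature_coordinates \<Omega> f h"
    by unfold_locales (use \<Omega>(1) smooth_f h nz lagr first second in blast)+
  moreover have "immersion_on \<Omega> f"
    unfolding immersion_on_def using smooth_f inj by blast
  ultimately show ?thesis by (rule that)
qed

theorem theorem2p3:
  fixes \<Omega> :: "(real^'n::finite) set"
    and \<beta> :: "real^'n \<Rightarrow> real^'n^'n"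
    and h :: "real^'n \<Rightarrow> real^'n"
  assumes "open \<Omega>" "connected \<Omega>" "simply_connected \<Omega>" "0 \<in> \<Omega>"
    and "smooth_on \<beta> \<Omega>"
    and "\<And>x. x \<in> \<Omega> \<Longrightarrow> transpose (\<beta> x) = \<beta> x"
    and "\<And>x i. x \<in> \<Omega> \<Longrightarrow> \<beta> x $ i $ i = 0"
    and "smooth_on h \<Omega>"
    and "\<And>x i. x \<in> \<Omega> \<Longrightarrow> h x $ i \<noteq> 0"
  shows "(flat_lagrangian_data \<Omega> \<beta> h \<longleftrightarrow> solves_system \<Omega> (q_mat \<beta> h))
       \<and> (solves_system \<Omega> (q_mat \<beta> h) \<longleftrightarrow> (\<forall>lam::complex. flat_form_on \<Omega> (lax_form \<beta> h lam)))"
proof -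
  have d\<beta>: "\<And>x. x \<in> \<Omega> \<Longrightarrow> \<beta> differentiable (at x)" and dh: "\<And>x. x \<in> \<Omega> \<Longrightarrow> h differentiable (at x)"
    using smooth_on_differentiable[OF assms(5)] smooth_on_differentiable[OF assms(8)] by blast+
  let ?Q = "\<forall>x\<in>\<Omega>. \<forall>v w. curvature (rot_form \<beta>) x v w = 0 \<and> torsion \<beta> h x v w = 0"
  have b: "solves_system \<Omega> (q_mat \<beta> h) \<longleftrightarrow> ?Q"
    by (rule solves_system_iff[OF d\<beta> dh assms(6)])
  have c: "flat_form_on \<Omega> (lax_form \<beta> h lam) \<longleftrightarrow> ?Q" for lam
    by (rule flat_lax_form_iff[OF d\<beta> dh])
  have a: "flat_lagrangian_data \<Omega> \<beta> h \<longleftrightarrow> ?Q"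
  proof
    assume data: "flat_lagrangian_data \<Omega> \<beta> h"
    have hd: "\<forall>x\<in>\<Omega>. \<forall>i j. i \<noteq> j \<longrightarrow> pd j (\<lambda>y. h y $ i) x = \<beta> x $ i $ j * h x $ j"
      using data[unfolded flat_lagrangian_data_def] by (rule conjunct2)
    obtain f where f: "immersion_on \<Omega> f \<and> lagrangian_on \<Omega> f \<and> flat_immersion_on \<Omega> f
        \<and> nondegenerate_normal_bundle_on \<Omega> f
        \<and> (\<forall>x\<in>\<Omega>. \<forall>v w. first_form f x v w = (\<Sum>i\<in>UNIV. (h x $ i)\<^sup>2 * (v $ i) * (w $ i)))
        \<and> (\<forall>x\<in>\<Omega>. \<forall>v w. second_form f x v w = (\<Sum>i\<in>UNIV. (v $ i * w $ i) *\<^sub>R Jmul (pd i f x)))"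
      using data[unfolded flat_lagrangian_data_def, THEN conjunct1] by (rule exE)
    interpret curvature_coordinates \<Omega> f h
    proof
      show "smooth_on f \<Omega>" using f by (simp only: immersion_on_def simp_thms)
      show "lagrangian_on \<Omega> f" using f by (simp only: simp_thms)
    qed (use assms f in blast)+
    show ?Q
    proof (intro ballI allI conjI)
      fix x v w assume x: "x \<in> \<Omega>"
      show "curvature (rot_form \<beta>) x v w = 0"
        by (rule rotation_coefficients_flat[OF assms(5,6) _ x]) (use hd in \<open>blast intro: x\<close>)+
      show "torsion \<beta> h x v w = 0"
        using torsion_eq_0_iff(1)[OF dh[OF x], of \<beta>] hd x by blast
    qed
  next
    assume Q: ?Q
    then have "flat_form_on \<Omega> (lax_form \<beta> h 1)" using c by (rule iffD2[rotated])
    from immersion_from_flat_lax_form[OF assms(1-5,8,6,9) this]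
    obtain f where cc: "curvature_coordinates \<Omega> f h" and imm: "immersion_on \<Omega> f" by blast
    interpret curvature_coordinates \<Omega> f h by (rule cc)
    have "pd j (\<lambda>y. h y $ i) x = \<beta> x $ i $ j * h x $ j" if "x \<in> \<Omega>" "i \<noteq> j" for x i j
    proof -
      have "\<forall>v w. torsion \<beta> h x v w = 0" using Q that(1) by simp
      then show ?thesis using torsion_eq_0_iff(1)[OF dh[OF that(1)], of \<beta>] that(2) by simp
    qed
    moreover have "\<forall>x\<in>\<Omega>. \<forall>v w. first_form f x v w = (\<Sum>i\<in>UNIV. (h x $ i)\<^sup>2 * (v $ i) * (w $ i))"
      by (intro ballI allI) (rule first_form)
    moreover have "\<forall>x\<in>\<Omega>. \<forall>v w. second_form f x v w = (\<Sum>i\<in>UNIV. (v $ i * w $ i) *\<^sub>R Jmul (pd i f x))"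
      by (intro ballI allI) (rule second_form)
    ultimately show "flat_lagrangian_data \<Omega> \<beta> h"
      unfolding flat_lagrangian_data_def
      using imm lagrangian flat_induced_metric nondegenerate_normal_bundle by (intro conjI exI[of _ f] ballI allI impI) simp_all
  qed
  show ?thesis unfolding a b c by simp
qed

end
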